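(* Let $Q=[0,1]^2$, let $S(x,y)$ be a real-valued $C^\infty$ phase function in $Q$, put $F=S''_{xy}$, let $\chi$ be a $C^\infty$ cutoff function supported in $Q$, and let $$T_\lambda f(x)=\int_{-\infty}^{\infty}e^{i\lambda S(x,y)}\chi(x,y)f(y)\,dy .$$ I. Let $B\ge 0$ be an integer and assume that $$F^{(1,0)}\ne 0,\qquad F^{(0,B)}\neq 0\qquad\text{everywhere in } Q .$$ Then $T_\lambda$ is bounded on $L^2(\mathbb{R})$ with $$\|T_\lambda\|\le C\lambda^{-\Delta},\qquad \Delta=\frac{B+1}{2(2B+1)},\qquad \lambda\ge 1.$$ II. Assume instead that $$F^{(2,0)}\neq 0,\qquad F^{(0,2)}\ne 0\qquad\text{everywhere in } Q .$$ Then $$\|T_\lambda\|\le C\lambda^{-1/4},\qquad \lambda\ge 1 .$$ In both parts $C$ is a constant independent of $\lambda$.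
   Context: Notation: $S''_{xy}=\partial_x\partial_yS$; $F^{(\alpha,\beta)}=\partial_x^\alpha\partial_y^\beta F$; $\|T_\lambda\|$ is the operator norm on $L^2(\mathbb{R})$. Smoothness in $Q$ is understood up to the boundary of the closed square. *)

theory Defs
  imports "HOL-Analysis.Analysis"
begin

definition unit_square :: "(real \<times> real) set"
  where "unit_square = {0..1} \<times> {0..1}"

text \<open>
  Partial derivatives relative to a set \<open>U\<close>. At a boundary point of the closed square the
  slice of \<open>U\<close> makes them one-sided. They are meant for \<open>U\<close> a product of nondegenerate intervals
  (here: the closed square or the whole plane), where \<^const>\<open>vector_derivative\<close> is unique
  at every point of \<open>U\<close>; off \<open>U\<close> the values are irrelevant.
\<close>

definition partial_x ::
    "(real \<times> real) set \<Rightarrow> (real \<times> real \<Rightarrow> 'a::real_normed_vector) \<Rightarrow> real \<times> real \<Rightarrow> 'a"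
  where "partial_x U f = (\<lambda>(x, y). vector_derivative (\<lambda>t. f (t, y)) (at x within {t. (t, y) \<in> U}))"

definition partial_y ::
    "(real \<times> real) set \<Rightarrow> (real \<times> real \<Rightarrow> 'a::real_normed_vector) \<Rightarrow> real \<times> real \<Rightarrow> 'a"
  where "partial_y U f = (\<lambda>(x, y). vector_derivative (\<lambda>t. f (x, t)) (at y within {t. (x, t) \<in> U}))"

definition mixed_partial ::
    "(real \<times> real) set \<Rightarrow> nat \<Rightarrow> nat \<Rightarrow> (real \<times> real \<Rightarrow> 'a::real_normed_vector) \<Rightarrow> real \<times> real \<Rightarrow> 'a"
  where "mixed_partial U a b f = (partial_x U ^^ a) ((partial_y U ^^ b) f)"

text \<open>On the closed square this is smoothness up to the boundary.\<close>

primrec Ck_on ::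
    "nat \<Rightarrow> (real \<times> real) set \<Rightarrow> (real \<times> real \<Rightarrow> 'a::real_normed_vector) \<Rightarrow> bool"
  where
    "Ck_on 0 U f \<longleftrightarrow> continuous_on U f"
  | "Ck_on (Suc k) U f \<longleftrightarrow>
       continuous_on U f \<and>
       (\<forall>(x, y) \<in> U. (\<lambda>t. f (t, y)) differentiable (at x within {t. (t, y) \<in> U}) \<and>
                    (\<lambda>t. f (x, t)) differentiable (at y within {t. (x, t) \<in> U})) \<and>
       Ck_on k U (partial_x U f) \<and> Ck_on k U (partial_y U f)"

definition smooth_on :: "(real \<times> real) set \<Rightarrow> (real \<times> real \<Rightarrow> 'a::real_normed_vector) \<Rightarrow> bool"
  where "smooth_on U f \<longleftrightarrow> (\<forall>k. Ck_on k U f)"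

text \<open>
  Representatives of the elements of \<open>L\<^sup>2(\<real>)\<close>. Every class of Lebesgue measurable functions has a
  Borel representative, so nothing is lost by working with \<^const>\<open>lborel\<close>.
\<close>

definition L2_space :: "(real \<Rightarrow> complex) set"
  where "L2_space = {f \<in> borel_measurable lborel. integrable lborel (\<lambda>x. (norm (f x))\<^sup>2)}"

definition L2_norm :: "(real \<Rightarrow> complex) \<Rightarrow> real"
  where "L2_norm f = sqrt (LINT x|lborel. (norm (f x))\<^sup>2)"

text \<open>
  Linearity is required only almost everywhere; together with the norm bound it makes \<open>T\<close>
  respect equality almost everywhere, so that \<open>T\<close> acts on the classes.
\<close>

definition L2_bounded_linear :: "((real \<Rightarrow> complex) \<Rightarrow> real \<Rightarrow> complex) \<Rightarrow> bool"
  where "L2_bounded_linear T \<longleftrightarrow>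
    (\<forall>f\<in>L2_space. T f \<in> L2_space) \<and>
    (\<forall>f\<in>L2_space. \<forall>g\<in>L2_space. AE x in lborel. T (\<lambda>y. f y + g y) x = T f x + T g x) \<and>
    (\<forall>c. \<forall>f\<in>L2_space. AE x in lborel. T (\<lambda>y. c * f y) x = c * T f x) \<and>
    (\<exists>K. \<forall>f\<in>L2_space. L2_norm (T f) \<le> K * L2_norm f)"

text \<open>
  The analogue of \<^const>\<open>onorm\<close>; the quotient is \<open>0\<close> when \<open>f\<close> vanishes almost everywhere.
  The supremum is meaningful only for operators satisfying \<^const>\<open>L2_bounded_linear\<close>.
\<close>

definition L2_onorm :: "((real \<Rightarrow> complex) \<Rightarrow> real \<Rightarrow> complex) \<Rightarrow> real"
  where "L2_onorm T = (SUP f\<in>L2_space. L2_norm (T f) / L2_norm f)"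

definition osc_op ::
    "(real \<times> real \<Rightarrow> real) \<Rightarrow> (real \<times> real \<Rightarrow> complex) \<Rightarrow> real \<Rightarrow> (real \<Rightarrow> complex) \<Rightarrow> real \<Rightarrow> complex"
  where "osc_op S chi l f =
    (\<lambda>x. LINT y|lborel. exp (\<i> * complex_of_real (l * S (x, y))) * chi (x, y) * f y)"

end

theory Submission
  imports Defs
begin

text \<open>
  The operator is cut into pieces on which the mixed derivative \<open>F\<close> has a fixed size. Write \<open>\<lambda>\<close> for the
  large parameter (the variable \<open>l\<close> below). On the part of the square where \<open>\<bar>F\<bar> \<le> \<delta>\<close>
  only the size of the kernel matters: since \<open>\<partial>\<^sub>x\<^sup>a F\<close> and \<open>\<partial>\<^sub>y\<^sup>b F\<close> do not
  vanish, its horizontal and vertical sections have length \<open>O(\<delta>\<^bsup>1/a\<^esup>)\<close> and \<open>O(\<delta>\<^bsup>1/b\<^esup>)\<close>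
  (\<open>measure_sublevel_le\<close>), so Schur's test bounds the norm by \<open>O(\<delta>\<^bsup>(1/a + 1/b)/2\<^esup>)\<close>. On a shell
  \<open>\<delta> < \<bar>F\<bar> \<le> 2\<delta>\<close> the kernel oscillates, and the norm is essentially \<open>O((\<lambda>\<delta>)\<^bsup>-1/2\<^esup>)\<close>. The two bounds
  agree at the scale \<open>\<delta>\<^sub>0\<close> with \<open>\<lambda> \<delta>\<^sub>0\<^bsup>1 + 1/a + 1/b\<^esup> = 1\<close>, and there both are
  \<open>\<lambda>\<close> to the power \<open>-(1/a + 1/b) / (2 (1 + 1/a + 1/b))\<close>. This exponent is \<open>-(B+1) / (2(2B+1))\<close> for
  \<open>a = 1\<close>, \<open>b = B\<close> and \<open>-1/4\<close> for \<open>a = b = 2\<close>. Beyond \<open>\<delta>\<^sub>0\<close> the shells \<open>\<delta> = 2\<^sup>j \<delta>\<^sub>0\<close> contribute a geometric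
  series, so that nothing is lost in the sum.

  A shell is treated by the \<open>T T\<^sup>*\<close> method. The kernel of \<open>T T\<^sup>*\<close> at \<open>(x\<^sub>2, x\<^sub>1)\<close> is an oscillatory integral
  in \<open>y\<close> whose phase has derivative \<open>\<phi>(y) = \<integral> F(u,y) du\<close>, taken over \<open>u\<close> from \<open>x\<^sub>1\<close> to \<open>x\<^sub>2\<close>. The cutoffs
  to the shells are sharp, so the integrand lives on the set where \<open>F(x\<^sub>1,y)\<close> and \<open>F(x\<^sub>2,y)\<close> both lie in
  \<open>(\<delta>, 2\<delta>]\<close>. This set and the intervals of monotonicity of \<open>\<phi>\<close> are delimited by the zeros of functions
  whose \<open>b\<close>-th derivative (for \<open>\<phi>\<close> itself: \<open>\<integral> \<partial>\<^sub>y\<^sup>b F du\<close>) does not vanish, and by Rolle's theorem there are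
  \<open>O(b)\<close> of them. If \<open>x\<^sub>1\<close> and \<open>x\<^sub>2\<close> are so close that \<open>F(\<cdot>,y)\<close> cannot dip below \<open>\<delta>/2\<close> between them,
  van der Corput's lemma applies on each piece and gives \<open>O(1 / (\<lambda> \<delta> \<bar>x\<^sub>1 - x\<^sub>2\<bar>))\<close>. The closeness is
  \<open>\<bar>x\<^sub>1 - x\<^sub>2\<bar> \<le> \<kappa> \<delta>\<^bsup>1/a\<^esup>\<close>, and it is arranged by cutting the \<open>x\<close>-axis into cells of that length: a horizontal
  line meets the shell in boundedly many cells, which makes the pieces almost orthogonal
  (\<open>localized_TT_star_bound\<close>).

  The decay \<open>1 / \<bar>x\<^sub>1 - x\<^sub>2\<bar>\<close> is not integrable. Interpolating it with the trivial bound
  \<open>O(\<delta>\<^bsup>1/b\<^esup>)\<close> for the kernel costs the factor \<open>(\<lambda> \<delta>\<^bsup>1 + 1/a + 1/b\<^esup>)\<^bsup>1/8\<^esup>\<close>, which is \<open>1\<close> at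
  \<open>\<delta>\<^sub>0\<close> and grows slowly enough with \<open>\<delta>\<close> to be absorbed by the geometric series. For \<open>B = 0\<close> there is no
  such series; then \<open>F\<close> does not vanish at all, the smooth kernel is kept in one piece, and integrating by
  parts twice gives the integrable decay \<open>(\<lambda> \<bar>x\<^sub>1 - x\<^sub>2\<bar>)\<^bsup>-2\<^esup>\<close>.
\<close>

section \<open>Zeros and small values of a function with a nonvanishing derivative\<close>

text \<open>
  All interval decompositions go through this lemma: \<open>P\<close> contains the breakpoints, and the
  quantity \<open>\<mu>\<close> (a count, a length, the absolute value of an integral) is controlled on
  intervals without one.
\<close>

lemma subadditive_pieces_bound:
  fixes \<mu> :: "real \<Rightarrow> real \<Rightarrow> real"
  assumes fin: "finite P"
    and sub: "\<And>a p b. lo \<le> a \<Longrightarrow> a \<le> p \<Longrightarrow> p \<le> b \<Longrightarrow> b \<le> hi \<Longrightarrow> \<mu> a b \<le> \<mu> a p + \<mu> p b"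
    and piece: "\<And>c d. lo \<le> c \<Longrightarrow> c \<le> d \<Longrightarrow> d \<le> hi \<Longrightarrow> {c<..<d} \<inter> P = {} \<Longrightarrow> \<mu> c d \<le> M"
    and "0 \<le> M" "lo \<le> hi"
  shows "\<mu> lo hi \<le> (real (card P) + 1) * M"
proof -
  have *: "\<mu> a b \<le> (real (card (P \<inter> {a<..<b})) + 1) * M" if "lo \<le> a" "a \<le> b" "b \<le> hi" for a b
    using that
  proof (induction "card (P \<inter> {a<..<b})" arbitrary: a b rule: less_induct)
    case less
    show ?case
    proof (cases "P \<inter> {a<..<b} = {}")
      case True
      then show ?thesis using piece[of a b] less.prems by (auto simp: Int_commute)
    next
      case False
      then obtain p where p: "p \<in> P" "a < p" "p < b" by auto
      let ?A = "P \<inter> {a<..<p}" and ?B = "P \<inter> {p<..<b}"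
      have eq: "P \<inter> {a<..<b} = insert p (?A \<union> ?B)" using p by auto
      have "card (P \<inter> {a<..<b}) = Suc (card ?A + card ?B)"
        unfolding eq using fin by (subst card_insert_disjoint) (auto intro!: card_Un_disjoint)
      moreover from this have "\<mu> a p \<le> (real (card ?A) + 1) * M" "\<mu> p b \<le> (real (card ?B) + 1) * M"
        using less.hyps[of a p] less.hyps[of p b] p less.prems by auto
      moreover have "\<mu> a b \<le> \<mu> a p + \<mu> p b" using sub[of a p b] p less.prems by auto
      ultimately show ?thesis by (simp add: algebra_simps)
    qed
  qed
  have "card (P \<inter> {lo<..<hi}) \<le> card P" using fin by (intro card_mono) auto
  then have "(real (card (P \<inter> {lo<..<hi})) + 1) * M \<le> (real (card P) + 1) * M"
    using \<open>0 \<le> M\<close> by (intro mult_right_mono) auto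
  then show ?thesis using *[of lo hi] \<open>lo \<le> hi\<close> by auto
qed

lemma mean_value_within:
  fixes f f' :: "real \<Rightarrow> real"
  assumes "p < q" "{p..q} \<subseteq> S"
    and d: "\<And>t. t \<in> S \<Longrightarrow> (f has_real_derivative f' t) (at t within S)"
  shows "\<exists>z\<in>{p<..<q}. f q - f p = f' z * (q - p)"
proof (rule mvt_simple[OF \<open>p < q\<close>])
  fix t assume "p \<le> t" "t \<le> q"
  then show "(f has_derivative (*) (f' t)) (at t within {p..q})"
    unfolding has_field_derivative_def[symmetric] using assms(2) by (intro DERIV_subset[OF d]) auto
qed

text \<open>
  By the mean value theorem an interval without zeros of the derivative contains at most
  one zero, so each derivative adds one zero. Finite subsets \<open>Z\<close> of the zero set are
  counted, because finiteness has to be proved as well.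
\<close>

lemma card_zeros_le:
  fixes D :: "nat \<Rightarrow> real \<Rightarrow> real"
  assumes "\<And>k y. k < n \<Longrightarrow> y \<in> {0..1} \<Longrightarrow> (D k has_real_derivative D (Suc k) y) (at y within {0..1})"
    and "\<And>y. y \<in> {0..1} \<Longrightarrow> D n y \<noteq> 0"
  shows "finite {y\<in>{0..1}. D 0 y = 0} \<and> card {y\<in>{0..1}. D 0 y = 0} \<le> n"
  using assms
proof (induction n arbitrary: D)
  case 0
  then have "{y\<in>{0..1}. D 0 y = 0} = {}" by auto
  then show ?case by (metis card.empty finite.emptyI le0)
next
  case (Suc n)
  let ?Z = "{y\<in>{0..1}. D 0 y = 0}" and ?P = "{y\<in>{0..1}. D (Suc 0) y = 0}"
  have P: "finite ?P" "card ?P \<le> n"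
    using Suc.IH[of "\<lambda>k. D (Suc k)"] Suc.prems by auto
  have der: "(D 0 has_real_derivative D (Suc 0) y) (at y within {0..1})" if "y \<in> {0..1}" for y
    using Suc.prems(1)[of 0 y] that by auto
  have bd: "card Z \<le> Suc n" if Z: "Z \<subseteq> ?Z" "finite Z" for Z
  proof -
    have "real (card (Z \<inter> {0..1})) \<le> (real (card ?P) + 1) * 1"
    proof (rule subadditive_pieces_bound[where \<mu> = "\<lambda>a b. real (card (Z \<inter> {a..b}))" and lo=0 and hi=1, OF P(1)])
      fix a p b :: real assume "0 \<le> a" "a \<le> p" "p \<le> b" "b \<le> 1"
      then have "Z \<inter> {a..b} = (Z \<inter> {a..p}) \<union> (Z \<inter> {p..b})" by auto
      then have "card (Z \<inter> {a..b}) \<le> card (Z \<inter> {a..p}) + card (Z \<inter> {p..b})"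
        using card_Un_le by metis
      then show "real (card (Z \<inter> {a..b})) \<le> real (card (Z \<inter> {a..p})) + real (card (Z \<inter> {p..b}))"
        by linarith
    next
      fix c d :: real assume cd: "0 \<le> c" "c \<le> d" "d \<le> 1" "{c<..<d} \<inter> ?P = {}"
      have "s = t" if st: "s \<in> Z \<inter> {c..d}" "t \<in> Z \<inter> {c..d}" for s t
      proof -
        have False if s: "s \<in> Z \<inter> {c..d}" and t: "t \<in> Z \<inter> {c..d}" and "s < t" for s t
        proof -
          obtain z where z: "z \<in> {s<..<t}" "D 0 t - D 0 s = D (Suc 0) z * (t - s)"
            using mean_value_within[OF \<open>s < t\<close> _ der] s t cd(1-3) by auto
          moreover have "D 0 s = 0" "D 0 t = 0" using subsetD[OF Z(1)] s t by auto
          ultimately have "D (Suc 0) z = 0" using \<open>s < t\<close> by simp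
          then have "z \<in> {c<..<d} \<inter> ?P" using cd(1-3) z s t by auto
          then show False using cd(4) by blast
        qed
        then show ?thesis using st by (metis linorder_neqE)
      qed
      then have "card (Z \<inter> {c..d}) \<le> Suc 0" using card_le_Suc0_iff_eq[of "Z \<inter> {c..d}"] Z(2) by auto
      then show "real (card (Z \<inter> {c..d})) \<le> 1" by auto
    qed auto
    moreover have "Z \<inter> {0..1} = Z" using Z by auto
    ultimately show ?thesis using P(2) by auto
  qed
  have "finite ?Z \<and> card ?Z \<le> Suc n"
    by (rule finite_if_finite_subsets_card_bdd) (use bd in blast)
  then show ?case .
qed

text \<open>
  The difference \<open>f(t + h/2) - f(t)\<close> is at most \<open>2\<delta>\<close>, and by the mean value theorem its
  derivative of order \<open>n - 1\<close> is at least \<open>c h/2\<close>; this gives an induction on \<open>n\<close>.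
\<close>

lemma length_of_small_interval:
  fixes D :: "nat \<Rightarrow> real \<Rightarrow> real"
  assumes "\<And>k y. k < n \<Longrightarrow> y \<in> {a..a+h} \<Longrightarrow> (D k has_real_derivative D (Suc k) y) (at y within {a..a+h})"
    and "\<And>y. y \<in> {a..a+h} \<Longrightarrow> c \<le> \<bar>D n y\<bar>"
    and "\<And>y. y \<in> {a..a+h} \<Longrightarrow> \<bar>D 0 y\<bar> \<le> \<delta>"
    and "0 \<le> h" "0 \<le> c"
  shows "c * h ^ n \<le> 4 ^ (n * n) * \<delta>"
  using assms
proof (induction n arbitrary: D a h c \<delta>)
  case 0
  then show ?case using order_trans[OF "0.prems"(2)[of a] "0.prems"(3)[of a]] by auto
next
  case (Suc n)
  let ?h = "h/2"
  let ?D = "\<lambda>k t. D k (t + ?h) - D k t"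
  have "0 \<le> \<delta>" using Suc.prems(3)[of a] Suc.prems(4) by auto
  have IH: "(c * ?h) * ?h ^ n \<le> 4 ^ (n * n) * (2 * \<delta>)"
  proof (rule Suc.IH[of a ?h ?D])
    fix k y assume k: "k < n" and y: "y \<in> {a..a+?h}"
    have 1: "(D k has_real_derivative D (Suc k) y) (at y within {a..a+?h})"
      by (rule DERIV_subset[OF Suc.prems(1)]) (use k y Suc.prems(4) in auto)
    have "(D k has_real_derivative D (Suc k) (y + ?h)) (at (y + ?h) within (\<lambda>t. t + ?h) ` {a..a+?h})"
      by (rule DERIV_subset[OF Suc.prems(1)]) (use k y Suc.prems(4) in auto)
    moreover have "((\<lambda>t. t + ?h) has_real_derivative 1) (at y within {a..a+?h})"
      by (auto intro!: derivative_eq_intros)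
    ultimately have "(D k \<circ> (\<lambda>t. t + ?h) has_real_derivative D (Suc k) (y + ?h) * 1) (at y within {a..a+?h})"
      by (rule DERIV_image_chain)
    then have "((\<lambda>t. D k (t + ?h)) has_real_derivative D (Suc k) (y + ?h)) (at y within {a..a+?h})"
      by (simp add: o_def)
    from DERIV_diff[OF this 1]
    show "((\<lambda>t. D k (t + ?h) - D k t) has_real_derivative D (Suc k) (y + ?h) - D (Suc k) y) (at y within {a..a+?h})" .
  next
    fix y assume y: "y \<in> {a..a+?h}"
    show "c * ?h \<le> \<bar>?D n y\<bar>"
    proof (cases "h = 0")
      case False
      then have hpos: "h > 0" using Suc.prems by auto
      have "\<exists>x\<in>{y<..<y + ?h}. D n (y + ?h) - D n y = D (Suc n) x * (y + ?h - y)"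
        using hpos y by (intro mean_value_within[OF _ _ Suc.prems(1)]) auto
      then obtain x where x: "x \<in> {y<..<y + ?h}" "?D n y = D (Suc n) x * ?h" by auto
      have "c \<le> \<bar>D (Suc n) x\<bar>" using Suc.prems(2)[of x] x y by auto
      moreover have "\<bar>?D n y\<bar> = \<bar>D (Suc n) x\<bar> * ?h" using hpos unfolding x(2) abs_mult by simp
      ultimately show ?thesis using hpos by (simp add: mult_right_mono)
    qed auto
  next
    fix y assume y: "y \<in> {a..a+?h}"
    have "\<bar>D 0 (y + ?h)\<bar> \<le> \<delta>" "\<bar>D 0 y\<bar> \<le> \<delta>" using Suc.prems(3) y by auto
    then show "\<bar>?D 0 y\<bar> \<le> 2 * \<delta>" by linarith
  qed (use Suc.prems in auto)
  have "c * h ^ Suc n = 2 ^ Suc n * ((c * ?h) * ?h ^ n)"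
    by (simp add: power_divide field_simps)
  also have "\<dots> \<le> 2 ^ Suc n * (4 ^ (n * n) * (2 * \<delta>))"
    using IH by (intro mult_left_mono) auto
  also have "\<dots> = 2 ^ (n + 2 + 2 * (n * n)) * \<delta>"
    by (simp add: power_add power_mult)
  also have "\<dots> \<le> 2 ^ (2 * (Suc n * Suc n)) * \<delta>"
    using \<open>0 \<le> \<delta>\<close> by (intro mult_right_mono power_increasing) auto
  also have "\<dots> = 4 ^ (Suc n * Suc n) * \<delta>" unfolding power_mult[of 2 2] by simp
  finally show ?case .
qed

text \<open>
  Between the zeros of \<open>f - \<delta>\<close> and \<open>f + \<delta>\<close> the function is either small throughout, and
  then the interval is short, or small at most at the endpoints.
\<close>

lemma sublevel_pieces:
  fixes D :: "nat \<Rightarrow> real \<Rightarrow> real"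
  assumes D: "\<And>k y. k < n \<Longrightarrow> y \<in> {0..1} \<Longrightarrow> (D k has_real_derivative D (Suc k) y) (at y within {0..1})"
    and Dn: "\<And>y. y \<in> {0..1} \<Longrightarrow> c \<le> \<bar>D n y\<bar>"
    and "0 < c" "0 < \<delta>" "0 < n"
  obtains P where "finite P" "card P \<le> 2 * n"
    "\<And>u v. \<lbrakk>0 \<le> u; u \<le> v; v \<le> 1; {u<..<v} \<inter> P = {}\<rbrakk> \<Longrightarrow>
       v - u \<le> (4 ^ (n * n) * \<delta> / c) powr (1 / n) \<or> {y\<in>{u..v}. \<bar>D 0 y\<bar> \<le> \<delta>} \<subseteq> {u, v}"
proof -
  let ?Z = "\<lambda>s. {y\<in>{0..1}. D 0 y - s = 0}"
  have Z: "finite (?Z s) \<and> card (?Z s) \<le> n" for s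
  proof -
    let ?E = "\<lambda>k. if k = 0 then (\<lambda>y. D 0 y - s) else D k"
    have "finite {y\<in>{0..1}. ?E 0 y = 0} \<and> card {y\<in>{0..1}. ?E 0 y = 0} \<le> n"
    proof (rule card_zeros_le[where D = ?E and n = n])
      fix k and y :: real assume "k < n" "y \<in> {0..1}"
      then show "(?E k has_real_derivative ?E (Suc k) y) (at y within {0..1})"
        using D[of k y] by (cases k) (auto intro!: derivative_eq_intros)
    next
      fix y :: real assume "y \<in> {0..1}"
      then show "?E n y \<noteq> 0" using Dn[of y] \<open>0 < c\<close> \<open>0 < n\<close> by auto
    qed
    then show ?thesis by simp
  qed
  have cont: "continuous_on {0..1} (D 0)"
    by (rule DERIV_continuous_on[where D = "D (Suc 0)"]) (use D[of 0] \<open>0 < n\<close> in auto)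
  show ?thesis
  proof (rule that[of "?Z \<delta> \<union> ?Z (-\<delta>)"])
    show "finite (?Z \<delta> \<union> ?Z (-\<delta>))" using Z[of \<delta>] Z[of "-\<delta>"] by auto
    show "card (?Z \<delta> \<union> ?Z (-\<delta>)) \<le> 2 * n"
      using card_Un_le[of "?Z \<delta>" "?Z (-\<delta>)"] Z[of \<delta>] Z[of "-\<delta>"] by linarith
  next
    fix u v :: real assume uv: "0 \<le> u" "u \<le> v" "v \<le> 1" "{u<..<v} \<inter> (?Z \<delta> \<union> ?Z (-\<delta>)) = {}"
    have contabs: "continuous_on {0..1} (\<lambda>y. \<bar>D 0 y\<bar>)" using cont by (intro continuous_intros)
    show "v - u \<le> (4 ^ (n * n) * \<delta> / c) powr (1 / n) \<or> {y\<in>{u..v}. \<bar>D 0 y\<bar> \<le> \<delta>} \<subseteq> {u, v}"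
    proof (rule disjCI)
      assume "\<not> {y\<in>{u..v}. \<bar>D 0 y\<bar> \<le> \<delta>} \<subseteq> {u, v}"
      then obtain y0 where y0: "y0 \<in> {u<..<v}" "\<bar>D 0 y0\<bar> \<le> \<delta>" by force
      have sm: "\<bar>D 0 y\<bar> \<le> \<delta>" if y: "y \<in> {u<..<v}" for y
      proof (rule ccontr)
        assume "\<not> \<bar>D 0 y\<bar> \<le> \<delta>"
        then have "\<delta> \<in> closed_segment \<bar>D 0 y0\<bar> \<bar>D 0 y\<bar>"
          using y0 by (auto simp: closed_segment_eq_real_ivl)
        moreover have "continuous_on (closed_segment y0 y) (\<lambda>y. \<bar>D 0 y\<bar>)"
          using y y0 uv by (intro continuous_on_subset[OF contabs]) (auto simp: closed_segment_eq_real_ivl split: if_splits)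
        ultimately have "\<exists>z\<in>closed_segment y0 y. \<bar>D 0 z\<bar> = \<delta>"
          by (rule IVT'_closed_segment_real)
        then obtain z where z: "z \<in> closed_segment y0 y" "\<bar>D 0 z\<bar> = \<delta>" by blast
        have "z \<in> {u<..<v}" using z(1) y y0(1) by (auto simp: closed_segment_eq_real_ivl split: if_splits)
        then have "z \<in> {u<..<v} \<inter> (?Z \<delta> \<union> ?Z (-\<delta>))"
          using z(2) uv(1-3) by (auto simp: abs_if split: if_splits)
        then show False using uv(4) by blast
      qed
      have "u < v" using y0 by auto
      have sm': "\<bar>D 0 y\<bar> \<le> \<delta>" if "y \<in> {u..v}" for y
      proof (rule continuous_le_on_closure[of "{u<..<v}" "\<lambda>y. \<bar>D 0 y\<bar>"])
        show "continuous_on (closure {u<..<v}) (\<lambda>y. \<bar>D 0 y\<bar>)"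
          using uv \<open>u < v\<close> by (intro continuous_on_subset[OF contabs]) auto
      qed (use that \<open>u < v\<close> sm in auto)
      have "c * (v - u) ^ n \<le> 4 ^ (n * n) * \<delta>"
      proof (rule length_of_small_interval[where a=u and D=D])
        fix k y assume "k < n" "y \<in> {u..u + (v-u)}"
        then show "(D k has_real_derivative D (Suc k) y) (at y within {u..u + (v-u)})"
          by (intro DERIV_subset[OF D]) (use uv in auto)
      qed (use Dn sm' uv \<open>0 < c\<close> in auto)
      then have "(v - u) ^ n \<le> 4 ^ (n * n) * \<delta> / c"
        using \<open>0 < c\<close> by (simp add: field_simps)
      then have "((v - u) ^ n) powr (1/n) \<le> (4 ^ (n * n) * \<delta> / c) powr (1 / n)"
        using \<open>u < v\<close> by (intro powr_mono2) auto
      moreover have "((v - u) ^ n) powr (1/n) = v - u"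
        using \<open>u < v\<close> \<open>0 < n\<close> by (simp add: powr_realpow[symmetric] powr_powr)
      ultimately show "v - u \<le> (4 ^ (n * n) * \<delta> / c) powr (1 / n)" by simp
    qed
  qed
qed

text \<open>
  The sublevel set estimate behind the size bounds. Its power of \<open>\<delta>\<close> is exact for
  \<open>f(y) = y\<^sup>n\<close>.
\<close>

lemma measure_sublevel_le:
  fixes D :: "nat \<Rightarrow> real \<Rightarrow> real"
  assumes D: "\<And>k y. k < n \<Longrightarrow> y \<in> {0..1} \<Longrightarrow> (D k has_real_derivative D (Suc k) y) (at y within {0..1})"
    and Dn: "\<And>y. y \<in> {0..1} \<Longrightarrow> c \<le> \<bar>D n y\<bar>"
    and c: "0 < c" "0 < \<delta>" "0 < n"
  shows "measure lborel {y\<in>{0..1}. \<bar>D 0 y\<bar> \<le> \<delta>} \<le> (2 * real n + 1) * (4 ^ (n * n) * \<delta> / c) powr (1 / n)"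
proof -
  obtain P where P: "finite P" "card P \<le> 2 * n"
    "\<And>u v. \<lbrakk>0 \<le> u; u \<le> v; v \<le> 1; {u<..<v} \<inter> P = {}\<rbrakk> \<Longrightarrow>
       v - u \<le> (4 ^ (n * n) * \<delta> / c) powr (1 / n) \<or> {y\<in>{u..v}. \<bar>D 0 y\<bar> \<le> \<delta>} \<subseteq> {u, v}"
    using sublevel_pieces[where D=D, OF D Dn c] by blast
  let ?E = "{y\<in>{0..1}. \<bar>D 0 y\<bar> \<le> \<delta>}"
  have cont: "continuous_on {0..1} (\<lambda>y. \<bar>D 0 y\<bar>)"
    by (intro continuous_intros DERIV_continuous_on[where D = "D (Suc 0)"])
       (use D[of 0] \<open>0 < n\<close> in auto)
  then have "closed ?E"
    using continuous_on_closed_Collect_le[OF cont continuous_on_const] by auto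
  then have E: "?E \<in> sets lborel" by auto
  have "measure lborel (?E \<inter> {0..1}) \<le> (real (card P) + 1) * ((4 ^ (n * n) * \<delta> / c) powr (1 / n))"
  proof (rule subadditive_pieces_bound[where \<mu> = "\<lambda>a b. measure lborel (?E \<inter> {a..b})", OF P(1)])
    fix a p b :: real assume "0 \<le> a" "a \<le> p" "p \<le> b" "b \<le> 1"
    then have eq: "?E \<inter> {a..b} = (?E \<inter> {a..p}) \<union> (?E \<inter> {p..b})" by auto
    show "measure lborel (?E \<inter> {a..b}) \<le> measure lborel (?E \<inter> {a..p}) + measure lborel (?E \<inter> {p..b})"
      unfolding eq by (rule measure_Un_le; intro sets.Int E) simp_all
  next
    fix u v :: real assume uv: "0 \<le> u" "u \<le> v" "v \<le> 1" "{u<..<v} \<inter> P = {}"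
    from P(3)[OF this] show "measure lborel (?E \<inter> {u..v}) \<le> (4 ^ (n * n) * \<delta> / c) powr (1 / n)"
    proof
      assume l: "v - u \<le> (4 ^ (n * n) * \<delta> / c) powr (1 / n)"
      have "measure lborel (?E \<inter> {u..v}) \<le> measure lborel {u..v}"
        by (rule measure_mono_fmeasurable) (use E in \<open>auto simp: fmeasurable_def emeasure_lborel_Icc_eq\<close>)
      then show ?thesis using l uv by auto
    next
      assume "{y\<in>{u..v}. \<bar>D 0 y\<bar> \<le> \<delta>} \<subseteq> {u, v}"
      then have "?E \<inter> {u..v} \<subseteq> {u, v}" by auto
      then have "finite (?E \<inter> {u..v})" by (rule finite_subset) simp
      then have "measure lborel (?E \<inter> {u..v}) = 0"
        unfolding measure_def by (simp only: null_setsD1[OF finite_imp_null_set_lborel] enn2real_0)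
      then show ?thesis by simp
    qed
  qed auto
  also have "\<dots> \<le> (2 * real n + 1) * (4 ^ (n * n) * \<delta> / c) powr (1 / n)"
    using P(2) by (intro mult_right_mono) auto
  moreover have "?E \<inter> {0..1} = ?E" by auto
  ultimately show ?thesis by simp
qed

text \<open>
  For \<open>\<epsilon>\<close> of the order \<open>\<delta>\<^bsup>1/n\<^esup>\<close> the bound does not depend on \<open>\<delta>\<close>. This cannot be read off
  from the measure of the sublevel set, which could be spread over many cells; it uses the
  decomposition into short intervals.
\<close>

lemma card_cells_sublevel_le:
  fixes D :: "nat \<Rightarrow> real \<Rightarrow> real"
  assumes D: "\<And>k y. k < n \<Longrightarrow> y \<in> {0..1} \<Longrightarrow> (D k has_real_derivative D (Suc k) y) (at y within {0..1})"
    and Dn: "\<And>y. y \<in> {0..1} \<Longrightarrow> c \<le> \<bar>D n y\<bar>"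
    and c: "0 < c" "0 < \<delta>" "0 < n" and "0 < \<epsilon>"
  shows "real (card ((\<lambda>x. \<lfloor>x / \<epsilon>\<rfloor>) ` {x\<in>{0..1}. \<bar>D 0 x\<bar> \<le> \<delta>}))
          \<le> (2 * n + 1) * ((4 ^ (n * n) * \<delta> / c) powr (1 / n) / \<epsilon> + 2)"
proof -
  obtain P where P: "finite P" "card P \<le> 2 * n"
    "\<And>u v. \<lbrakk>0 \<le> u; u \<le> v; v \<le> 1; {u<..<v} \<inter> P = {}\<rbrakk> \<Longrightarrow>
       v - u \<le> (4 ^ (n * n) * \<delta> / c) powr (1 / n) \<or> {y\<in>{u..v}. \<bar>D 0 y\<bar> \<le> \<delta>} \<subseteq> {u, v}"
    using sublevel_pieces[where D=D, OF D Dn c] by blast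
  let ?f = "\<lambda>x::real. \<lfloor>x / \<epsilon>\<rfloor>"
  let ?N = "\<lambda>a b. real (card (?f ` {x\<in>{a..b}. \<bar>D 0 x\<bar> \<le> \<delta>}))"
  let ?l = "(4 ^ (n * n) * \<delta> / c) powr (1 / n)"
  have cells: "?f ` {u..v} \<subseteq> {?f u..?f v}" for u v
    using \<open>0 < \<epsilon>\<close> by (auto intro!: floor_mono divide_right_mono)
  have "?N 0 1 \<le> (real (card P) + 1) * (?l / \<epsilon> + 2)"
  proof (rule subadditive_pieces_bound[where \<mu> = ?N, OF P(1)])
    fix a p b :: real assume "0 \<le> a" "a \<le> p" "p \<le> b" "b \<le> 1"
    then have "{x\<in>{a..b}. \<bar>D 0 x\<bar> \<le> \<delta>} = {x\<in>{a..p}. \<bar>D 0 x\<bar> \<le> \<delta>} \<union> {x\<in>{p..b}. \<bar>D 0 x\<bar> \<le> \<delta>}"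
      by auto
    then have "?f ` {x\<in>{a..b}. \<bar>D 0 x\<bar> \<le> \<delta>} = ?f ` {x\<in>{a..p}. \<bar>D 0 x\<bar> \<le> \<delta>} \<union> ?f ` {x\<in>{p..b}. \<bar>D 0 x\<bar> \<le> \<delta>}"
      by (simp only: image_Un)
    then show "?N a b \<le> ?N a p + ?N p b"
      unfolding of_nat_add[symmetric] of_nat_le_iff by (simp only: card_Un_le)
  next
    fix u v :: real assume uv: "0 \<le> u" "u \<le> v" "v \<le> 1" "{u<..<v} \<inter> P = {}"
    from P(3)[OF this] show "?N u v \<le> ?l / \<epsilon> + 2"
    proof
      assume l: "v - u \<le> ?l"
      have "card (?f ` {x\<in>{u..v}. \<bar>D 0 x\<bar> \<le> \<delta>}) \<le> card {?f u..?f v}"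
        by (rule card_mono) (use cells[of u v] in auto)
      moreover have "?f u \<le> ?f v" using uv \<open>0 < \<epsilon>\<close> by (auto intro!: floor_mono divide_right_mono)
      then have "real (card {?f u..?f v}) = of_int (?f v - ?f u) + 1" by simp
      moreover have "of_int (?f v - ?f u) \<le> v/\<epsilon> - u/\<epsilon> + 1"
        by linarith
      moreover have "v/\<epsilon> - u/\<epsilon> \<le> ?l / \<epsilon>"
        using l \<open>0 < \<epsilon>\<close> by (simp add: diff_divide_distrib[symmetric] divide_right_mono)
      ultimately show ?thesis by linarith
    next
      assume s: "{y\<in>{u..v}. \<bar>D 0 y\<bar> \<le> \<delta>} \<subseteq> {u, v}"
      have "card (?f ` {x\<in>{u..v}. \<bar>D 0 x\<bar> \<le> \<delta>}) \<le> card (?f ` {u,v})"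
        using s by (intro card_mono image_mono) auto
      also have "\<dots> \<le> card {u,v}" by (rule card_image_le) auto
      also have "\<dots> \<le> 2" by (simp add: card_insert_if)
      finally have "?N u v \<le> 2" by simp
      moreover have "0 \<le> ?l / \<epsilon>" using \<open>0 < \<epsilon>\<close> by auto
      ultimately show ?thesis by linarith
    qed
  qed (use \<open>0 < \<epsilon>\<close> in auto)
  also have "\<dots> \<le> (2 * real n + 1) * (?l / \<epsilon> + 2)"
    using P(2) \<open>0 < \<epsilon>\<close> by (intro mult_right_mono) auto
  finally show ?thesis .
qed

section \<open>Oscillatory integrals in one variable\<close>

text \<open>
  Integration by parts with the amplitude written as \<open>\<phi> w\<close>, which postpones the division
  by \<open>\<phi>\<close>.
\<close>

lemma oscillatory_ibp:
  fixes \<Phi> \<phi> :: "real \<Rightarrow> real" and w w' :: "real \<Rightarrow> complex"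
  assumes "c \<le> d"
    and d\<Phi>: "\<And>y. y \<in> {c..d} \<Longrightarrow> (\<Phi> has_real_derivative \<phi> y) (at y within {c..d})"
    and dw: "\<And>y. y \<in> {c..d} \<Longrightarrow> (w has_vector_derivative w' y) (at y within {c..d})"
    and w': "continuous_on {c..d} w'"
  shows "((\<lambda>y. \<i> * l * (exp (\<i> * complex_of_real (l * \<Phi> y)) * (complex_of_real (\<phi> y) * w y))) has_integral
           exp (\<i> * complex_of_real (l * \<Phi> d)) * w d - exp (\<i> * complex_of_real (l * \<Phi> c)) * w c
           - integral {c..d} (\<lambda>y. exp (\<i> * complex_of_real (l * \<Phi> y)) * w' y)) {c..d}"
proof -
  let ?e = "\<lambda>y. exp (\<i> * complex_of_real (l * \<Phi> y))"
  have de: "(?e has_vector_derivative \<i> * l * \<phi> y * ?e y) (at y within {c..d})" if "y \<in> {c..d}" for y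
  proof -
    have "((\<lambda>y. \<i> * complex_of_real (l * \<Phi> y)) has_vector_derivative \<i> * complex_of_real (l * \<phi> y)) (at y within {c..d})"
      by (intro has_vector_derivative_mult_right has_vector_derivative_of_real DERIV_cmult)
         (use d\<Phi>[OF that] in auto)
    from field_vector_diff_chain_within[OF this has_field_derivative_at_within[OF DERIV_exp]]
    show ?thesis by (simp add: o_def mult_ac)
  qed
  have "continuous_on {c..d} \<Phi>" using d\<Phi> by (rule DERIV_continuous_on)
  then have ew': "(\<lambda>y. ?e y * w' y) integrable_on {c..d}"
    using w' by (intro integrable_continuous_interval continuous_intros)
  have "((\<lambda>y. ?e y * w y) has_vector_derivative ?e y * w' y + \<i> * l * \<phi> y * ?e y * w y) (at y within {c..d})"
    if "y \<in> {c..d}" for y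
    using has_vector_derivative_mult[OF de[OF that] dw[OF that]] by simp
  from fundamental_theorem_of_calculus[OF \<open>c \<le> d\<close> this]
  have "((\<lambda>y. ?e y * w' y + \<i> * l * \<phi> y * ?e y * w y) has_integral (?e d * w d - ?e c * w c)) {c..d}" .
  from has_integral_diff[OF this integrable_integral[OF ew']]
  show ?thesis by (simp add: mult_ac)
qed

text \<open>
  Integrating by parts leaves \<open>a'/\<phi>\<close> and \<open>a (1/\<phi>)'\<close>. The second term is harmless because
  \<open>1/\<phi>\<close> is monotone and bounded by \<open>1/\<mu>\<close>, so its total variation is at most \<open>2/\<mu>\<close> however
  large \<open>\<phi>'\<close> is.
\<close>

lemma van_der_Corput:
  fixes \<Phi> \<phi> \<phi>' :: "real \<Rightarrow> real" and a a' :: "real \<Rightarrow> complex"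
  assumes cd: "c \<le> d" "d - c \<le> 1" and l: "0 < l" and \<mu>: "0 < \<mu>"
    and d\<Phi>: "\<And>y. y \<in> {c..d} \<Longrightarrow> (\<Phi> has_real_derivative \<phi> y) (at y within {c..d})"
    and d\<phi>: "\<And>y. y \<in> {c..d} \<Longrightarrow> (\<phi> has_real_derivative \<phi>' y) (at y within {c..d})"
    and c\<phi>': "continuous_on {c..d} \<phi>'"
    and da: "\<And>y. y \<in> {c..d} \<Longrightarrow> (a has_vector_derivative a' y) (at y within {c..d})"
    and ca': "continuous_on {c..d} a'"
    and big: "\<And>y. y \<in> {c..d} \<Longrightarrow> \<mu> \<le> \<bar>\<phi> y\<bar>"
    and sign: "(\<forall>y\<in>{c..d}. 0 \<le> \<phi>' y) \<or> (\<forall>y\<in>{c..d}. \<phi>' y \<le> 0)"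
    and M: "\<And>y. y \<in> {c..d} \<Longrightarrow> norm (a y) \<le> M" "\<And>y. y \<in> {c..d} \<Longrightarrow> norm (a' y) \<le> M"
  shows "norm (integral {c..d} (\<lambda>y. exp (\<i> * complex_of_real (l * \<Phi> y)) * a y)) \<le> 5 * M / (l * \<mu>)"
proof -
  let ?e = "\<lambda>y. exp (\<i> * complex_of_real (l * \<Phi> y))"
  let ?w = "\<lambda>y. (1 / \<phi> y) *\<^sub>R a y"
  let ?w' = "\<lambda>y. (1 / \<phi> y) *\<^sub>R a' y + (- \<phi>' y / (\<phi> y)\<^sup>2) *\<^sub>R a y"
  have M0: "0 \<le> M" using order_trans[OF norm_ge_zero M(1)[of c]] cd by auto
  have nz: "\<phi> y \<noteq> 0" if "y \<in> {c..d}" for y using big[OF that] \<mu> by auto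
  have c\<Phi>: "continuous_on {c..d} \<Phi>" using d\<Phi> by (rule DERIV_continuous_on)
  have c\<phi>: "continuous_on {c..d} \<phi>" using d\<phi> by (rule DERIV_continuous_on)
  have ca: "continuous_on {c..d} a" using da by (rule continuous_on_vector_derivative)
  have dinv: "((\<lambda>y. 1 / \<phi> y) has_real_derivative - \<phi>' y / (\<phi> y)\<^sup>2) (at y within {c..d})" if "y \<in> {c..d}" for y
    using d\<phi>[OF that] nz[OF that]
    by (auto intro!: derivative_eq_intros simp: power2_eq_square)
  have dw: "(?w has_vector_derivative ?w' y) (at y within {c..d})" if "y \<in> {c..d}" for y
    using has_vector_derivative_scaleR[OF dinv[OF that] da[OF that]] by simp
  have cw': "continuous_on {c..d} ?w'"
    using nz by (intro continuous_intros c\<phi> ca ca' c\<phi>') auto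
  have inv: "\<bar>1 / \<phi> y\<bar> \<le> 1 / \<mu>" if "y \<in> {c..d}" for y
    using big[OF that] \<mu> by (simp add: frac_le)
  let ?q = "\<lambda>y. - \<phi>' y / (\<phi> y)\<^sup>2"
  have q: "(?q has_integral (1 / \<phi> d - 1 / \<phi> c)) {c..d}"
    by (rule fundamental_theorem_of_calculus[OF \<open>c \<le> d\<close>])
       (use dinv in \<open>auto simp: has_real_derivative_iff_has_vector_derivative\<close>)
  have iq: "(\<lambda>y. \<bar>?q y\<bar>) integrable_on {c..d}"
    using nz by (intro integrable_continuous_interval continuous_intros c\<phi> c\<phi>') auto
  have absq: "integral {c..d} (\<lambda>y. \<bar>?q y\<bar>) \<le> 2 / \<mu>"
  proof -
    have "integral {c..d} (\<lambda>y. \<bar>?q y\<bar>) = \<bar>integral {c..d} ?q\<bar>"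
      using sign
    proof
      assume *: "\<forall>y\<in>{c..d}. 0 \<le> \<phi>' y"
      then have eq: "integral {c..d} (\<lambda>y. \<bar>?q y\<bar>) = integral {c..d} (\<lambda>y. - ?q y)"
        by (intro integral_cong abs_of_nonpos) (auto intro!: divide_nonpos_nonneg)
      have "0 \<le> integral {c..d} (\<lambda>y. \<bar>?q y\<bar>)" by (rule integral_nonneg[OF iq]) auto
      then show ?thesis unfolding eq by simp
    next
      assume *: "\<forall>y\<in>{c..d}. \<phi>' y \<le> 0"
      then have eq: "integral {c..d} (\<lambda>y. \<bar>?q y\<bar>) = integral {c..d} ?q"
        by (intro integral_cong) (auto simp: divide_nonpos_nonneg)
      have "0 \<le> integral {c..d} (\<lambda>y. \<bar>?q y\<bar>)" by (rule integral_nonneg[OF iq]) auto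
      then show ?thesis unfolding eq by simp
    qed
    also have "\<dots> = \<bar>1 / \<phi> d - 1 / \<phi> c\<bar>" using integral_unique[OF q] by simp
    also have "\<dots> \<le> 2 / \<mu>" using inv[of c] inv[of d] cd abs_triangle_ineq4[of "1 / \<phi> d" "1 / \<phi> c"] by auto
    finally show ?thesis .
  qed
  have "norm (integral {c..d} (\<lambda>y. ?e y * ?w' y)) \<le> integral {c..d} (\<lambda>y. M / \<mu> + M * \<bar>?q y\<bar>)"
  proof (rule integral_norm_bound_integral)
    show "(\<lambda>y. ?e y * ?w' y) integrable_on {c..d}"
      by (intro integrable_continuous_interval continuous_intros c\<Phi> cw')
    show "(\<lambda>y. M / \<mu> + M * \<bar>?q y\<bar>) integrable_on {c..d}"
      using nz by (intro integrable_continuous_interval continuous_intros c\<phi> c\<phi>') auto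
  next
    fix y assume y: "y \<in> {c..d}"
    have "norm (?e y * ?w' y) = norm (?w' y)" by (simp add: norm_mult)
    also have "\<dots> \<le> \<bar>1 / \<phi> y\<bar> * norm (a' y) + \<bar>?q y\<bar> * norm (a y)"
      by (rule norm_triangle_le) simp
    also have "\<dots> \<le> 1 / \<mu> * M + \<bar>?q y\<bar> * M"
      using inv[OF y] M[OF y] \<mu> by (intro add_mono mult_mono) auto
    finally show "norm (?e y * ?w' y) \<le> M / \<mu> + M * \<bar>?q y\<bar>" by (simp add: mult.commute)
  qed
  also have "\<dots> = integral {c..d} (\<lambda>y. M / \<mu>) + integral {c..d} (\<lambda>y. M * \<bar>?q y\<bar>)"
    by (rule integral_add[OF integrable_const_ivl integrable_on_mult_right[OF iq]])
  also have "\<dots> = (d - c) * (M / \<mu>) + M * integral {c..d} (\<lambda>y. \<bar>?q y\<bar>)"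
    unfolding integral_mult_right using \<open>c \<le> d\<close> by simp
  also have "\<dots> \<le> 1 * (M / \<mu>) + M * (2 / \<mu>)"
    using absq M0 cd \<mu> by (intro add_mono mult_right_mono mult_left_mono) auto
  finally have I: "norm (integral {c..d} (\<lambda>y. ?e y * ?w' y)) \<le> 3 * M / \<mu>" by simp
  have bw: "norm (?e y * ?w y) \<le> M / \<mu>" if "y \<in> {c..d}" for y
  proof -
    have "norm (?e y * ?w y) = \<bar>1 / \<phi> y\<bar> * norm (a y)" by (simp add: norm_mult)
    also have "\<dots> \<le> 1 / \<mu> * M" using inv[OF that] M(1)[OF that] \<mu> by (intro mult_mono) auto
    finally show ?thesis by simp
  qed
  have "((\<lambda>y. \<i> * l * (?e y * (complex_of_real (\<phi> y) * ?w y))) has_integral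
           ?e d * ?w d - ?e c * ?w c - integral {c..d} (\<lambda>y. ?e y * ?w' y)) {c..d}" (is "(_ has_integral ?R) _")
    by (rule oscillatory_ibp[OF \<open>c \<le> d\<close> d\<Phi> dw cw'])
  then have "((\<lambda>y. \<i> * l * (?e y * a y)) has_integral ?R) {c..d}"
    by (rule has_integral_eq[rotated]) (use nz in \<open>auto simp: scaleR_conv_of_real\<close>)
  from integral_unique[OF this] have eq: "\<i> * l * integral {c..d} (\<lambda>y. ?e y * a y) = ?R"
    by (simp only: integral_mult_right)
  have "l * norm (integral {c..d} (\<lambda>y. ?e y * a y)) = norm ?R"
    unfolding eq[symmetric] norm_mult using l by simp
  also have "norm ?R \<le> norm (?e d * ?w d) + norm (?e c * ?w c) + norm (integral {c..d} (\<lambda>y. ?e y * ?w' y))"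
    by (meson add_right_mono norm_triangle_ineq4 order_trans)
  also have "\<dots> \<le> M / \<mu> + M / \<mu> + 3 * M / \<mu>"
    using bw[of c] bw[of d] cd I by (intro add_mono) auto
  also have "\<dots> = 5 * M / \<mu>" by simp
  finally show ?thesis using l \<mu> by (simp add: field_simps)
qed

text \<open>
  Two integrations by parts. In the application \<open>r\<close> is the distance \<open>\<bar>x\<^sub>1 - x\<^sub>2\<bar>\<close>; as \<open>\<phi>\<close>
  is at least \<open>k r\<close> and its derivatives are \<open>O(r)\<close>, differentiating \<open>1/\<phi>\<close> costs nothing,
  and each division by \<open>l \<phi>\<close> gains a factor \<open>1 / (l r)\<close>.
\<close>

lemma oscillatory_second_order:
  fixes \<Phi> \<phi> \<phi>' \<phi>'' :: "real \<Rightarrow> real" and a a' a'' :: "real \<Rightarrow> complex"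
  assumes l: "0 < l" and r: "0 < r" and k: "0 < k" "k \<le> 1"
    and d\<Phi>: "\<And>y. y \<in> {0..1} \<Longrightarrow> (\<Phi> has_real_derivative \<phi> y) (at y within {0..1})"
    and d\<phi>: "\<And>y. y \<in> {0..1} \<Longrightarrow> (\<phi> has_real_derivative \<phi>' y) (at y within {0..1})"
    and d\<phi>': "\<And>y. y \<in> {0..1} \<Longrightarrow> (\<phi>' has_real_derivative \<phi>'' y) (at y within {0..1})"
    and c\<phi>'': "continuous_on {0..1} \<phi>''"
    and da: "\<And>y. y \<in> {0..1} \<Longrightarrow> (a has_vector_derivative a' y) (at y within {0..1})"
    and da': "\<And>y. y \<in> {0..1} \<Longrightarrow> (a' has_vector_derivative a'' y) (at y within {0..1})"
    and ca'': "continuous_on {0..1} a''"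
    and big: "\<And>y. y \<in> {0..1} \<Longrightarrow> k * r \<le> \<bar>\<phi> y\<bar>"
    and small: "\<And>y. y \<in> {0..1} \<Longrightarrow> \<bar>\<phi>' y\<bar> \<le> M * r" "\<And>y. y \<in> {0..1} \<Longrightarrow> \<bar>\<phi>'' y\<bar> \<le> M * r"
    and M: "\<And>y. y \<in> {0..1} \<Longrightarrow> norm (a y) \<le> M" "\<And>y. y \<in> {0..1} \<Longrightarrow> norm (a' y) \<le> M" "\<And>y. y \<in> {0..1} \<Longrightarrow> norm (a'' y) \<le> M"
      "1 \<le> M"
    and bd: "a 0 = 0" "a 1 = 0" "a' 0 = 0" "a' 1 = 0"
  shows "norm (integral {0..1} (\<lambda>y. exp (\<i> * complex_of_real (l * \<Phi> y)) * a y)) \<le> 8 * M ^ 3 / (k ^ 4 * (l * r)\<^sup>2)"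
proof -
  let ?e = "\<lambda>y. exp (\<i> * complex_of_real (l * \<Phi> y))"
  let ?q = "\<lambda>y. - \<phi>' y / (\<phi> y)\<^sup>2"
  let ?q' = "\<lambda>y. - \<phi>'' y / (\<phi> y)\<^sup>2 + 2 * (\<phi>' y)\<^sup>2 / (\<phi> y) ^ 3"
  define w where "w = (\<lambda>y. (1 / \<phi> y) *\<^sub>R a y)"
  define w' where "w' = (\<lambda>y. (1 / \<phi> y) *\<^sub>R a' y + ?q y *\<^sub>R a y)"
  define v where "v = (\<lambda>y. (1 / \<phi> y) *\<^sub>R w' y)"
  define v' where "v' = (\<lambda>y. (1 / \<phi> y) *\<^sub>R (((1 / \<phi> y) *\<^sub>R a'' y + ?q y *\<^sub>R a' y) + (?q y *\<^sub>R a' y + ?q' y *\<^sub>R a y)) + ?q y *\<^sub>R w' y)"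
  have nz: "\<phi> y \<noteq> 0" if "y \<in> {0..1}" for y using big[OF that] mult_pos_pos[OF k(1) r] by auto
  have c\<Phi>: "continuous_on {0..1} \<Phi>" using d\<Phi> by (rule DERIV_continuous_on)
  have c\<phi>: "continuous_on {0..1} \<phi>" using d\<phi> by (rule DERIV_continuous_on)
  have c\<phi>': "continuous_on {0..1} \<phi>'" using d\<phi>' by (rule DERIV_continuous_on)
  have ca: "continuous_on {0..1} a" using da by (rule continuous_on_vector_derivative)
  have ca': "continuous_on {0..1} a'" using da' by (rule continuous_on_vector_derivative)
  have dinv: "((\<lambda>y. 1 / \<phi> y) has_real_derivative ?q y) (at y within {0..1})" if "y \<in> {0..1}" for y
    using d\<phi>[OF that] nz[OF that] by (auto intro!: derivative_eq_intros simp: power2_eq_square)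
  have dq: "(?q has_real_derivative ?q' y) (at y within {0..1})" if "y \<in> {0..1}" for y
    using d\<phi>[OF that] d\<phi>'[OF that] nz[OF that]
    by (auto intro!: derivative_eq_intros simp: power2_eq_square power3_eq_cube field_simps)
  have dw: "(w has_vector_derivative w' y) (at y within {0..1})" if "y \<in> {0..1}" for y
    unfolding w_def w'_def using has_vector_derivative_scaleR[OF dinv[OF that] da[OF that]] by simp
  have dw': "(w' has_vector_derivative ((1 / \<phi> y) *\<^sub>R a'' y + ?q y *\<^sub>R a' y) + (?q y *\<^sub>R a' y + ?q' y *\<^sub>R a y)) (at y within {0..1})" if "y \<in> {0..1}" for y
    unfolding w'_def by (intro has_vector_derivative_add has_vector_derivative_scaleR dinv dq da' da that)
  have dv: "(v has_vector_derivative v' y) (at y within {0..1})" if "y \<in> {0..1}" for y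
    unfolding v_def v'_def using has_vector_derivative_scaleR[OF dinv[OF that] dw'[OF that]] by simp
  have cw': "continuous_on {0..1} w'" using dw' by (rule continuous_on_vector_derivative)
  have cv': "continuous_on {0..1} v'" unfolding v'_def
    using nz by (intro continuous_intros c\<phi> ca ca' c\<phi>' ca'' c\<phi>'' cw') auto
  have M0: "0 \<le> M" using M(4) by auto
  have bv': "norm (?e y * v' y) \<le> 8 * M ^ 3 / (k ^ 4 * r\<^sup>2)" if y: "y \<in> {0..1}" for y
  proof -
    define z where "z = 1 / (k * r)"
    have z: "0 < z" using k r by (auto simp: z_def)
    have inv: "\<bar>1 / \<phi> y\<bar> \<le> z" using big[OF y] k r by (simp add: frac_le z_def)
    have zr: "z * r = 1 / k" using r by (simp add: z_def)
    have ik: "1 \<le> 1 / k" using k by auto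
    have q: "\<bar>?q y\<bar> \<le> M * z / k"
    proof -
      have "\<bar>?q y\<bar> = \<bar>\<phi>' y\<bar> * \<bar>1 / \<phi> y\<bar> * \<bar>1 / \<phi> y\<bar>" by (simp add: power2_eq_square abs_mult)
      also have "\<dots> \<le> (M * r) * z * z"
        using small(1)[OF y] inv z M0 r by (intro mult_mono) auto
      also have "\<dots> = M * z * (z * r)" by simp
      finally show ?thesis unfolding zr by simp
    qed
    have q': "\<bar>?q' y\<bar> \<le> 3 * M\<^sup>2 * z / k\<^sup>2"
    proof -
      have "\<bar>- \<phi>'' y / (\<phi> y)\<^sup>2\<bar> = \<bar>\<phi>'' y\<bar> * \<bar>1 / \<phi> y\<bar> * \<bar>1 / \<phi> y\<bar>" by (simp add: power2_eq_square abs_mult)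
      also have "\<dots> \<le> (M * r) * z * z"
        using small(2)[OF y] inv z M0 r by (intro mult_mono) auto
      also have "\<dots> = M * z * (z * r)" by simp
      also have "\<dots> = M * z * (1/k)" unfolding zr ..
      also have "\<dots> \<le> M\<^sup>2 * z * (1/k)\<^sup>2"
        using self_le_power[OF M(4), of 2] self_le_power[OF ik, of 2] M0 k z
        by (intro mult_mono) auto
      finally have 1: "\<bar>- \<phi>'' y / (\<phi> y)\<^sup>2\<bar> \<le> M\<^sup>2 * z * (1/k)\<^sup>2" .
      have "\<bar>2 * (\<phi>' y)\<^sup>2 / (\<phi> y) ^ 3\<bar> = 2 * (\<bar>\<phi>' y\<bar> * \<bar>\<phi>' y\<bar>) * (\<bar>1 / \<phi> y\<bar> * \<bar>1 / \<phi> y\<bar> * \<bar>1 / \<phi> y\<bar>)"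
        by (simp add: power2_eq_square power3_eq_cube abs_mult)
      also have "\<dots> \<le> 2 * ((M * r) * (M * r)) * (z * z * z)"
        by (intro mult_mono' mult_nonneg_nonneg small(1)[OF y] inv abs_ge_zero order_refl) simp_all
      also have "\<dots> = 2 * M\<^sup>2 * z * (z * r)\<^sup>2" by (simp add: power2_eq_square)
      finally have "\<bar>2 * (\<phi>' y)\<^sup>2 / (\<phi> y) ^ 3\<bar> \<le> 2 * M\<^sup>2 * z * (1/k)\<^sup>2" unfolding zr .
      with 1 have "\<bar>?q' y\<bar> \<le> M\<^sup>2 * z * (1/k)\<^sup>2 + 2 * M\<^sup>2 * z * (1/k)\<^sup>2" by linarith
      then show ?thesis unfolding power_divide by (simp add: mult_ac)
    qed
    have tri: "norm (s *\<^sub>R u) \<le> A * B" if "\<bar>s\<bar> \<le> A" "norm u \<le> B" for s A B and u :: complex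
      unfolding norm_scaleR using that by (intro mult_mono') auto
    have nw': "norm (w' y) \<le> z * M + (M * z / k) * M"
      unfolding w'_def by (intro norm_triangle_le add_mono tri inv q M y)
    have "norm (v' y) \<le> z * (z * M + (M * z / k) * M + ((M * z / k) * M + (3 * M\<^sup>2 * z / k\<^sup>2) * M)) + (M * z / k) * (z * M + (M * z / k) * M)"
      unfolding v'_def by (intro norm_triangle_le add_mono tri inv q q' M y nw')
    also have "\<dots> = z\<^sup>2 * (M + 3 * (M\<^sup>2 * (1/k)) + 3 * (M ^ 3 * (1/k)\<^sup>2) + M ^ 3 * (1/k)\<^sup>2)"
      by (simp add: power2_eq_square power3_eq_cube algebra_simps)
    also have "\<dots> \<le> z\<^sup>2 * (M ^ 3 * (1/k)\<^sup>2 + 3 * (M ^ 3 * (1/k)\<^sup>2) + 3 * (M ^ 3 * (1/k)\<^sup>2) + M ^ 3 * (1/k)\<^sup>2)"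
    proof -
      have "M * 1 \<le> M ^ 3 * (1/k)\<^sup>2"
        using self_le_power[OF M(4), of 3] one_le_power[OF ik, of 2] M0 by (intro mult_mono) auto
      moreover have "M\<^sup>2 * (1/k) \<le> M ^ 3 * (1/k)\<^sup>2"
        using power_increasing[OF _ M(4), of 2 3] self_le_power[OF ik, of 2] M0 k by (intro mult_mono) auto
      ultimately show ?thesis by (intro mult_left_mono) auto
    qed
    also have "\<dots> = 8 * M ^ 3 / (k ^ 4 * r\<^sup>2)"
      unfolding z_def using k r by (simp add: field_simps power2_eq_square power4_eq_xxxx)
    finally show ?thesis by (simp add: norm_mult)
  qed
  have I: "norm (integral {0..1} (\<lambda>y. ?e y * v' y)) \<le> 8 * M ^ 3 / (k ^ 4 * r\<^sup>2)"
  proof -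
    have "norm (integral {0..1} (\<lambda>y. ?e y * v' y)) \<le> integral {0..1} (\<lambda>y::real. 8 * M ^ 3 / (k ^ 4 * r\<^sup>2))"
      by (intro integral_norm_bound_integral integrable_continuous_interval continuous_intros c\<Phi> cv') (use bv' in auto)
    then show ?thesis by simp
  qed
  have step: "\<i> * l * integral {0..1} (\<lambda>y. ?e y * b y) = - integral {0..1} (\<lambda>y. ?e y * u' y)"
    if du: "\<And>y. y \<in> {0..1} \<Longrightarrow> (u has_vector_derivative u' y) (at y within {0..1})"
      and cu: "continuous_on {0..1} u'" and u: "u = (\<lambda>y. (1 / \<phi> y) *\<^sub>R b y)" "b 0 = 0" "b 1 = 0" for u u' b
  proof -
    have "((\<lambda>y. \<i> * l * (?e y * (complex_of_real (\<phi> y) * u y))) has_integral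
           ?e 1 * u 1 - ?e 0 * u 0 - integral {0..1} (\<lambda>y. ?e y * u' y)) {0..1}"
      by (rule oscillatory_ibp[OF _ d\<Phi> du cu]) simp
    moreover have "u 0 = 0" "u 1 = 0" by (simp_all add: u)
    ultimately have "((\<lambda>y. \<i> * l * (?e y * (complex_of_real (\<phi> y) * u y))) has_integral - integral {0..1} (\<lambda>y. ?e y * u' y)) {0..1}"
      by (simp only: mult_zero_right diff_self diff_0)
    moreover have "\<i> * l * (?e y * (complex_of_real (\<phi> y) * u y)) = \<i> * l * (?e y * b y)" if "y \<in> {0..1}" for y
      using nz[OF that] by (simp add: u(1) scaleR_conv_of_real)
    ultimately have "((\<lambda>y. \<i> * l * (?e y * b y)) has_integral - integral {0..1} (\<lambda>y. ?e y * u' y)) {0..1}"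
      by (rule has_integral_eq[rotated])
    from integral_unique[OF this] show ?thesis by (simp only: integral_mult_right)
  qed
  have "\<i> * l * integral {0..1} (\<lambda>y. ?e y * a y) = - integral {0..1} (\<lambda>y. ?e y * w' y)"
    by (rule step[OF dw cw']) (auto simp: w_def bd)
  moreover have "\<i> * l * integral {0..1} (\<lambda>y. ?e y * w' y) = - integral {0..1} (\<lambda>y. ?e y * v' y)"
    by (rule step[OF dv cv']) (auto simp: v_def w'_def bd)
  ultimately have eq: "(\<i> * l) * ((\<i> * l) * integral {0..1} (\<lambda>y. ?e y * a y)) = integral {0..1} (\<lambda>y. ?e y * v' y)"
    by (simp only: mult_minus_right minus_minus)
  have "l\<^sup>2 * norm (integral {0..1} (\<lambda>y. ?e y * a y)) = norm (integral {0..1} (\<lambda>y. ?e y * v' y))"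
    unfolding eq[symmetric] norm_mult using l by (simp add: power2_eq_square)
  with I have "l\<^sup>2 * norm (integral {0..1} (\<lambda>y. ?e y * a y)) \<le> 8 * M ^ 3 / (k ^ 4 * r\<^sup>2)" by simp
  then have "norm (integral {0..1} (\<lambda>y. ?e y * a y)) \<le> 8 * M ^ 3 / (k ^ 4 * r\<^sup>2) / l\<^sup>2"
    using l by (subst pos_le_divide_eq) (simp_all only: mult.commute[of _ "l\<^sup>2"] zero_less_power)
  also have "\<dots> = 8 * M ^ 3 / (k ^ 4 * (l * r)\<^sup>2)" by (simp add: power_mult_distrib mult_ac)
  finally show ?thesis .
qed

section \<open>Kernels on the unit square and their bilinear forms\<close>

abbreviation plane :: "(real \<times> real) measure" where "plane \<equiv> lborel \<Otimes>\<^sub>M lborel"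

text \<open>
  Bounded values and bounded support make all integrals below converge absolutely for
  functions in \<open>L\<^sup>2\<close>.
\<close>

definition square_kernel :: "real \<Rightarrow> (real \<times> real \<Rightarrow> complex) \<Rightarrow> bool"
  where "square_kernel M k \<longleftrightarrow> k \<in> borel_measurable plane \<and>
    (\<forall>p. norm (k p) \<le> M) \<and> (\<forall>p. p \<notin> unit_square \<longrightarrow> k p = 0)"

lemma square_kernelD:
  assumes "square_kernel M k"
  shows "k \<in> borel_measurable plane" "norm (k p) \<le> M" "p \<notin> unit_square \<Longrightarrow> k p = 0" "0 \<le> M"
  using assms order_trans[OF norm_ge_zero, of "k p" M] by (auto simp: square_kernel_def simp del: split_paired_All)

lemma L2_spaceD:
  assumes "f \<in> L2_space"
  shows "f \<in> borel_measurable borel" "integrable lborel (\<lambda>x. (norm (f x))\<^sup>2)"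
  using assms by (auto simp: L2_space_def)

lemma L2_norm_nonneg [simp]: "0 \<le> L2_norm f"
  unfolding L2_norm_def by (auto intro!: integral_nonneg)

lemma L2_norm_squared: "(L2_norm f)\<^sup>2 = (LINT x|lborel. (norm (f x))\<^sup>2)"
  unfolding L2_norm_def by (auto intro!: integral_nonneg)

text \<open>
  Optimizing over \<open>t\<close>; it turns the inequality of arithmetic and geometric means under an
  integral into the Cauchy-Schwarz inequality, including the cases where one factor
  vanishes.
\<close>

lemma le_sqrt_mult_if_weighted_means:
  fixes X a b :: real
  assumes "\<And>t. 0 < t \<Longrightarrow> X \<le> (t * a + b / t) / 2" "0 \<le> a" "0 \<le> b"
  shows "X \<le> sqrt (a * b)"
proof (rule field_le_epsilon)
  fix e :: real assume "0 < e"
  consider "a = 0" | "b = 0" "a > 0" | "a > 0" "b > 0" using assms by linarith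
  then show "X \<le> sqrt (a * b) + e"
  proof cases
    case 1
    have "X \<le> (b / ((b + 1) / e)) / 2" using assms(1)[of "(b+1)/e"] 1 \<open>0 < e\<close> assms(3) by auto
    also have "\<dots> \<le> e" using \<open>0 < e\<close> assms(3) by (simp add: field_simps)
    finally show ?thesis using 1 by simp
  next
    case 2
    have "X \<le> ((e / a) * a) / 2" using assms(1)[of "e / a"] 2 \<open>0 < e\<close> by auto
    also have "\<dots> \<le> e" using \<open>0 < e\<close> 2 by simp
    finally show ?thesis using 2 by simp
  next
    case 3
    let ?t = "sqrt b / sqrt a"
    have "X \<le> (?t * a + b / ?t) / 2" using assms(1)[of ?t] 3 by auto
    also have "?t * a = sqrt (a * b)"
      using 3 by (simp add: real_sqrt_mult field_simps)
    also have "b / ?t = sqrt (a * b)"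
      using 3 by (simp add: real_sqrt_mult field_simps)
    finally show ?thesis using \<open>0 < e\<close> by simp
  qed
qed

lemma weighted_mean_ge:
  fixes u v t :: real
  assumes "0 < t"
  shows "u * v \<le> (t * u\<^sup>2 + v\<^sup>2 / t) / 2"
proof -
  have "0 \<le> (t * u - v)\<^sup>2 / t" using assms by simp
  then show ?thesis using assms by (simp add: power2_eq_square field_simps)
qed

lemma mult_le_sum_squares:
  fixes u v :: real
  assumes "0 \<le> u" "0 \<le> v"
  shows "u * v \<le> u\<^sup>2 + v\<^sup>2"
proof -
  have "u * v \<le> 2 * u * v" using assms by simp
  also have "\<dots> \<le> u\<^sup>2 + v\<^sup>2" by (rule sum_squares_bound)
  finally show ?thesis .
qed

lemma L2_norm_times_integrable:
  assumes "f \<in> L2_space" "g \<in> L2_space"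
  shows "integrable lborel (\<lambda>x. norm (f x) * norm (g x))"
proof (rule Bochner_Integration.integrable_bound[of _ "\<lambda>x. (norm (f x))\<^sup>2 + (norm (g x))\<^sup>2"])
  note [measurable] = L2_spaceD(1)[OF assms(1)] L2_spaceD(1)[OF assms(2)]
  show "integrable lborel (\<lambda>x. (norm (f x))\<^sup>2 + (norm (g x))\<^sup>2)"
    using L2_spaceD(2)[OF assms(1)] L2_spaceD(2)[OF assms(2)] by simp
  show "(\<lambda>x. norm (f x) * norm (g x)) \<in> borel_measurable lborel" by measurable
  have "norm (f x) * norm (g x) \<le> (norm (f x))\<^sup>2 + (norm (g x))\<^sup>2" for x
    by (rule mult_le_sum_squares) auto
  then show "AE x in lborel. norm (norm (f x) * norm (g x)) \<le> norm ((norm (f x))\<^sup>2 + (norm (g x))\<^sup>2)"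
    by (auto simp: abs_mult)
qed

lemma L2_Cauchy_Schwarz:
  assumes f: "f \<in> L2_space" and g: "g \<in> L2_space"
  shows "norm (LINT x|lborel. f x * g x) \<le> L2_norm f * L2_norm g"
proof -
  have "norm (LINT x|lborel. f x * g x) \<le> (LINT x|lborel. norm (f x) * norm (g x))"
    using integral_norm_bound[of lborel "\<lambda>x. f x * g x"] by (simp add: norm_mult)
  also have "\<dots> \<le> sqrt ((L2_norm f)\<^sup>2 * (L2_norm g)\<^sup>2)"
  proof (rule le_sqrt_mult_if_weighted_means)
    fix t :: real assume "0 < t"
    have "(LINT x|lborel. norm (f x) * norm (g x)) \<le> (LINT x|lborel. (t * (norm (f x))\<^sup>2 + (norm (g x))\<^sup>2 / t) / 2)"
      using L2_norm_times_integrable[OF f g] L2_spaceD(2)[OF f] L2_spaceD(2)[OF g] weighted_mean_ge[OF \<open>0 < t\<close>]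
      by (intro integral_mono) auto
    also have "\<dots> = (t * (L2_norm f)\<^sup>2 + (L2_norm g)\<^sup>2 / t) / 2"
      using L2_spaceD(2)[OF f] L2_spaceD(2)[OF g] by (simp add: L2_norm_squared)
    finally show "(LINT x|lborel. norm (f x) * norm (g x)) \<le> (t * (L2_norm f)\<^sup>2 + (L2_norm g)\<^sup>2 / t) / 2" .
  qed auto
  finally show ?thesis by (simp add: real_sqrt_mult)
qed

lemma L2_cnj:
  assumes "f \<in> L2_space"
  shows "(\<lambda>x. cnj (f x)) \<in> L2_space"
proof -
  have [measurable]: "cnj \<in> borel_measurable borel"
    by (intro borel_measurable_continuous_onI continuous_intros)
  note [measurable] = L2_spaceD(1)[OF assms]
  have "(\<lambda>x. cnj (f x)) \<in> borel_measurable borel" by measurable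
  then show ?thesis using L2_spaceD(2)[OF assms] by (simp add: L2_space_def)
qed

lemma L2_restrict:
  assumes "f \<in> L2_space" "A \<in> sets borel"
  shows "(\<lambda>x. indicator A x * f x) \<in> L2_space"
proof -
  note [measurable] = L2_spaceD(1)[OF assms(1)] assms(2)
  have "integrable lborel (\<lambda>x. (norm (indicator A x * f x))\<^sup>2)"
    by (rule Bochner_Integration.integrable_bound[OF L2_spaceD(2)[OF assms(1)]]) (auto simp: norm_mult split: split_indicator)
  then show ?thesis unfolding L2_space_def by auto
qed

lemma L2_space_bounded:
  assumes [measurable]: "f \<in> borel_measurable borel" and "\<And>x. norm (f x) \<le> M" "\<And>x. x \<notin> {0..1} \<Longrightarrow> f x = 0"
  shows "f \<in> L2_space" "L2_norm f \<le> M"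
proof -
  have "integrable lborel (\<lambda>x. (norm (f x))\<^sup>2)"
    by (rule integrableI_bounded_set[where A="{0..1}" and B="M\<^sup>2"])
       (use assms in \<open>auto intro!: power_mono\<close>)
  then show L2: "f \<in> L2_space" unfolding L2_space_def by auto
  have "(LINT x|lborel. (norm (f x))\<^sup>2) \<le> (LINT x|lborel. M\<^sup>2 * indicator {0..1::real} x)"
    using L2_spaceD(2)[OF L2] assms(2,3)
    by (intro integral_mono) (auto intro!: power_mono split: split_indicator)
  then have "L2_norm f \<le> sqrt (M\<^sup>2)" unfolding L2_norm_def by (intro real_sqrt_le_mono) simp
  then show "L2_norm f \<le> M" using order_trans[OF norm_ge_zero assms(2)] by simp
qed

lemma integrable_on_plane_product:
  fixes u v :: "real \<Rightarrow> real"
  assumes u: "integrable lborel u" and v: "integrable lborel v"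
  shows "integrable plane (\<lambda>(x, y). u x * v y)"
proof (rule lborel_pair.Fubini_integrable)
  note [measurable] = borel_measurable_integrable[OF u] borel_measurable_integrable[OF v]
  show "(\<lambda>(x, y). u x * v y) \<in> borel_measurable plane" by measurable
  show "integrable lborel (\<lambda>x. LINT y|lborel. norm (case (x, y) of (x, y) \<Rightarrow> u x * v y))"
    using u by (simp add: abs_mult)
  show "AE x in lborel. integrable lborel (\<lambda>y. case (x, y) of (x, y) \<Rightarrow> u x * v y)"
    using v by simp
qed

lemma square_kernel_section_integrable:
  assumes k: "square_kernel M k"
  shows "integrable lborel (\<lambda>y. k (x, y))" "integrable lborel (\<lambda>x. k (x, y))"
proof -
  note [measurable] = square_kernelD(1)[OF k]
  note b = square_kernelD(2)[OF k] and z = square_kernelD(3)[OF k] and M0 = square_kernelD(4)[OF k]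
  show "integrable lborel (\<lambda>y. k (x, y))"
    by (rule integrableI_bounded_set[where A="{0..1}" and B=M])
       (use b z in \<open>auto simp: unit_square_def\<close>)
  show "integrable lborel (\<lambda>x. k (x, y))"
    by (rule integrableI_bounded_set[where A="{0..1}" and B=M])
       (use b z in \<open>auto simp: unit_square_def\<close>)
qed

lemma square_kernel_section_L2:
  assumes k: "square_kernel M k"
  shows "(\<lambda>y. k (x, y)) \<in> L2_space" "L2_norm (\<lambda>y. k (x, y)) \<le> M"
    and "(\<lambda>x. k (x, y)) \<in> L2_space" "L2_norm (\<lambda>x. k (x, y)) \<le> M"
proof -
  note [measurable] = square_kernelD(1)[OF k]
  note b = square_kernelD(2)[OF k] and z = square_kernelD(3)[OF k]
  show "(\<lambda>y. k (x, y)) \<in> L2_space" "L2_norm (\<lambda>y. k (x, y)) \<le> M"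
    by (rule L2_space_bounded[where M=M]; use b z in \<open>auto simp: unit_square_def\<close>)+
  show "(\<lambda>x. k (x, y)) \<in> L2_space" "L2_norm (\<lambda>x. k (x, y)) \<le> M"
    by (rule L2_space_bounded[where M=M]; use b z in \<open>auto simp: unit_square_def\<close>)+
qed

lemma square_kernel_le_indicator:
  assumes k: "square_kernel M k"
  shows "norm (k (x, y)) \<le> M * indicator {0..1} x" "norm (k (x, y)) \<le> M * indicator {0..1} y"
  using square_kernelD(2,3)[OF k, of "(x, y)"] by (auto simp: unit_square_def split: split_indicator)

lemma square_kernel_integrable:
  assumes k: "square_kernel M k" and f: "f \<in> L2_space"
  shows "integrable plane (\<lambda>(x, y). norm (k (x, y)) * (norm (f x))\<^sup>2)"
    and "integrable plane (\<lambda>(x, y). norm (k (x, y)) * (norm (f y))\<^sup>2)"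
proof -
  note [measurable] = square_kernelD(1)[OF k]
  note b = square_kernelD(2)[OF k] and z = square_kernelD(3)[OF k] and M0 = square_kernelD(4)[OF k]
  note [measurable] = L2_spaceD(1)[OF f]
  note kb1 = square_kernel_le_indicator[OF k]
  have i: "integrable lborel (indicator {0..1::real} :: real \<Rightarrow> real)" by simp
  show "integrable plane (\<lambda>(x, y). norm (k (x, y)) * (norm (f x))\<^sup>2)"
  proof (rule Bochner_Integration.integrable_bound[OF integrable_on_plane_product[OF L2_spaceD(2)[OF f] integrable_mult_right[OF i, of M]]])
    show "AE p in plane. norm (case p of (x, y) \<Rightarrow> norm (k (x, y)) * (norm (f x))\<^sup>2)
        \<le> norm (case p of (x, y) \<Rightarrow> (norm (f x))\<^sup>2 * (M * indicator {0..1} y))"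
    proof (intro AE_I2, clarify)
      fix x y
      have "norm (k (x, y)) * (norm (f x))\<^sup>2 \<le> (M * indicator {0..1} y) * (norm (f x))\<^sup>2"
        by (intro mult_right_mono kb1) simp
      also have "\<dots> = (norm (f x))\<^sup>2 * (M * indicator {0..1} y)" by (rule mult.commute)
      finally show "norm (norm (k (x, y)) * (norm (f x))\<^sup>2) \<le> norm ((norm (f x))\<^sup>2 * (M * indicator {0..1} y))"
        by simp
    qed
  qed measurable
  show "integrable plane (\<lambda>(x, y). norm (k (x, y)) * (norm (f y))\<^sup>2)"
  proof (rule Bochner_Integration.integrable_bound[OF integrable_on_plane_product[OF integrable_mult_right[OF i, of M] L2_spaceD(2)[OF f]]])
    show "AE p in plane. norm (case p of (x, y) \<Rightarrow> norm (k (x, y)) * (norm (f y))\<^sup>2)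
        \<le> norm (case p of (x, y) \<Rightarrow> (M * indicator {0..1} x) * (norm (f y))\<^sup>2)"
    proof (intro AE_I2, clarify)
      fix x y
      have "norm (k (x, y)) * (norm (f y))\<^sup>2 \<le> (M * indicator {0..1} x) * (norm (f y))\<^sup>2"
        by (intro mult_right_mono kb1) simp
      then show "norm (norm (k (x, y)) * (norm (f y))\<^sup>2) \<le> norm ((M * indicator {0..1} x) * (norm (f y))\<^sup>2)"
        by simp
    qed
  qed measurable
qed

lemma square_kernel_bilinear_integrable:
  assumes k: "square_kernel M k" and f: "f \<in> L2_space" and g: "g \<in> L2_space"
  shows "integrable plane (\<lambda>(x, y). k (x, y) * f y * g x)"
proof (rule Bochner_Integration.integrable_bound[OF Bochner_Integration.integrable_add[OF square_kernel_integrable(1)[OF k g] square_kernel_integrable(2)[OF k f]]])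
  note [measurable] = L2_spaceD(1)[OF f] L2_spaceD(1)[OF g]
  have [measurable]: "k \<in> borel_measurable plane" using k by (simp add: square_kernel_def)
  show "(\<lambda>(x, y). k (x, y) * f y * g x) \<in> borel_measurable plane" by measurable
  have "norm (f y) * norm (g x) \<le> (norm (g x))\<^sup>2 + (norm (f y))\<^sup>2" for x y
    unfolding add.commute[of "(norm (g x))\<^sup>2"] by (rule mult_le_sum_squares) auto
  then have "norm (k (x, y) * f y * g x) \<le> norm (k (x, y)) * ((norm (g x))\<^sup>2 + (norm (f y))\<^sup>2)" for x y
    unfolding norm_mult mult.assoc by (intro mult_left_mono) auto
  then show "AE p in plane. norm (case p of (x, y) \<Rightarrow> k (x, y) * f y * g x)
     \<le> norm ((case p of (x, y) \<Rightarrow> norm (k (x, y)) * (norm (g x))\<^sup>2) + (case p of (x, y) \<Rightarrow> norm (k (x, y)) * (norm (f y))\<^sup>2))"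
    by (auto simp: algebra_simps)
qed

text \<open>
  Schur's test: \<open>\<bar>f(y) g(x)\<bar>\<close> is at most a weighted mean of \<open>\<bar>f(y)\<bar>\<^sup>2\<close> and \<open>\<bar>g(x)\<bar>\<^sup>2\<close>, and
  each square is integrated against the kernel in the other variable first.
\<close>

lemma Schur_test:
  assumes k: "square_kernel M k" and f: "f \<in> L2_space" and g: "g \<in> L2_space"
    and A1: "\<And>x. x \<in> {0..1} \<Longrightarrow> (LINT y|lborel. norm (k (x, y))) \<le> A1"
    and A2: "\<And>y. y \<in> {0..1} \<Longrightarrow> (LINT x|lborel. norm (k (x, y))) \<le> A2"
  shows "norm (LINT (x, y)|plane. k (x, y) * f y * g x) \<le> sqrt (A1 * A2) * L2_norm f * L2_norm g"
proof -
  let ?u = "\<lambda>(x, y). norm (k (x, y)) * (norm (g x))\<^sup>2" and ?v = "\<lambda>(x, y). norm (k (x, y)) * (norm (f y))\<^sup>2"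
  have z: "\<And>p. p \<notin> unit_square \<Longrightarrow> k p = 0"
    using k by (auto simp: square_kernel_def)
  have "0 \<le> A1" "0 \<le> A2"
    using order_trans[OF integral_nonneg_AE A1, of 0] order_trans[OF integral_nonneg_AE A2, of 0] by auto
  have A1': "(LINT y|lborel. norm (k (x, y))) \<le> A1" for x
    using A1[of x] z[of "(x, _)"] \<open>0 \<le> A1\<close> by (cases "x \<in> {0..1}") (auto simp: unit_square_def)
  have A2': "(LINT x|lborel. norm (k (x, y))) \<le> A2" for y
    using A2[of y] z[of "(_, y)"] \<open>0 \<le> A2\<close> by (cases "y \<in> {0..1}") (auto simp: unit_square_def)
  note ig = square_kernel_integrable(1)[OF k g] and if' = square_kernel_integrable(2)[OF k f]
  have Ig: "integral\<^sup>L plane ?u \<le> A1 * (L2_norm g)\<^sup>2"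
  proof -
    have "integral\<^sup>L plane ?u
        = (LINT x|lborel. (LINT y|lborel. norm (k (x, y)) * (norm (g x))\<^sup>2))"
      by (rule lborel_pair.integral_fst[symmetric]) (rule ig)
    also have "\<dots> \<le> (LINT x|lborel. A1 * (norm (g x))\<^sup>2)"
    proof (rule integral_mono)
      show "integrable lborel (\<lambda>x. LINT y|lborel. norm (k (x, y)) * (norm (g x))\<^sup>2)"
        by (rule lborel_pair.integrable_fst) (rule ig)
      show "(LINT y|lborel. norm (k (x, y)) * (norm (g x))\<^sup>2) \<le> A1 * (norm (g x))\<^sup>2" for x
        using A1'[of x] by (simp add: mult_right_mono)
    qed (use L2_spaceD(2)[OF g] in auto)
    finally show ?thesis by (simp add: L2_norm_squared)
  qed
  have If: "integral\<^sup>L plane ?v \<le> A2 * (L2_norm f)\<^sup>2"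
  proof -
    have "integral\<^sup>L plane ?v
        = (LINT y|lborel. (LINT x|lborel. norm (k (x, y)) * (norm (f y))\<^sup>2))"
      by (rule lborel_pair.integral_snd[symmetric]) (rule if')
    also have "\<dots> \<le> (LINT y|lborel. A2 * (norm (f y))\<^sup>2)"
    proof (rule integral_mono)
      show "integrable lborel (\<lambda>y. LINT x|lborel. norm (k (x, y)) * (norm (f y))\<^sup>2)"
        by (rule lborel_pair.integrable_snd) (rule if')
      show "(LINT x|lborel. norm (k (x, y)) * (norm (f y))\<^sup>2) \<le> A2 * (norm (f y))\<^sup>2" for y
        using A2'[of y] by (simp add: mult_right_mono)
    qed (use L2_spaceD(2)[OF f] in auto)
    finally show ?thesis by (simp add: L2_norm_squared)
  qed
  let ?I = "LINT (x, y)|plane. norm (k (x, y) * f y * g x)"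
  have "norm (LINT (x, y)|plane. k (x, y) * f y * g x) \<le> ?I"
    using integral_norm_bound[of plane "\<lambda>(x, y). k (x, y) * f y * g x"] by (simp add: case_prod_unfold)
  also have "?I \<le> sqrt ((A2 * (L2_norm f)\<^sup>2) * (A1 * (L2_norm g)\<^sup>2))"
  proof (rule le_sqrt_mult_if_weighted_means)
    fix t :: real assume t: "0 < t"
    have "?I \<le> (LINT p|plane. (t * ?v p + ?u p / t) / 2)"
    proof (rule integral_mono)
      show "integrable plane (\<lambda>(x, y). norm (k (x, y) * f y * g x))"
        using integrable_norm[OF square_kernel_bilinear_integrable[OF k f g]] by (simp add: case_prod_unfold)
      show "integrable plane (\<lambda>p. (t * ?v p + ?u p / t) / 2)"
        using ig if' by auto
      fix p :: "real \<times> real"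
      obtain x y where p: "p = (x, y)" by force
      have "norm (k (x, y)) * (norm (f y) * norm (g x)) \<le> norm (k (x, y)) * ((t * (norm (f y))\<^sup>2 + (norm (g x))\<^sup>2 / t) / 2)"
        by (rule mult_left_mono[OF weighted_mean_ge[OF t]]) simp
      then show "(case p of (x, y) \<Rightarrow> norm (k (x, y) * f y * g x)) \<le>
          (t * ?v p + ?u p / t) / 2"
        unfolding p by (simp add: norm_mult algebra_simps)
    qed
    also have "\<dots> = (t * integral\<^sup>L plane ?v + integral\<^sup>L plane ?u / t) / 2"
      using ig if' by simp
    also have "\<dots> \<le> (t * (A2 * (L2_norm f)\<^sup>2) + (A1 * (L2_norm g)\<^sup>2) / t) / 2"
      using If Ig t by (intro divide_right_mono add_mono mult_left_mono) auto
    finally show "?I \<le> (t * (A2 * (L2_norm f)\<^sup>2) + (A1 * (L2_norm g)\<^sup>2) / t) / 2" .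
  qed (use \<open>0 \<le> A1\<close> \<open>0 \<le> A2\<close> in auto)
  also have "sqrt ((A2 * (L2_norm f)\<^sup>2) * (A1 * (L2_norm g)\<^sup>2)) = sqrt (A1 * A2) * L2_norm f * L2_norm g"
    by (simp add: real_sqrt_mult)
  finally show ?thesis .
qed

text \<open>The transpose, without complex conjugation; its norm is that of the adjoint.\<close>

definition transposed_op :: "(real \<times> real \<Rightarrow> complex) \<Rightarrow> (real \<Rightarrow> complex) \<Rightarrow> real \<Rightarrow> complex"
  where "transposed_op k g y = (LINT x|lborel. k (x, y) * g x)"

text \<open>The kernel of \<open>T T\<^sup>*\<close>, where \<open>T\<close> is the operator with kernel \<open>k\<close>.\<close>

definition iterated_kernel :: "(real \<times> real \<Rightarrow> complex) \<Rightarrow> real \<times> real \<Rightarrow> complex"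
  where "iterated_kernel k = (\<lambda>(x1, x2). LINT y|lborel. k (x1, y) * cnj (k (x2, y)))"

lemma square_kernel_L2_integrable:
  assumes k: "square_kernel M k" and g: "g \<in> L2_space"
  shows "integrable lborel (\<lambda>x. k (x, y) * g x)" "integrable lborel (\<lambda>y. k (x, y) * g y)"
proof -
  note [measurable] = square_kernelD(1)[OF k]
  note b = square_kernelD(2)[OF k] and z = square_kernelD(3)[OF k] and M0 = square_kernelD(4)[OF k]
  note [measurable] = L2_spaceD(1)[OF g]
  have i: "(indicator {0..1} :: real \<Rightarrow> complex) \<in> L2_space"
    by (rule L2_space_bounded[where M=1]) (auto split: split_indicator)
  note kb1 = square_kernel_le_indicator[OF k]
  have I: "integrable lborel (\<lambda>x. M * (norm (indicator {0..1} x :: complex) * norm (g x)))"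
    by (intro integrable_mult_right L2_norm_times_integrable i g)
  show "integrable lborel (\<lambda>x. k (x, y) * g x)"
  proof (rule Bochner_Integration.integrable_bound[OF I])
    have "norm (k (x, y) * g x) \<le> M * (norm (indicator {0..1} x :: complex) * norm (g x))" for x
      unfolding norm_mult mult.assoc[symmetric] using kb1(1)[of x y]
      by (intro mult_right_mono) (auto split: split_indicator)
    then show "AE x in lborel. norm (k (x, y) * g x) \<le> norm (M * (norm (indicator {0..1} x :: complex) * norm (g x)))"
      using M0 by (auto simp: abs_mult)
  qed measurable
  show "integrable lborel (\<lambda>y. k (x, y) * g y)"
  proof (rule Bochner_Integration.integrable_bound[OF I])
    have "norm (k (x, y) * g y) \<le> M * (norm (indicator {0..1} y :: complex) * norm (g y))" for y
      unfolding norm_mult mult.assoc[symmetric] using kb1(2)[of x y]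
      by (intro mult_right_mono) (auto split: split_indicator)
    then show "AE y in lborel. norm (k (x, y) * g y) \<le> norm (M * (norm (indicator {0..1} y :: complex) * norm (g y)))"
      using M0 by (auto simp: abs_mult)
  qed measurable
qed

lemma square_kernel_product_integrable:
  assumes k: "square_kernel M k"
  shows "integrable lborel (\<lambda>y. k (x, y) * cnj (k (x', y)))"
  by (rule square_kernel_L2_integrable(2)[OF k L2_cnj[OF square_kernel_section_L2(1)[OF k]]])

lemma square_kernel_swap:
  assumes "square_kernel M k"
  shows "square_kernel M (\<lambda>(x, y). k (y, x))"
proof -
  have [measurable]: "k \<in> borel_measurable plane" using assms by (simp add: square_kernel_def)
  have "(\<lambda>(x, y). k (y, x)) \<in> borel_measurable plane" by measurable
  then show ?thesis using assms by (auto simp: square_kernel_def unit_square_def)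
qed

lemma transposed_op_L2:
  assumes k: "square_kernel M k" and g: "g \<in> L2_space"
  shows "transposed_op k g \<in> L2_space"
proof (rule L2_space_bounded)
  note [measurable] = square_kernelD(1)[OF k]
  note b = square_kernelD(2)[OF k] and z = square_kernelD(3)[OF k] and M0 = square_kernelD(4)[OF k]
  note [measurable] = L2_spaceD(1)[OF g]
  have "(\<lambda>y. LINT x|lborel. k (x, y) * g x) \<in> borel_measurable lborel" by measurable
  then show "transposed_op k g \<in> borel_measurable borel" unfolding transposed_op_def by simp
  fix y
  show "norm (transposed_op k g y) \<le> M * L2_norm g"
    unfolding transposed_op_def
    by (intro order_trans[OF L2_Cauchy_Schwarz[OF square_kernel_section_L2(3)[OF k] g]] mult_right_mono
        square_kernel_section_L2(4)[OF k]) simp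
  assume "y \<notin> {0..1}"
  then show "transposed_op k g y = 0" using z by (auto simp: transposed_op_def unit_square_def)
qed

lemma square_kernel_iterated:
  assumes k: "square_kernel M k"
  shows "square_kernel (M\<^sup>2) (iterated_kernel k)"
proof -
  note [measurable] = square_kernelD(1)[OF k]
  note b = square_kernelD(2)[OF k] and z = square_kernelD(3)[OF k] and M0 = square_kernelD(4)[OF k]
  have [measurable]: "cnj \<in> borel_measurable borel"
    by (intro borel_measurable_continuous_onI continuous_intros)
  have "(\<lambda>(x1, x2). LINT y|lborel. k (x1, y) * cnj (k (x2, y))) \<in> borel_measurable plane"
    unfolding case_prod_unfold by measurable
  moreover have "norm (iterated_kernel k p) \<le> M\<^sup>2" for p
  proof -
    obtain x1 x2 where p: "p = (x1, x2)" by force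
    note kx = square_kernel_section_L2(1)[OF k] and n = square_kernel_section_L2(2)[OF k]
    have "L2_norm (\<lambda>y. cnj (k (x2, y))) = L2_norm (\<lambda>y. k (x2, y))" by (simp add: L2_norm_def)
    then have "norm (iterated_kernel k p) \<le> L2_norm (\<lambda>y. k (x1, y)) * L2_norm (\<lambda>y. k (x2, y))"
      using L2_Cauchy_Schwarz[OF kx L2_cnj[OF kx], of x1 x2] by (simp add: iterated_kernel_def p)
    also have "\<dots> \<le> M * M" by (intro mult_mono n M0) auto
    finally show ?thesis by (simp add: power2_eq_square)
  qed
  moreover have "iterated_kernel k p = 0" if "p \<notin> unit_square" for p
  proof -
    obtain x1 x2 where p: "p = (x1, x2)" by force
    have zero: "k (x1, y) * cnj (k (x2, y)) = 0" for y
      using that z[of "(x1, y)"] z[of "(x2, y)"] by (auto simp: p unit_square_def)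
    show ?thesis by (simp only: iterated_kernel_def p prod.case zero Bochner_Integration.integral_zero)
  qed
  ultimately show ?thesis unfolding square_kernel_def iterated_kernel_def by auto
qed

text \<open>
  The square of the norm of \<open>transposed_op k g\<close> is the bilinear form of the iterated
  kernel at \<open>cnj g\<close> and \<open>g\<close>, which is bounded by Schur's test; the iterated kernel is
  Hermitian, so one of the two Schur conditions suffices.
\<close>

lemma TT_star_bound:
  assumes k: "square_kernel M k" and g: "g \<in> L2_space"
    and A: "\<And>x. x \<in> {0..1} \<Longrightarrow> (LINT x'|lborel. norm (iterated_kernel k (x, x'))) \<le> A"
  shows "(L2_norm (transposed_op k g))\<^sup>2 \<le> A * (L2_norm g)\<^sup>2"
proof -
  note [measurable] = square_kernelD(1)[OF k]
  note b = square_kernelD(2)[OF k] and z = square_kernelD(3)[OF k] and M0 = square_kernelD(4)[OF k]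
  note [measurable] = L2_spaceD(1)[OF g]
  have [measurable]: "cnj \<in> borel_measurable borel"
    by (intro borel_measurable_continuous_onI continuous_intros)
  have g': "(\<lambda>x. cnj (g x)) \<in> L2_space" by (rule L2_cnj[OF g])
  have ng': "L2_norm (\<lambda>x. cnj (g x)) = L2_norm g" by (simp add: L2_norm_def)
  let ?K = "iterated_kernel k"
  have K: "square_kernel (M\<^sup>2) ?K" by (rule square_kernel_iterated[OF k])
  have Ksym: "norm (?K (x, x')) = norm (?K (x', x))" for x x'
  proof -
    have "?K (x, x') = cnj (?K (x', x))"
      unfolding iterated_kernel_def by (simp add: mult.commute flip: Bochner_Integration.integral_cnj)
    then show ?thesis by simp
  qed
  have A': "(LINT x|lborel. norm (?K (x, x'))) \<le> A" if "x' \<in> {0..1}" for x'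
    using A[OF that] by (subst Ksym)
  have A0: "0 \<le> A" using order_trans[OF integral_nonneg_AE A, of 0] by auto
  let ?h = "\<lambda>p y. k (fst p, y) * cnj (k (snd p, y)) * (g (fst p) * cnj (g (snd p)))"
  interpret Q: pair_sigma_finite plane lborel ..
  let ?u = "\<lambda>x. M * (norm (indicator {0..1} x :: complex) * norm (g x))"
  have u: "integrable lborel ?u"
    by (intro integrable_mult_right L2_norm_times_integrable g L2_space_bounded[where M=1]) (auto split: split_indicator)
  have kb: "norm (k (x, y) * g x) \<le> ?u x * indicator {0..1} y" for x y
    using b[of "(x, y)"] z[of "(x, y)"]
    by (auto simp: unit_square_def norm_mult mult_right_mono split: split_indicator)
  have hb: "norm (?h p y) \<le> (case p of (x, x') \<Rightarrow> ?u x * ?u x') * indicator {0..1} y" for p y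
  proof -
    obtain x x' where p: "p = (x, x')" by force
    have "norm (?h p y) = norm (k (x, y) * g x) * norm (k (x', y) * g x')"
      by (simp add: p norm_mult)
    also have "\<dots> \<le> (?u x * indicator {0..1} y) * (?u x' * indicator {0..1} y)"
      by (intro mult_mono' kb norm_ge_zero)
    also have "\<dots> = (case p of (x, x') \<Rightarrow> ?u x * ?u x') * indicator {0..1} y"
      by (cases "y \<in> {0..1}") (simp_all add: p)
    finally show ?thesis .
  qed
  have hint: "integrable (plane \<Otimes>\<^sub>M lborel) (\<lambda>(p, y). ?h p y)"
  proof (rule Bochner_Integration.integrable_bound)
    show "integrable (plane \<Otimes>\<^sub>M lborel) (\<lambda>(p, y). (case p of (x, x') \<Rightarrow> ?u x * ?u x') * indicator {0..1::real} y)"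
    proof (rule Q.Fubini_integrable)
      have uu: "integrable plane (\<lambda>(x, x'). ?u x * ?u x')" by (rule integrable_on_plane_product[OF u u])
      then show "integrable plane (\<lambda>p. LINT y|lborel. norm (case (p, y) of (p, y) \<Rightarrow> (case p of (x, x') \<Rightarrow> ?u x * ?u x') * indicator {0..1::real} y))"
        by (simp add: abs_mult case_prod_unfold abs_of_nonneg[OF M0])
    qed (auto simp: case_prod_unfold)
    show "AE q in plane \<Otimes>\<^sub>M lborel. norm (case q of (p, y) \<Rightarrow> ?h p y) \<le> norm (case q of (p, y) \<Rightarrow> (case p of (x, x') \<Rightarrow> ?u x * ?u x') * indicator {0..1::real} y)"
      using order_trans[OF hb abs_ge_self] by (auto simp: case_prod_unfold)
  qed measurable
  have sq: "complex_of_real ((norm (transposed_op k g y))\<^sup>2) = (LINT p|plane. ?h p y)" for y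
  proof -
    have i: "integrable lborel (\<lambda>x. k (x, y) * g x)" by (rule square_kernel_L2_integrable(1)[OF k g])
    have "complex_of_real ((norm (transposed_op k g y))\<^sup>2) = (LINT x|lborel. k (x, y) * g x) * cnj (LINT x|lborel. k (x, y) * g x)"
      unfolding transposed_op_def by (rule complex_norm_square)
    also have "\<dots> = (LINT x|lborel. k (x, y) * g x) * (LINT x'|lborel. cnj (k (x', y) * g x'))"
      by (simp flip: Bochner_Integration.integral_cnj)
    also have "\<dots> = (LINT x|lborel. (LINT x'|lborel. ?h (x, x') y))"
    proof -
      have "(LINT x|lborel. k (x, y) * g x) * (LINT x'|lborel. cnj (k (x', y) * g x'))
          = (LINT x|lborel. k (x, y) * g x * (LINT x'|lborel. cnj (k (x', y) * g x')))"
        by (rule integral_mult_left_zero[symmetric])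
      also have "\<dots> = (LINT x|lborel. LINT x'|lborel. (k (x, y) * g x) * cnj (k (x', y) * g x'))"
        by (simp only: integral_mult_right_zero)
      also have "\<dots> = (LINT x|lborel. (LINT x'|lborel. ?h (x, x') y))"
        by (intro Bochner_Integration.integral_cong refl) (simp add: mult_ac)
      finally show ?thesis .
    qed
    also have "\<dots> = (LINT p|plane. ?h p y)"
    proof (subst lborel_pair.integral_fst)
      have "integrable plane (\<lambda>(x, x'). ?u x * ?u x')" by (rule integrable_on_plane_product[OF u u])
      moreover have "norm (?h p y) \<le> norm (case p of (x, x') \<Rightarrow> ?u x * ?u x')" for p
      proof -
        have "0 \<le> (case p of (x, x') \<Rightarrow> ?u x * ?u x')" using M0 by (auto simp: case_prod_unfold)
        then show ?thesis using hb[of p y] by (auto split: split_indicator_asm)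
      qed
      moreover have "(\<lambda>p. ?h p y) \<in> borel_measurable plane" by measurable
      ultimately have "integrable plane (\<lambda>p. ?h p y)"
        using Bochner_Integration.integrable_bound by (metis (no_types, lifting) AE_I2)
      then show "integrable plane (\<lambda>(x, x'). ?h (x, x') y)" by (simp add: case_prod_unfold)
    qed (simp add: case_prod_unfold)
    finally show ?thesis .
  qed
  have "complex_of_real ((L2_norm (transposed_op k g))\<^sup>2) = (LINT y|lborel. (LINT p|plane. ?h p y))"
    unfolding L2_norm_squared integral_complex_of_real[symmetric] sq ..
  also have "\<dots> = (LINT p|plane. (LINT y|lborel. ?h p y))"
    by (rule Q.Fubini_integral[OF hint])
  also have "\<dots> = (LINT (x, x')|plane. ?K (x, x') * cnj (g x') * g x)"
    by (intro Bochner_Integration.integral_cong refl) (auto simp: iterated_kernel_def mult_ac case_prod_unfold)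
  finally have "norm (complex_of_real ((L2_norm (transposed_op k g))\<^sup>2)) = norm (LINT (x, x')|plane. ?K (x, x') * cnj (g x') * g x)"
    by (rule arg_cong)
  then have "(L2_norm (transposed_op k g))\<^sup>2 = norm (LINT (x, x')|plane. ?K (x, x') * cnj (g x') * g x)"
    by (simp only: norm_of_real abs_power2)
  also have "\<dots> \<le> sqrt (A * A) * L2_norm (\<lambda>x. cnj (g x)) * L2_norm g"
    by (rule Schur_test[OF K g' g A A'])
  finally show ?thesis using A0 by (simp add: ng' power2_eq_square)
qed

lemma bilinear_form_eq:
  assumes k: "square_kernel M k" and f: "f \<in> L2_space" and g: "g \<in> L2_space"
  shows "(LINT (x, y)|plane. k (x, y) * f y * g x) = (LINT y|lborel. f y * transposed_op k g y)"
    and "(LINT (x, y)|plane. k (x, y) * f y * g x) = (LINT x|lborel. (LINT y|lborel. k (x, y) * f y) * g x)"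
proof -
  note int = square_kernel_bilinear_integrable[OF k f g]
  show "(LINT (x, y)|plane. k (x, y) * f y * g x) = (LINT y|lborel. f y * transposed_op k g y)"
    unfolding lborel_pair.integral_snd[OF int, symmetric] transposed_op_def
    unfolding integral_mult_right_zero[symmetric]
    by (intro Bochner_Integration.integral_cong refl) (simp add: mult_ac)
  show "(LINT (x, y)|plane. k (x, y) * f y * g x) = (LINT x|lborel. (LINT y|lborel. k (x, y) * f y) * g x)"
    unfolding lborel_pair.integral_fst[OF int, symmetric]
    unfolding integral_mult_left_zero[symmetric] ..
qed

lemma bilinear_form_le_transposed:
  assumes k: "square_kernel M k" and f: "f \<in> L2_space" and g: "g \<in> L2_space"
    and A: "0 \<le> A" "(L2_norm (transposed_op k g))\<^sup>2 \<le> A * (L2_norm g)\<^sup>2"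
  shows "norm (LINT (x, y)|plane. k (x, y) * f y * g x) \<le> sqrt A * L2_norm f * L2_norm g"
proof -
  have "L2_norm (transposed_op k g) \<le> sqrt (A * (L2_norm g)\<^sup>2)"
    using A by (simp add: real_le_rsqrt)
  also have "\<dots> = sqrt A * L2_norm g" by (simp add: real_sqrt_mult)
  finally have *: "L2_norm (transposed_op k g) \<le> sqrt A * L2_norm g" .
  have "norm (LINT (x, y)|plane. k (x, y) * f y * g x) \<le> L2_norm f * L2_norm (transposed_op k g)"
    unfolding bilinear_form_eq(1)[OF k f g] by (rule L2_Cauchy_Schwarz[OF f transposed_op_L2[OF k g]])
  also have "\<dots> \<le> L2_norm f * (sqrt A * L2_norm g)" by (intro mult_left_mono *) simp
  finally show ?thesis by (simp add: mult_ac)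
qed

lemma kernel_op_L2:
  assumes k: "square_kernel M k" and f: "f \<in> L2_space"
  shows "(\<lambda>x. LINT y|lborel. k (x, y) * f y) \<in> L2_space"
proof -
  have "transposed_op (\<lambda>(x, y). k (y, x)) f = (\<lambda>x. LINT y|lborel. k (x, y) * f y)"
    by (auto simp: transposed_op_def)
  then show ?thesis using transposed_op_L2[OF square_kernel_swap[OF k] f] by simp
qed

text \<open>Duality: the bilinear form is tested on the conjugate of the image of \<open>f\<close>.\<close>

lemma kernel_op_norm_le:
  assumes k: "square_kernel M k" and f: "f \<in> L2_space" and A: "0 \<le> A"
    and bil: "\<And>g. g \<in> L2_space \<Longrightarrow> norm (LINT (x, y)|plane. k (x, y) * f y * g x) \<le> A * L2_norm f * L2_norm g"
  shows "L2_norm (\<lambda>x. LINT y|lborel. k (x, y) * f y) \<le> A * L2_norm f"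
proof -
  let ?T = "\<lambda>x. LINT y|lborel. k (x, y) * f y"
  have T: "?T \<in> L2_space" by (rule kernel_op_L2[OF k f])
  then have g: "(\<lambda>x. cnj (?T x)) \<in> L2_space" by (rule L2_cnj)
  have n: "L2_norm (\<lambda>x. cnj (?T x)) = L2_norm ?T" unfolding L2_norm_def by simp
  have "complex_of_real ((L2_norm ?T)\<^sup>2) = (LINT x|lborel. ?T x * cnj (?T x))"
    unfolding L2_norm_squared integral_complex_of_real[symmetric] complex_norm_square ..
  also have "\<dots> = (LINT (x, y)|plane. k (x, y) * f y * cnj (?T x))"
    by (rule bilinear_form_eq(2)[OF k f g, symmetric])
  finally have "norm (complex_of_real ((L2_norm ?T)\<^sup>2)) = norm (LINT (x, y)|plane. k (x, y) * f y * cnj (?T x))"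
    by (rule arg_cong)
  then have "(L2_norm ?T)\<^sup>2 = norm (LINT (x, y)|plane. k (x, y) * f y * cnj (?T x))"
    by (simp only: norm_of_real abs_power2)
  also have "\<dots> \<le> A * L2_norm f * L2_norm ?T" using bil[OF g] unfolding n .
  finally have "L2_norm ?T * L2_norm ?T \<le> (A * L2_norm f) * L2_norm ?T" by (simp add: power2_eq_square)
  then show ?thesis
    using A L2_norm_nonneg[of ?T] L2_norm_nonneg[of f]
    by (cases "L2_norm ?T = 0") (auto simp: mult_le_cancel_right simp del: L2_norm_nonneg)
qed

text \<open>
  The \<open>T T\<^sup>*\<close> bound when \<open>x\<close> is restricted to cells of length \<open>\<epsilon>\<close>. The function \<open>g\<close> is
  split along the cells; at a given \<open>y\<close> at most \<open>N\<close> of the pieces have a nonzero image, so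
  by Cauchy-Schwarz the square of the sum is at most \<open>N\<close> times the sum of the squares.
  Only the iterated kernel at pairs in a common cell enters.
\<close>

lemma localized_TT_star_bound:
  assumes k: "square_kernel M k" and g: "g \<in> L2_space" and e: "0 < \<epsilon>" and A0: "0 \<le> A"
    and N: "\<And>y. y \<in> {0..1} \<Longrightarrow> real (card ((\<lambda>x. \<lfloor>x / \<epsilon>\<rfloor>) ` {x\<in>{0..1}. k (x, y) \<noteq> 0})) \<le> N"
    and A: "\<And>x. x \<in> {0..1} \<Longrightarrow>
      (LINT x'|lborel. indicator {x'. \<lfloor>x' / \<epsilon>\<rfloor> = \<lfloor>x / \<epsilon>\<rfloor>} x' * norm (iterated_kernel k (x, x'))) \<le> A"
  shows "(L2_norm (transposed_op k g))\<^sup>2 \<le> N * A * (L2_norm g)\<^sup>2"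
proof -
  let ?cell = "\<lambda>i. {x. \<lfloor>x / \<epsilon>\<rfloor> = i}"
  note [measurable] = square_kernelD(1)[OF k]
  note b = square_kernelD(2)[OF k] and z = square_kernelD(3)[OF k] and M0 = square_kernelD(4)[OF k]
  note [measurable] = L2_spaceD(1)[OF g]
  have [measurable]: "?cell i \<in> sets borel" for i by measurable
  define I where "I = {\<lfloor>0 / \<epsilon>\<rfloor>..\<lfloor>1 / \<epsilon>\<rfloor>}"
  have I: "\<lfloor>x / \<epsilon>\<rfloor> \<in> I" if "x \<in> {0..1}" for x
    using that e unfolding I_def by (auto intro!: floor_mono divide_right_mono)
  have finI: "finite I" by (simp add: I_def)
  define gi where "gi = (\<lambda>i x. indicator (?cell i) x * g x)"
  define ki where "ki = (\<lambda>i p. indicator (?cell i) (fst p) * k p)"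
  have gi: "gi i \<in> L2_space" for i unfolding gi_def by (rule L2_restrict[OF g]) measurable
  have ki: "square_kernel M (ki i)" for i
  proof -
    have "ki i \<in> borel_measurable plane" unfolding ki_def by measurable
    moreover have "norm (ki i p) \<le> M" "p \<notin> unit_square \<Longrightarrow> ki i p = 0" for p
      using b[of p] z[of p] order_trans[OF norm_ge_zero b] by (auto simp: ki_def norm_mult split: split_indicator)
    ultimately show ?thesis by (auto simp: square_kernel_def)
  qed
  have cellsum: "(\<Sum>i\<in>I. indicator (?cell i) x) = (1 :: 'b :: comm_semiring_1)" if "x \<in> {0..1}" for x
    using I[OF that] finI by (simp add: indicator_def if_distrib sum.delta' cong: if_cong)
  have Ri: "transposed_op (ki i) (gi i) y = transposed_op k (gi i) y" for i y
    unfolding transposed_op_def ki_def gi_def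
    by (intro Bochner_Integration.integral_cong refl) (auto split: split_indicator)
  have Rsum: "transposed_op k g y = (\<Sum>i\<in>I. transposed_op k (gi i) y)" for y
  proof -
    have "k (x, y) * g x = (\<Sum>i\<in>I. k (x, y) * gi i x)" for x
    proof (cases "x \<in> {0..1}")
      case True
      have "(\<Sum>i\<in>I. k (x, y) * gi i x) = (\<Sum>i\<in>I. indicator (?cell i) x) * (k (x, y) * g x)"
        unfolding gi_def sum_distrib_right by (intro sum.cong refl) (simp add: mult_ac)
      then show ?thesis by (simp add: cellsum[OF True])
    qed (use z in \<open>auto simp: unit_square_def\<close>)
    then show ?thesis unfolding transposed_op_def
      using square_kernel_L2_integrable(1)[OF k gi] by simp
  qed
  have N0: "0 \<le> N" using order_trans[OF of_nat_0_le_iff N[of 0]] by auto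
  have pt: "(norm (transposed_op k g y))\<^sup>2 \<le> N * (\<Sum>i\<in>I. (norm (transposed_op k (gi i) y))\<^sup>2)" for y
  proof -
    define J where "J = (\<lambda>x. \<lfloor>x / \<epsilon>\<rfloor>) ` {x\<in>{0..1}. k (x, y) \<noteq> 0}"
    have JI: "J \<subseteq> I" using I by (auto simp: J_def)
    have zero: "transposed_op k (gi i) y = 0" if "i \<notin> J" for i
    proof -
      have zero: "k (x, y) * gi i x = 0" for x
        using that z[of "(x, y)"] by (auto simp: J_def gi_def unit_square_def split: split_indicator)
      show ?thesis by (simp only: transposed_op_def zero Bochner_Integration.integral_zero)
    qed
    have cJ: "real (card J) \<le> N"
    proof (cases "y \<in> {0..1}")
      case True then show ?thesis using N unfolding J_def by auto
    next
      case False
      then have "J = {}" using z by (auto simp: J_def unit_square_def)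
      then show ?thesis using N0 by simp
    qed
    have "transposed_op k g y = (\<Sum>i\<in>J. transposed_op k (gi i) y)"
      unfolding Rsum by (rule sum.mono_neutral_right[OF finI JI]) (use zero in auto)
    then have "(norm (transposed_op k g y))\<^sup>2 \<le> (\<Sum>i\<in>J. norm (transposed_op k (gi i) y))\<^sup>2"
      by (simp only:) (intro power_mono norm_sum norm_ge_zero)
    also have "\<dots> \<le> (\<Sum>i\<in>J. (norm (transposed_op k (gi i) y))\<^sup>2) * card J"
      by (rule sum_squared_le_sum_of_squares)
    also have "\<dots> \<le> (\<Sum>i\<in>I. (norm (transposed_op k (gi i) y))\<^sup>2) * N"
      using cJ by (intro mult_mono sum_mono2[OF finI JI] sum_nonneg) auto
    finally show ?thesis by (simp add: mult.commute)
  qed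
  have L: "transposed_op k h \<in> L2_space" if "h \<in> L2_space" for h by (rule transposed_op_L2[OF k that])
  have "(L2_norm (transposed_op k g))\<^sup>2 \<le> (LINT y|lborel. N * (\<Sum>i\<in>I. (norm (transposed_op k (gi i) y))\<^sup>2))"
    unfolding L2_norm_squared
    using pt by (intro integral_mono) (auto intro!: L2_spaceD(2) L g gi)
  also have "\<dots> = N * (\<Sum>i\<in>I. (L2_norm (transposed_op k (gi i)))\<^sup>2)"
    unfolding L2_norm_squared
    by (simp add: Bochner_Integration.integral_sum L2_spaceD(2)[OF L[OF gi]])
  also have "\<dots> \<le> N * (\<Sum>i\<in>I. A * (L2_norm (gi i))\<^sup>2)"
  proof (intro mult_left_mono sum_mono N0)
    fix i assume "i \<in> I"
    have "(L2_norm (transposed_op (ki i) (gi i)))\<^sup>2 \<le> A * (L2_norm (gi i))\<^sup>2"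
    proof (rule TT_star_bound[OF ki gi])
      fix x :: real assume x: "x \<in> {0..1}"
      have eq: "norm (iterated_kernel (ki i) (x, x')) = indicator (?cell i) x * (indicator (?cell i) x' * norm (iterated_kernel k (x, x')))" for x'
        unfolding iterated_kernel_def ki_def by (auto split: split_indicator)
      show "(LINT x'|lborel. norm (iterated_kernel (ki i) (x, x'))) \<le> A"
        unfolding eq using A[OF x] A0 by (auto split: split_indicator)
    qed
    then show "(L2_norm (transposed_op k (gi i)))\<^sup>2 \<le> A * (L2_norm (gi i))\<^sup>2"
      unfolding L2_norm_squared Ri .
  qed
  also have "\<dots> = N * A * (\<Sum>i\<in>I. (L2_norm (gi i))\<^sup>2)" by (simp add: sum_distrib_left mult.assoc)
  also have "\<dots> \<le> N * A * (L2_norm g)\<^sup>2"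
  proof (rule mult_left_mono)
    have "(\<Sum>i\<in>I. (L2_norm (gi i))\<^sup>2) = (LINT x|lborel. (\<Sum>i\<in>I. (norm (gi i x))\<^sup>2))"
      unfolding L2_norm_squared by (simp add: Bochner_Integration.integral_sum L2_spaceD(2)[OF gi])
    also have "\<dots> \<le> (LINT x|lborel. (norm (g x))\<^sup>2)"
    proof (rule integral_mono)
      fix x
      have "(\<Sum>i\<in>I. (norm (gi i x))\<^sup>2) = (\<Sum>i\<in>I. if i = \<lfloor>x / \<epsilon>\<rfloor> then (norm (g x))\<^sup>2 else 0)"
        by (intro sum.cong refl) (auto simp: gi_def norm_mult split: split_indicator)
      also have "\<dots> \<le> (norm (g x))\<^sup>2" using finI by (simp add: sum.delta')
      finally show "(\<Sum>i\<in>I. (norm (gi i x))\<^sup>2) \<le> (norm (g x))\<^sup>2" .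
    qed (use L2_spaceD(2)[OF gi] L2_spaceD(2)[OF g] in auto)
    finally show "(\<Sum>i\<in>I. (L2_norm (gi i))\<^sup>2) \<le> (L2_norm g)\<^sup>2" by (simp add: L2_norm_squared)
  qed (use N0 A0 in auto)
  finally show ?thesis .
qed

definition bilinear_bound :: "(real \<times> real \<Rightarrow> complex) \<Rightarrow> real \<Rightarrow> bool"
  where "bilinear_bound k C \<longleftrightarrow> (\<forall>f\<in>L2_space. \<forall>g\<in>L2_space.
     norm (LINT (x, y)|plane. k (x, y) * f y * g x) \<le> C * L2_norm f * L2_norm g)"

lemma bilinear_bound_mono:
  assumes "bilinear_bound k C" "C \<le> C'"
  shows "bilinear_bound k C'"
  unfolding bilinear_bound_def
proof (intro ballI)
  fix f g assume fg: "f \<in> L2_space" "g \<in> L2_space"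
  then have "norm (LINT (x, y)|plane. k (x, y) * f y * g x) \<le> C * L2_norm f * L2_norm g"
    using assms unfolding bilinear_bound_def by blast
  also have "\<dots> \<le> C' * L2_norm f * L2_norm g" using assms by (intro mult_right_mono) auto
  finally show "norm (LINT (x, y)|plane. k (x, y) * f y * g x) \<le> C' * L2_norm f * L2_norm g" .
qed

lemma square_kernel_add:
  assumes k: "square_kernel M k" and k': "square_kernel M' k'"
  shows "square_kernel (M + M') (\<lambda>p. k p + k' p)"
proof -
  have [measurable]: "k \<in> borel_measurable plane" "k' \<in> borel_measurable plane"
    using k k' by (auto simp: square_kernel_def)
  have "(\<lambda>p. k p + k' p) \<in> borel_measurable plane" by measurable
  moreover have "norm (k p + k' p) \<le> M + M'" for p
    using k k' unfolding square_kernel_def by (intro norm_triangle_mono) blast+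
  ultimately show ?thesis using k k' by (auto simp: square_kernel_def)
qed

lemma bilinear_bound_add:
  assumes k: "square_kernel M k" "square_kernel M' k'" and B: "bilinear_bound k C" "bilinear_bound k' C'"
  shows "bilinear_bound (\<lambda>p. k p + k' p) (C + C')"
  unfolding bilinear_bound_def
proof (intro ballI)
  fix f g assume f: "f \<in> L2_space" and g: "g \<in> L2_space"
  have "(LINT (x, y)|plane. (k (x, y) + k' (x, y)) * f y * g x)
     = (LINT p|plane. (case p of (x, y) \<Rightarrow> k (x, y) * f y * g x) + (case p of (x, y) \<Rightarrow> k' (x, y) * f y * g x))"
    by (intro Bochner_Integration.integral_cong refl) (auto simp: algebra_simps)
  also have "\<dots> = (LINT (x, y)|plane. k (x, y) * f y * g x) + (LINT (x, y)|plane. k' (x, y) * f y * g x)"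
    by (intro Bochner_Integration.integral_add square_kernel_bilinear_integrable[OF k(1) f g]
        square_kernel_bilinear_integrable[OF k(2) f g])
  also have "norm \<dots> \<le> C * L2_norm f * L2_norm g + C' * L2_norm f * L2_norm g"
    using B f g unfolding bilinear_bound_def by (intro norm_triangle_mono) auto
  finally show "norm (LINT (x, y)|plane. (k (x, y) + k' (x, y)) * f y * g x) \<le> (C + C') * L2_norm f * L2_norm g"
    by (simp add: algebra_simps)
qed

section \<open>Smooth functions on the closed square\<close>

lemma smooth_on_partial_x: "smooth_on U f \<Longrightarrow> smooth_on U (partial_x U f)"
  unfolding smooth_on_def by (metis Ck_on.simps(2))

lemma smooth_on_partial_y: "smooth_on U f \<Longrightarrow> smooth_on U (partial_y U f)"
  unfolding smooth_on_def by (metis Ck_on.simps(2))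

lemma smooth_on_partial_y_funpow: "smooth_on U f \<Longrightarrow> smooth_on U ((partial_y U ^^ n) f)"
  by (induction n) (auto intro: smooth_on_partial_y)

lemma smooth_on_partial_x_funpow: "smooth_on U f \<Longrightarrow> smooth_on U ((partial_x U ^^ n) f)"
  by (induction n) (auto intro: smooth_on_partial_x)

lemma smooth_on_imp_continuous_on: "smooth_on U f \<Longrightarrow> continuous_on U f"
  unfolding smooth_on_def by (metis Ck_on.simps(1))

lemma partial_derivatives:
  assumes "smooth_on U f" "(x, y) \<in> U"
  shows "((\<lambda>t. f (t, y)) has_vector_derivative partial_x U f (x, y)) (at x within {t. (t, y) \<in> U})"
    and "((\<lambda>t. f (x, t)) has_vector_derivative partial_y U f (x, y)) (at y within {t. (x, t) \<in> U})"
proof -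
  have "Ck_on (Suc 0) U f" using assms(1) unfolding smooth_on_def by blast
  then have "(\<lambda>t. f (t, y)) differentiable (at x within {t. (t, y) \<in> U})"
    "(\<lambda>t. f (x, t)) differentiable (at y within {t. (x, t) \<in> U})"
    using assms(2) by auto
  then show "((\<lambda>t. f (t, y)) has_vector_derivative partial_x U f (x, y)) (at x within {t. (t, y) \<in> U})"
    "((\<lambda>t. f (x, t)) has_vector_derivative partial_y U f (x, y)) (at y within {t. (x, t) \<in> U})"
    by (auto simp: vector_derivative_works partial_x_def partial_y_def)
qed

lemma square_slices:
  assumes "t \<in> {0..1}"
  shows "{s. (s, t) \<in> unit_square} = {0..1}" "{s. (t, s) \<in> unit_square} = {0..1}"
  using assms by (auto simp: unit_square_def)

lemma partial_derivatives_square: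
  assumes "smooth_on unit_square f" "x \<in> {0..1}" "y \<in> {0..1}"
  shows "((\<lambda>t. f (t, y)) has_vector_derivative partial_x unit_square f (x, y)) (at x within {0..1})"
    and "((\<lambda>t. f (x, t)) has_vector_derivative partial_y unit_square f (x, y)) (at y within {0..1})"
proof -
  have "(x, y) \<in> unit_square" using assms by (auto simp: unit_square_def)
  from partial_derivatives[OF assms(1) this]
  show "((\<lambda>t. f (t, y)) has_vector_derivative partial_x unit_square f (x, y)) (at x within {0..1})"
    "((\<lambda>t. f (x, t)) has_vector_derivative partial_y unit_square f (x, y)) (at y within {0..1})"
    using square_slices[OF assms(2)] square_slices[OF assms(3)] by simp_all
qed

lemma compact_unit_square: "compact unit_square" and connected_unit_square: "connected unit_square"
  unfolding unit_square_def by (auto intro!: compact_Times connected_Times)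

lemma unit_square_borel [measurable]: "unit_square \<in> sets borel"
  using compact_unit_square by (intro borel_closed compact_imp_closed)

lemma mem_square: "0 \<le> x \<Longrightarrow> x \<le> 1 \<Longrightarrow> 0 \<le> y \<Longrightarrow> y \<le> 1 \<Longrightarrow> (x, y) \<in> unit_square"
  by (simp add: unit_square_def)

lemma continuous_on_square_slices:
  assumes "continuous_on unit_square f" "t \<in> {0..1}"
  shows "continuous_on {0..1} (\<lambda>s. f (t, s))" "continuous_on {0..1} (\<lambda>s. f (s, t))"
  by (rule continuous_on_compose2[OF assms(1)]; use assms(2) in \<open>auto intro!: continuous_intros simp: unit_square_def\<close>)+

lemma square_bounded:
  fixes f :: "real \<times> real \<Rightarrow> 'a::real_normed_vector"
  assumes "continuous_on unit_square f"
  obtains M where "1 \<le> M" "\<And>p. p \<in> unit_square \<Longrightarrow> norm (f p) \<le> M"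
proof -
  have "bounded (f ` unit_square)"
    by (intro compact_imp_bounded compact_continuous_image assms compact_unit_square)
  then obtain B where B: "\<forall>p\<in>unit_square. norm (f p) \<le> B" by (auto simp: bounded_iff)
  show ?thesis by (rule that[of "max 1 B"]) (use B in \<open>auto simp: le_max_iff_disj\<close>)
qed

lemma square_bounded_below:
  fixes f :: "real \<times> real \<Rightarrow> real"
  assumes "continuous_on unit_square f" "\<And>p. p \<in> unit_square \<Longrightarrow> f p \<noteq> 0"
  obtains c where "0 < c" "\<And>p. p \<in> unit_square \<Longrightarrow> c \<le> \<bar>f p\<bar>"
proof -
  have ne: "unit_square \<noteq> {}" by (auto simp: unit_square_def)
  have "continuous_on unit_square (\<lambda>p. \<bar>f p\<bar>)" using assms(1) by (intro continuous_intros)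
  from continuous_attains_inf[OF compact_unit_square ne this]
  obtain p where p: "p \<in> unit_square" "\<forall>q\<in>unit_square. \<bar>f p\<bar> \<le> \<bar>f q\<bar>" by blast
  show ?thesis by (rule that[of "\<bar>f p\<bar>"]) (use p assms(2)[of p] in auto)
qed

text \<open>
  A nonvanishing continuous function on the connected square keeps its sign, so its
  integrals over segments do not cancel.
\<close>

lemma square_constant_sign:
  fixes f :: "real \<times> real \<Rightarrow> real"
  assumes "continuous_on unit_square f" "\<And>p. p \<in> unit_square \<Longrightarrow> c \<le> \<bar>f p\<bar>" "0 < c"
  shows "(\<forall>p\<in>unit_square. c \<le> f p) \<or> (\<forall>p\<in>unit_square. f p \<le> - c)"
proof (rule ccontr)
  assume "\<not> ?thesis"
  then obtain p q where pq: "p \<in> unit_square" "q \<in> unit_square" "f p < c" "- c < f q" by (auto simp: not_le)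
  then have "f p \<le> 0" "0 \<le> f q" using assms(2)[of p] assms(2)[of q] by auto
  moreover have "connected (f ` unit_square)"
    by (rule connected_continuous_image[OF assms(1) connected_unit_square])
  ultimately have "0 \<in> f ` unit_square"
    using pq connectedD_interval[of "f ` unit_square" "f p" "f q" 0] by blast
  then show False using assms(2,3) by force
qed

lemma constant_sign_on_interval:
  fixes h :: "real \<Rightarrow> real"
  assumes "continuous_on {c<..<d} h" "\<And>y. y \<in> {c<..<d} \<Longrightarrow> h y \<noteq> 0"
  shows "(\<forall>y\<in>{c<..<d}. 0 < h y) \<or> (\<forall>y\<in>{c<..<d}. h y < 0)"
proof (rule ccontr)
  assume "\<not> ?thesis"
  then obtain y z where yz: "y \<in> {c<..<d}" "z \<in> {c<..<d}" "h y \<le> 0" "0 \<le> h z" by (auto simp: not_less)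
  have "connected (h ` {c<..<d})" by (rule connected_continuous_image[OF assms(1)]) simp
  then have "0 \<in> h ` {c<..<d}"
    using yz connectedD_interval[of "h ` {c<..<d}" "h y" "h z" 0] by blast
  then show False using assms(2) by force
qed

lemma slice_integrable:
  fixes G :: "real \<times> real \<Rightarrow> real"
  assumes "continuous_on unit_square G" "0 \<le> x1" "x2 \<le> 1" "y \<in> {0..1}"
  shows "(\<lambda>u. G (u, y)) integrable_on {x1..x2}"
  using assms(2,3)
  by (intro integrable_continuous_interval continuous_on_subset[OF continuous_on_square_slices(2)[OF assms(1,4)]]) auto

lemma slice_integral_lower_bound:
  fixes G :: "real \<times> real \<Rightarrow> real"
  assumes G: "continuous_on unit_square G" "\<And>p. p \<in> unit_square \<Longrightarrow> c \<le> \<bar>G p\<bar>" "0 < c"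
    and x: "0 \<le> x1" "x1 \<le> x2" "x2 \<le> 1" and y: "y \<in> {0..1}"
  shows "c * (x2 - x1) \<le> \<bar>integral {x1..x2} (\<lambda>u. G (u, y))\<bar>"
  using square_constant_sign[OF G]
proof
  note int = slice_integrable[OF G(1) x(1,3) y]
  have inQ: "(u, y) \<in> unit_square" if "u \<in> {x1..x2}" for u using that x y by (auto simp: unit_square_def)
  {
    assume *: "\<forall>p\<in>unit_square. c \<le> G p"
    have "integral {x1..x2} (\<lambda>u. c) \<le> integral {x1..x2} (\<lambda>u. G (u, y))"
      by (rule integral_le[OF integrable_const_ivl int]) (use * inQ in auto)
    then show ?thesis using x by (simp add: mult.commute)
  next
    assume *: "\<forall>p\<in>unit_square. G p \<le> - c"
    have "integral {x1..x2} (\<lambda>u. G (u, y)) \<le> integral {x1..x2} (\<lambda>u. - c)"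
      by (rule integral_le[OF int integrable_const_ivl]) (use * inQ in auto)
    then show ?thesis using x by (simp add: mult.commute)
  }
qed

text \<open>
  Differentiation under the integral sign. Since the phase difference is expressed through
  integrals of \<open>F\<close>, this replaces the commutation of partial derivatives.
\<close>

lemma slice_integral_derivative:
  fixes G :: "real \<times> real \<Rightarrow> real"
  assumes G: "smooth_on unit_square G" and x: "0 \<le> x1" "x1 \<le> x2" "x2 \<le> 1" and y: "y \<in> {0..1}"
  shows "((\<lambda>y. integral {x1..x2} (\<lambda>u. G (u, y))) has_real_derivative
          integral {x1..x2} (\<lambda>u. partial_y unit_square G (u, y))) (at y within {0..1})"
proof -
  have "((\<lambda>y. integral (cbox x1 x2) (\<lambda>u. G (u, y))) has_vector_derivative
          integral (cbox x1 x2) (\<lambda>u. partial_y unit_square G (u, y))) (at y within {0..1})"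
  proof (rule leibniz_rule_vector_derivative)
    fix t u :: real assume "t \<in> {0..1}" "u \<in> cbox x1 x2"
    then show "((\<lambda>t. G (u, t)) has_vector_derivative partial_y unit_square G (u, t)) (at t within {0..1})"
      using x by (intro partial_derivatives_square[OF G]) auto
  next
    fix t :: real assume t: "t \<in> {0..1}"
    have "continuous_on {0..1} (\<lambda>u. G (u, t))"
      by (rule continuous_on_square_slices[OF smooth_on_imp_continuous_on[OF G] t])
    then show "(\<lambda>u. G (u, t)) integrable_on cbox x1 x2"
      by (intro integrable_continuous) (auto intro: continuous_on_subset simp: x intro!: order_trans[OF x(1)] order_trans[OF _ x(3)])
  next
    show "continuous_on ({0..1} \<times> cbox x1 x2) (\<lambda>(t, u). partial_y unit_square G (u, t))"
      unfolding case_prod_unfold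
      by (rule continuous_on_compose2[OF smooth_on_imp_continuous_on[OF smooth_on_partial_y[OF G]]])
         (use x in \<open>auto intro!: continuous_intros simp: unit_square_def\<close>)
  qed (use y in auto)
  then show ?thesis by (simp add: has_real_derivative_iff_has_vector_derivative)
qed

text \<open>
  By the fundamental theorem of calculus in \<open>x\<close>, the \<open>y\<close>-derivative of the phase
  difference is the integral of the mixed derivative over the segment between the two
  points.
\<close>

lemma phase_difference_derivative:
  assumes S: "smooth_on unit_square S" and x: "0 \<le> x1" "x1 \<le> x2" "x2 \<le> 1" and y: "y \<in> {0..1}"
  shows "((\<lambda>y. S (x2, y) - S (x1, y)) has_real_derivative
          integral {x1..x2} (\<lambda>u. partial_x unit_square (partial_y unit_square S) (u, y))) (at y within {0..1})"
proof -
  let ?Sy = "partial_y unit_square S"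
  have "((\<lambda>u. partial_x unit_square ?Sy (u, y)) has_integral (?Sy (x2, y) - ?Sy (x1, y))) {x1..x2}"
  proof (rule fundamental_theorem_of_calculus[OF x(2)])
    fix u assume "u \<in> {x1..x2}"
    then show "((\<lambda>u. ?Sy (u, y)) has_vector_derivative partial_x unit_square ?Sy (u, y)) (at u within {x1..x2})"
      using x y by (intro has_vector_derivative_within_subset[OF partial_derivatives_square(1)[OF smooth_on_partial_y[OF S]]]) auto
  qed
  then have eq: "integral {x1..x2} (\<lambda>u. partial_x unit_square ?Sy (u, y)) = ?Sy (x2, y) - ?Sy (x1, y)"
    by (rule integral_unique)
  show ?thesis
    unfolding eq has_real_derivative_iff_has_vector_derivative
    using x y by (intro has_vector_derivative_diff partial_derivatives_square[OF S]) auto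
qed

lemma plane_eq_lborel: "plane = lborel" by (rule lborel_prod)

lemma measurable_on_square:
  fixes f :: "real \<times> real \<Rightarrow> 'a::{real_normed_vector, second_countable_topology}"
  assumes "continuous_on unit_square f" "\<And>p. p \<notin> unit_square \<Longrightarrow> f p = 0"
  shows "f \<in> borel_measurable borel"
proof -
  have "(\<lambda>p. indicator unit_square p *\<^sub>R f p) \<in> borel_measurable borel"
    by (rule borel_measurable_continuous_on_indicator[OF unit_square_borel assms(1)])
  also have "(\<lambda>p. indicator unit_square p *\<^sub>R f p) = f"
    using assms(2) by (auto simp: fun_eq_iff split: split_indicator)
  finally show ?thesis .
qed

lemma sublevel_borel:
  fixes F :: "real \<times> real \<Rightarrow> real"
  assumes "continuous_on unit_square F"
  shows "{p \<in> unit_square. F p \<le> t} \<in> sets borel"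
  using continuous_on_closed_Collect_le[OF assms continuous_on_const compact_imp_closed[OF compact_unit_square]]
  by (rule borel_closed)

lemma square_kernel_restrict:
  assumes k: "square_kernel M k" and E: "E \<in> sets borel"
  shows "square_kernel M (\<lambda>p. indicator E p * k p)"
proof -
  note [measurable] = E
  have [measurable]: "k \<in> borel_measurable borel" using k by (simp add: square_kernel_def plane_eq_lborel)
  have "(\<lambda>p. indicator E p * k p) \<in> borel_measurable borel" by measurable
  moreover have "norm (indicator E p * k p) \<le> M" for p
  proof -
    have "norm (k p) \<le> M" using k unfolding square_kernel_def by blast
    then show ?thesis using order_trans[OF norm_ge_zero, of "k p" M] by (simp add: norm_mult split: split_indicator)
  qed
  ultimately show ?thesis using k by (auto simp: square_kernel_def plane_eq_lborel)
qed

lemma iterated_kernel_eq_integral: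
  assumes k: "square_kernel M k"
  shows "(\<lambda>y. k (x, y) * cnj (k (x', y))) integrable_on {0..1}"
    and "iterated_kernel k (x, x') = integral {0..1} (\<lambda>y. k (x, y) * cnj (k (x', y)))"
proof -
  have eq: "indicator {0..1} y *\<^sub>R (k (x, y) * cnj (k (x', y))) = k (x, y) * cnj (k (x', y))" for y
    using square_kernelD(3)[OF k, of "(x, y)"] by (auto simp: unit_square_def split: split_indicator)
  have s: "set_integrable lborel {0..1} (\<lambda>y. k (x, y) * cnj (k (x', y)))"
    unfolding set_integrable_def eq by (rule square_kernel_product_integrable[OF k])
  show "(\<lambda>y. k (x, y) * cnj (k (x', y))) integrable_on {0..1}"
    by (rule set_borel_integral_eq_integral(1)[OF s])
  show "iterated_kernel k (x, x') = integral {0..1} (\<lambda>y. k (x, y) * cnj (k (x', y)))"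
    using set_borel_integral_eq_integral(2)[OF s] unfolding set_lebesgue_integral_def eq iterated_kernel_def by simp
qed

lemma iterated_kernel_sym: "iterated_kernel k (x, x') = cnj (iterated_kernel k (x', x))"
  unfolding iterated_kernel_def by (simp add: mult.commute flip: Bochner_Integration.integral_cnj)

lemma norm_iterated_kernel_sym: "norm (iterated_kernel k (x, x')) = norm (iterated_kernel k (x', x))"
  unfolding iterated_kernel_sym[of k x x'] by (rule complex_mod_cnj)

lemma has_vector_derivative_times_cnj:
  assumes "(f has_vector_derivative f') (at y within s)" "(g has_vector_derivative g') (at y within s)"
  shows "((\<lambda>y. f y * cnj (g y)) has_vector_derivative (f y * cnj g' + f' * cnj (g y))) (at y within s)"
  using has_vector_derivative_mult[OF assms(1) bounded_linear.has_vector_derivative[OF bounded_linear_cnj assms(2)]]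
  by simp

lemma integral_indicator_le:
  fixes f :: "real \<Rightarrow> complex"
  assumes f: "integrable lborel f" and E: "E \<in> sets lborel" "E \<subseteq> {0..1}"
    and le: "\<And>y. y \<in> E \<Longrightarrow> norm (f y) \<le> B" "\<And>y. y \<notin> E \<Longrightarrow> f y = 0" and B: "0 \<le> B"
  shows "(LINT y|lborel. norm (f y)) \<le> B * measure lborel E"
proof -
  have "emeasure lborel E \<le> emeasure lborel {0..1::real}" using E by (intro emeasure_mono) auto
  also have "\<dots> < \<infinity>" by simp
  finally have fin: "emeasure lborel E < \<infinity>" .
  then have i: "integrable lborel (\<lambda>y. B * indicator E y :: real)"
    using E by (intro integrable_mult_right integrable_real_indicator) auto
  have "(LINT y|lborel. norm (f y)) \<le> (LINT y|lborel. B * indicator E y)"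
    by (rule integral_mono[OF integrable_norm[OF f] i]) (use le in \<open>auto split: split_indicator\<close>)
  also have "\<dots> = B * measure lborel E" using E by simp
  finally show ?thesis .
qed

section \<open>The oscillatory kernel\<close>

definition osc_kernel :: "(real \<times> real \<Rightarrow> real) \<Rightarrow> (real \<times> real \<Rightarrow> complex) \<Rightarrow> real \<Rightarrow> real \<times> real \<Rightarrow> complex"
  where "osc_kernel S chi l p = exp (\<i> * complex_of_real (l * S p)) * chi p"

lemma square_kernel_osc:
  assumes S: "continuous_on unit_square S" and chi: "continuous_on unit_square chi"
    and z: "\<And>p. p \<notin> unit_square \<Longrightarrow> chi p = 0" and M: "\<And>p. p \<in> unit_square \<Longrightarrow> norm (chi p) \<le> M"
  shows "square_kernel M (osc_kernel S chi l)"
proof -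
  have M0: "0 \<le> M" using order_trans[OF norm_ge_zero M[of "(0,0)"]] by (auto simp: unit_square_def)
  have "osc_kernel S chi l \<in> borel_measurable borel"
    by (rule measurable_on_square)
       (auto simp: osc_kernel_def z intro!: continuous_intros S chi)
  moreover have "norm (osc_kernel S chi l p) \<le> M" for p
    using M[of p] z[of p] M0 by (cases "p \<in> unit_square") (auto simp: osc_kernel_def norm_mult)
  ultimately show ?thesis using z unfolding square_kernel_def plane_eq_lborel by (auto simp: osc_kernel_def)
qed

lemma osc_kernel_times_cnj:
  "osc_kernel S chi l p * cnj (osc_kernel S chi l q)
   = exp (\<i> * complex_of_real (l * (S p - S q))) * (chi p * cnj (chi q))"
proof -
  have "exp (\<i> * complex_of_real (l * (S p - S q))) = exp (\<i> * complex_of_real (l * S p)) * cnj (exp (\<i> * complex_of_real (l * S q)))"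
    by (simp add: exp_cnj right_diff_distrib flip: exp_add)
  then show ?thesis by (simp add: osc_kernel_def)
qed

lemma L2_operator_bound:
  assumes k: "square_kernel M (osc_kernel S chi l)" and B: "bilinear_bound (osc_kernel S chi l) A" and A: "0 \<le> A"
  shows "L2_bounded_linear (osc_op S chi l) \<and> L2_onorm (osc_op S chi l) \<le> A"
proof -
  have T: "osc_op S chi l f = (\<lambda>x. LINT y|lborel. osc_kernel S chi l (x, y) * f y)" for f
    by (simp add: osc_op_def osc_kernel_def)
  note int = square_kernel_L2_integrable(2)[OF k]
  have le: "L2_norm (osc_op S chi l f) \<le> A * L2_norm f" if "f \<in> L2_space" for f
    unfolding T by (rule kernel_op_norm_le[OF k that A]) (use B that in \<open>auto simp: bilinear_bound_def\<close>)
  have "osc_op S chi l f \<in> L2_space" if "f \<in> L2_space" for f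
    unfolding T by (rule kernel_op_L2[OF k that])
  moreover have "osc_op S chi l (\<lambda>y. f y + g y) x = osc_op S chi l f x + osc_op S chi l g x"
    if "f \<in> L2_space" "g \<in> L2_space" for f g x
    unfolding T using int[OF that(1)] int[OF that(2)] by (simp add: distrib_left)
  moreover have "osc_op S chi l (\<lambda>y. z * f y) x = z * osc_op S chi l f x" for z f x
  proof -
    have "osc_op S chi l (\<lambda>y. z * f y) x = (LINT y|lborel. z * (osc_kernel S chi l (x, y) * f y))"
      unfolding T by (intro Bochner_Integration.integral_cong refl) (simp add: mult_ac)
    then show ?thesis unfolding T by (simp only: integral_mult_right_zero)
  qed
  ultimately have 1: "L2_bounded_linear (osc_op S chi l)"
    unfolding L2_bounded_linear_def using le by (intro conjI exI[of _ A]) auto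
  have "(\<lambda>x. 0) \<in> L2_space" by (simp add: L2_space_def)
  then have 2: "L2_onorm (osc_op S chi l) \<le> A"
    unfolding L2_onorm_def
  proof (intro cSUP_least)
    fix f assume f: "f \<in> L2_space"
    show "L2_norm (osc_op S chi l f) / L2_norm f \<le> A"
    proof (cases "L2_norm f = 0")
      case False
      then have "0 < L2_norm f" using L2_norm_nonneg[of f] by linarith
      then show ?thesis using le[OF f] by (simp add: divide_le_eq)
    qed (use A in simp)
  qed auto
  from 1 2 show ?thesis by blast
qed

locale osc_data =
  fixes S F :: "real \<times> real \<Rightarrow> real" and chi :: "real \<times> real \<Rightarrow> complex" and M :: real
  assumes S_smooth: "smooth_on unit_square S"
    and F_eq: "F = partial_x unit_square (partial_y unit_square S)"
    and chi_smooth: "smooth_on UNIV chi"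
    and chi_support: "closure {p. chi p \<noteq> 0} \<subseteq> unit_square"
    and M_ge_1: "1 \<le> M"
    and chi_le: "\<And>p. p \<in> unit_square \<Longrightarrow> norm (chi p) \<le> M"
    and chi_y_le: "\<And>p. p \<in> unit_square \<Longrightarrow> norm (partial_y UNIV chi p) \<le> M"
begin

lemma F_smooth: "smooth_on unit_square F"
  unfolding F_eq by (intro smooth_on_partial_x smooth_on_partial_y S_smooth)

lemma F_continuous: "continuous_on unit_square F"
  by (rule smooth_on_imp_continuous_on[OF F_smooth])

lemma chi_zero: "p \<notin> unit_square \<Longrightarrow> chi p = 0"
  using chi_support closure_subset[of "{p. chi p \<noteq> 0}"] by auto

lemma chi_continuous: "continuous_on A chi"
  using smooth_on_imp_continuous_on[OF chi_smooth] continuous_on_subset by blast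

lemma osc_kernel_is_square_kernel: "square_kernel M (osc_kernel S chi l)"
  by (rule square_kernel_osc[OF smooth_on_imp_continuous_on[OF S_smooth] chi_continuous chi_zero chi_le])

lemma chi_deriv: "((\<lambda>t. chi (x, t)) has_vector_derivative partial_y UNIV chi (x, y)) (at y within s)"
  using partial_derivatives(2)[OF chi_smooth, of x y] by (auto intro: has_vector_derivative_at_within)

lemma F_slice_deriv:
  assumes "x \<in> {0..1}" "y \<in> {0..1}"
  shows "((\<lambda>t. ((partial_y unit_square ^^ k) F) (x, t)) has_real_derivative
     ((partial_y unit_square ^^ Suc k) F) (x, y)) (at y within {0..1})"
  using partial_derivatives_square(2)[OF smooth_on_partial_y_funpow[OF F_smooth] assms, of k]
  by (simp add: has_real_derivative_iff_has_vector_derivative)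

lemma F_slice_deriv_x:
  assumes "x \<in> {0..1}" "y \<in> {0..1}"
  shows "((\<lambda>t. ((partial_x unit_square ^^ k) F) (t, y)) has_real_derivative
     ((partial_x unit_square ^^ Suc k) F) (x, y)) (at x within {0..1})"
  using partial_derivatives_square(1)[OF smooth_on_partial_x_funpow[OF F_smooth] assms, of k]
  by (simp add: has_real_derivative_iff_has_vector_derivative)

end

section \<open>Shells of a degenerate phase\<close>

lemma has_integral_abs_powr:
  fixes x \<epsilon> :: real
  assumes "0 < \<epsilon>"
  shows "((\<lambda>t. \<bar>t - x\<bar> powr (-3/4)) has_integral 8 * \<epsilon> powr (1/4)) {x - \<epsilon>..x + \<epsilon>}"
proof -
  have 1: "((\<lambda>t. \<bar>t - x\<bar> powr (-3/4)) has_integral 4 * (x + \<epsilon> - x) powr (1/4) - 4 * (x - x) powr (1/4)) {x..x + \<epsilon>}"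
  proof (rule fundamental_theorem_of_calculus_interior)
    show "continuous_on {x..x + \<epsilon>} (\<lambda>t. 4 * (t - x) powr (1/4))"
      by (intro continuous_intros continuous_on_powr') auto
  next
    fix t assume t: "t \<in> {x<..<x + \<epsilon>}"
    then have "((\<lambda>t. 4 * (t - x) powr (1/4)) has_real_derivative (t - x) powr (-3/4)) (at t)"
      by (auto intro!: derivative_eq_intros)
    then show "((\<lambda>t. 4 * (t - x) powr (1/4)) has_vector_derivative \<bar>t - x\<bar> powr (-3/4)) (at t)"
      using t by (simp add: has_real_derivative_iff_has_vector_derivative)
  qed (use assms in auto)
  have 2: "((\<lambda>t. \<bar>t - x\<bar> powr (-3/4)) has_integral (- 4 * (x - x) powr (1/4)) - (- 4 * (x - (x - \<epsilon>)) powr (1/4))) {x - \<epsilon>..x}"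
  proof (rule fundamental_theorem_of_calculus_interior)
    show "continuous_on {x - \<epsilon>..x} (\<lambda>t. - 4 * (x - t) powr (1/4))"
      by (intro continuous_intros continuous_on_powr') auto
  next
    fix t assume t: "t \<in> {x - \<epsilon><..<x}"
    then have "((\<lambda>t. - 4 * (x - t) powr (1/4)) has_real_derivative (x - t) powr (-3/4)) (at t)"
      by (auto intro!: derivative_eq_intros)
    then show "((\<lambda>t. - 4 * (x - t) powr (1/4)) has_vector_derivative \<bar>t - x\<bar> powr (-3/4)) (at t)"
      using t by (simp add: has_real_derivative_iff_has_vector_derivative)
  qed (use assms in auto)
  have "((\<lambda>t. \<bar>t - x\<bar> powr (-3/4)) has_integral
      ((- 4 * (x - x) powr (1/4)) - (- 4 * (x - (x - \<epsilon>)) powr (1/4))) +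
      (4 * (x + \<epsilon> - x) powr (1/4) - 4 * (x - x) powr (1/4))) {x - \<epsilon>..x + \<epsilon>}"
    by (rule has_integral_combine[OF _ _ 2 1]) (use assms in auto)
  then show ?thesis by simp
qed

lemma integral_le_powr_singularity:
  fixes f :: "real \<Rightarrow> real"
  assumes f: "integrable lborel f" and e: "0 < \<epsilon>"
    and off: "\<And>t. \<epsilon> < \<bar>t - x\<bar> \<Longrightarrow> f t = 0"
    and near: "\<And>t. \<bar>t - x\<bar> \<le> \<epsilon> \<Longrightarrow> t \<noteq> x \<Longrightarrow> f t \<le> B * \<bar>t - x\<bar> powr (-3/4)"
  shows "(LINT t|lborel. f t) \<le> 8 * B * \<epsilon> powr (1/4)"
proof -
  have "(f has_integral (LINT t|lborel. f t)) UNIV" by (rule has_integral_integral_lborel[OF f])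
  moreover have "(\<lambda>t. if t \<in> {x - \<epsilon>..x + \<epsilon>} then f t else 0) = f"
    using off by (auto simp: fun_eq_iff)
  ultimately have "(f has_integral (LINT t|lborel. f t)) {x - \<epsilon>..x + \<epsilon>}"
    using has_integral_restrict_UNIV[of "{x - \<epsilon>..x + \<epsilon>}" f] by simp
  then have f': "((\<lambda>t. if t = x then 0 else f t) has_integral (LINT t|lborel. f t)) {x - \<epsilon>..x + \<epsilon>}"
    by (rule has_integral_spike_finite[of "{x}", rotated 2]) auto
  have "(LINT t|lborel. f t) \<le> B * (8 * \<epsilon> powr (1/4))"
    by (rule has_integral_le[OF f' has_integral_mult_right[OF has_integral_abs_powr[OF e]]])
       (use near in auto)
  then show ?thesis by simp
qed

text \<open>
  The weights \<open>1/4\<close> and \<open>3/4\<close> turn the decay \<open>1/r\<close> into the integrable \<open>r\<^bsup>-3/4\<^esup>\<close>. Any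
  weight below \<open>1/3\<close> on the size bound would make the sum over the shells converge.
\<close>

lemma le_geometric_mean:
  fixes z u v :: real
  assumes "0 \<le> z" "z \<le> u" "z \<le> v"
  shows "z \<le> u powr (1/4) * v powr (3/4)"
proof (cases "z = 0")
  case False
  have "z = z powr (1/4) * z powr (3/4)" using assms False by (simp flip: powr_add)
  also have "\<dots> \<le> u powr (1/4) * v powr (3/4)" using assms by (intro mult_mono powr_mono2) auto
  finally show ?thesis .
qed auto

lemma shell_powr_identity:
  fixes l \<delta> p q :: real
  assumes "0 < l" "0 < \<delta>"
  shows "(\<delta> powr q) powr (1/4) * (1 / (l * \<delta>)) powr (3/4) * (\<delta> powr p) powr (1/4)
       = 1 / (l * \<delta>) * (l * \<delta> powr (1 + p + q)) powr (1/4)"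
proof -
  define u v where "u = ln l" and "v = ln \<delta>"
  then have uv: "l = exp u" "\<delta> = exp v" using assms by simp_all
  have P: "exp t powr x = exp (x * t)" for t x :: real by (simp add: powr_def)
  have I: "1 / exp (u + v) = exp (- (u + v))" unfolding exp_minus inverse_eq_divide ..
  show ?thesis
    unfolding uv exp_add[symmetric] I P
    by (rule arg_cong[of _ _ exp]) (simp add: algebra_simps add_divide_distrib diff_divide_distrib)
qed

text \<open>
  The assumption \<open>no_dip\<close> is what the order \<open>a\<close> of degeneracy in \<open>x\<close> has to provide
  besides \<open>Fa\<close>: within the distance \<open>\<kappa> \<delta>\<^bsup>1/a\<^esup>\<close> the function \<open>s F\<close> cannot fall from above
  \<open>\<delta>\<close> to below \<open>\<delta>/2\<close> and return. The number \<open>s\<close> is the sign of \<open>F\<close> on the shell.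
\<close>

locale degenerate_phase = osc_data +
  fixes a b :: nat and c \<kappa> :: real
  assumes ab: "0 < a" "0 < b" and c: "0 < c" and \<kappa>: "0 < \<kappa>"
    and Fa: "\<And>p. p \<in> unit_square \<Longrightarrow> c \<le> \<bar>((partial_x unit_square ^^ a) F) p\<bar>"
    and Fb: "\<And>p. p \<in> unit_square \<Longrightarrow> c \<le> \<bar>((partial_y unit_square ^^ b) F) p\<bar>"
    and no_dip: "\<And>s \<delta> x1 x2 u y. \<lbrakk>s \<in> {1, -1}; 0 < \<delta>; 0 \<le> x1; x1 \<le> u; u \<le> x2; x2 \<le> 1; y \<in> {0..1};
        x2 - x1 \<le> \<kappa> * \<delta> powr (1 / a); \<delta> < s * F (x1, y); \<delta> < s * F (x2, y)\<rbrakk> \<Longrightarrow> \<delta> / 2 \<le> s * F (u, y)"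
begin

definition shell :: "real \<Rightarrow> real \<Rightarrow> (real \<times> real) set"
  where "shell s \<delta> = {p \<in> unit_square. \<delta> < s * F p \<and> s * F p \<le> 2 * \<delta>}"

definition shell_kernel :: "real \<Rightarrow> real \<Rightarrow> real \<Rightarrow> real \<times> real \<Rightarrow> complex"
  where "shell_kernel l s \<delta> p = indicator (shell s \<delta>) p * osc_kernel S chi l p"

lemma shell_borel: "shell s \<delta> \<in> sets borel"
proof -
  have "continuous_on unit_square (\<lambda>p. s * F p)" by (intro continuous_intros F_continuous)
  then have "{p \<in> unit_square. s * F p \<le> 2 * \<delta>} - {p \<in> unit_square. s * F p \<le> \<delta>} \<in> sets borel"
    by (intro sets.Diff sublevel_borel)
  also have "{p \<in> unit_square. s * F p \<le> 2 * \<delta>} - {p \<in> unit_square. s * F p \<le> \<delta>} = shell s \<delta>"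
    by (auto simp: shell_def)
  finally show ?thesis .
qed

lemma shell_kernel: "square_kernel M (shell_kernel l s \<delta>)"
  unfolding shell_kernel_def by (rule square_kernel_restrict[OF osc_kernel_is_square_kernel shell_borel])

lemma F_y_level:
  assumes "x \<in> {0..1}"
  shows "finite {y\<in>{0..1}. F (x, y) - t = 0} \<and> card {y\<in>{0..1}. F (x, y) - t = 0} \<le> b"
proof -
  define D where "D k = (\<lambda>y. ((partial_y unit_square ^^ k) F) (x, y) - (if k = 0 then t else 0))" for k
  have "finite {y\<in>{0..1}. D 0 y = 0} \<and> card {y\<in>{0..1}. D 0 y = 0} \<le> b"
  proof (rule card_zeros_le)
    fix k and y :: real assume "y \<in> {0..1}"
    then have "((\<lambda>y. ((partial_y unit_square ^^ k) F) (x, y) - (if k = 0 then t else 0)) has_real_derivative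
      ((partial_y unit_square ^^ Suc k) F) (x, y) - 0) (at y within {0..1})"
      by (intro DERIV_diff F_slice_deriv[OF assms] DERIV_const)
    then show "(D k has_real_derivative D (Suc k) y) (at y within {0..1})" unfolding D_def by simp
  next
    fix y :: real assume "y \<in> {0..1}"
    then have "(x, y) \<in> unit_square" using assms by (auto simp: unit_square_def)
    then show "D b y \<noteq> 0" using Fb[of "(x, y)"] c ab by (auto simp: D_def)
  qed
  then show ?thesis by (simp add: D_def)
qed

definition x_measure_const where "x_measure_const = (2 * real a + 1) * (4 ^ (a * a) / c) powr (1 / a)"

definition y_measure_const where "y_measure_const = (2 * real b + 1) * (4 ^ (b * b) / c) powr (1 / b)"

lemma measure_F_y_le:
  assumes x: "x \<in> {0..1}" and \<delta>: "0 < \<delta>"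
  shows "measure lborel {y\<in>{0..1}. \<bar>F (x, y)\<bar> \<le> \<delta>} \<le> (2 * real b + 1) * (4 ^ (b * b) / c) powr (1 / b) * \<delta> powr (1 / b)"
proof -
  have "measure lborel {y\<in>{0..1}. \<bar>((partial_y unit_square ^^ 0) F) (x, y)\<bar> \<le> \<delta>}
     \<le> (2 * real b + 1) * (4 ^ (b * b) * \<delta> / c) powr (1 / b)"
    by (rule measure_sublevel_le[where D = "\<lambda>k y. ((partial_y unit_square ^^ k) F) (x, y)"])
       (use x \<delta> ab c in \<open>auto intro!: F_slice_deriv[simplified] Fb simp: mem_square\<close>)
  also have "(4 ^ (b * b) * \<delta> / c) powr (1 / b) = (4 ^ (b * b) / c) powr (1 / b) * \<delta> powr (1 / b)"
    using \<delta> c by (subst powr_mult[symmetric]) (auto simp: mult_ac)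
  finally show ?thesis by (simp add: mult.assoc)
qed

lemma measure_F_x_le:
  assumes y: "y \<in> {0..1}" and \<delta>: "0 < \<delta>"
  shows "measure lborel {x\<in>{0..1}. \<bar>F (x, y)\<bar> \<le> \<delta>} \<le> (2 * real a + 1) * (4 ^ (a * a) / c) powr (1 / a) * \<delta> powr (1 / a)"
proof -
  have "measure lborel {x\<in>{0..1}. \<bar>((partial_x unit_square ^^ 0) F) (x, y)\<bar> \<le> \<delta>}
     \<le> (2 * real a + 1) * (4 ^ (a * a) * \<delta> / c) powr (1 / a)"
    by (rule measure_sublevel_le[where D = "\<lambda>k x. ((partial_x unit_square ^^ k) F) (x, y)"])
       (use y \<delta> ab c in \<open>auto intro!: F_slice_deriv_x[simplified] Fa simp: mem_square\<close>)
  also have "(4 ^ (a * a) * \<delta> / c) powr (1 / a) = (4 ^ (a * a) / c) powr (1 / a) * \<delta> powr (1 / a)"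
    using \<delta> c by (subst powr_mult[symmetric]) (auto simp: mult_ac)
  finally show ?thesis by (simp add: mult.assoc)
qed

lemma card_cells_le:
  assumes y: "y \<in> {0..1}" and \<delta>: "0 < \<delta>"
  shows "real (card ((\<lambda>x. \<lfloor>x / (\<kappa> * \<delta> powr (1 / a))\<rfloor>) ` {x\<in>{0..1}. \<bar>F (x, y)\<bar> \<le> 2 * \<delta>}))
     \<le> (2 * real a + 1) * ((4 ^ (a * a) * 2 / c) powr (1 / a) / \<kappa> + 2)"
proof -
  have "real (card ((\<lambda>x. \<lfloor>x / (\<kappa> * \<delta> powr (1 / a))\<rfloor>) ` {x\<in>{0..1}. \<bar>((partial_x unit_square ^^ 0) F) (x, y)\<bar> \<le> 2 * \<delta>}))
     \<le> (2 * real a + 1) * ((4 ^ (a * a) * (2 * \<delta>) / c) powr (1 / a) / (\<kappa> * \<delta> powr (1 / a)) + 2)"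
    by (rule card_cells_sublevel_le[where D = "\<lambda>k x. ((partial_x unit_square ^^ k) F) (x, y)"])
       (use y \<delta> ab c \<kappa> in \<open>auto intro!: F_slice_deriv_x[simplified] Fa simp: mem_square\<close>)
  also have "(4 ^ (a * a) * (2 * \<delta>) / c) powr (1 / a) = (4 ^ (a * a) * 2 / c) powr (1 / a) * \<delta> powr (1 / a)"
    using \<delta> c by (subst powr_mult[symmetric]) (auto simp: mult_ac)
  finally show ?thesis using \<delta> by simp
qed

text \<open>
  The number of turning points of the phase derivative \<open>\<phi>\<close>: the derivative of \<open>\<phi>\<close> of order
  \<open>b\<close> is the integral of \<open>\<partial>\<^sub>y\<^sup>b F\<close>, which has constant sign.
\<close>

lemma slice_integral_zeros:
  assumes x: "0 \<le> x1" "x1 < x2" "x2 \<le> 1"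
  defines "Z \<equiv> {y\<in>{0..1}. integral {x1..x2} (\<lambda>u. partial_y unit_square F (u, y)) = 0}"
  shows "finite Z \<and> card Z \<le> b - 1"
proof -
  define D where "D k = (\<lambda>y. integral {x1..x2} (\<lambda>u. ((partial_y unit_square ^^ Suc k) F) (u, y)))" for k
  have "finite {y\<in>{0..1}. D 0 y = 0} \<and> card {y\<in>{0..1}. D 0 y = 0} \<le> b - 1"
  proof (rule card_zeros_le)
    fix k and y :: real assume "y \<in> {0..1}"
    then show "(D k has_real_derivative D (Suc k) y) (at y within {0..1})"
      unfolding D_def using x slice_integral_derivative[OF smooth_on_partial_y_funpow[OF F_smooth, of "Suc k"], of x1 x2 y] by simp
  next
    fix y :: real assume y: "y \<in> {0..1}"
    let ?G = "(partial_y unit_square ^^ b) F"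
    have Db: "D (b - 1) y = integral {x1..x2} (\<lambda>u. ?G (u, y))" using ab by (simp add: D_def)
    have G: "continuous_on unit_square ?G"
      by (intro smooth_on_imp_continuous_on smooth_on_partial_y_funpow F_smooth)
    have "c * (x2 - x1) \<le> \<bar>D (b - 1) y\<bar>"
      unfolding Db using x by (intro slice_integral_lower_bound[OF G Fb c] y) auto
    moreover have "0 < c * (x2 - x1)" using x c by simp
    ultimately show "D (b - 1) y \<noteq> 0" by auto
  qed
  then show ?thesis by (simp add: D_def Z_def)
qed

text \<open>
  The zeros collected in \<open>P\<close> (at most \<open>4 b\<close> for the levels \<open>\<delta>\<close> and \<open>2 \<delta>\<close> at \<open>x\<^sub>1\<close> and
  \<open>x\<^sub>2\<close>, at most \<open>b - 1\<close> for \<open>\<phi>'\<close>) cut the \<open>y\<close>-interval into at most \<open>5 b\<close> pieces. On each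
  of them the integrand is zero, or both points stay in the shell and van der Corput's
  lemma applies with \<open>\<bar>\<phi>\<bar> \<ge> \<delta>/2 (x\<^sub>2 - x\<^sub>1)\<close>.
\<close>

lemma shell_iterated_kernel_decay:
  assumes s: "s \<in> {1, -1}" and \<delta>: "0 < \<delta>" and l: "0 < l"
    and x: "0 \<le> x1" "x1 < x2" "x2 \<le> 1" and near: "x2 - x1 \<le> \<kappa> * \<delta> powr (1 / a)"
  shows "norm (iterated_kernel (shell_kernel l s \<delta>) (x2, x1)) \<le> 100 * b * M\<^sup>2 / (l * \<delta>) / (x2 - x1)"
proof -
  let ?k = "shell_kernel l s \<delta>"
  let ?H = "\<lambda>y. ?k (x2, y) * cnj (?k (x1, y))"
  let ?r = "x2 - x1"
  let ?\<Phi> = "\<lambda>y. S (x2, y) - S (x1, y)"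
  let ?\<phi> = "\<lambda>y. integral {x1..x2} (\<lambda>u. F (u, y))"
  let ?\<phi>' = "\<lambda>y. integral {x1..x2} (\<lambda>u. partial_y unit_square F (u, y))"
  let ?\<phi>'' = "\<lambda>y. integral {x1..x2} (\<lambda>u. partial_y unit_square (partial_y unit_square F) (u, y))"
  let ?A = "\<lambda>y. chi (x2, y) * cnj (chi (x1, y))"
  let ?A' = "\<lambda>y. chi (x2, y) * cnj (partial_y UNIV chi (x1, y)) + partial_y UNIV chi (x2, y) * cnj (chi (x1, y))"
  let ?e = "\<lambda>y. exp (\<i> * complex_of_real (l * ?\<Phi> y))"
  have x1: "x1 \<in> {0..1}" and x2: "x2 \<in> {0..1}" and r: "0 < ?r" using x by auto
  have d\<Phi>: "(?\<Phi> has_real_derivative ?\<phi> y) (at y within {0..1})" if "y \<in> {0..1}" for y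
    unfolding F_eq using x that by (intro phase_difference_derivative[OF S_smooth]) auto
  have d\<phi>: "(?\<phi> has_real_derivative ?\<phi>' y) (at y within {0..1})" if "y \<in> {0..1}" for y
    using x that by (intro slice_integral_derivative F_smooth) auto
  have d\<phi>': "(?\<phi>' has_real_derivative ?\<phi>'' y) (at y within {0..1})" if "y \<in> {0..1}" for y
    using x that by (intro slice_integral_derivative smooth_on_partial_y F_smooth) auto
  have c\<phi>: "continuous_on {0..1} ?\<phi>" by (rule DERIV_continuous_on[OF d\<phi>])
  have c\<phi>': "continuous_on {0..1} ?\<phi>'" by (rule DERIV_continuous_on[OF d\<phi>'])
  have dA: "(?A has_vector_derivative ?A' y) (at y within t)" for y t
    by (intro has_vector_derivative_times_cnj chi_deriv)
  have cA': "continuous_on t ?A'" for t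
  proof -
    have c1: "continuous_on t (\<lambda>y. g (z, y))" if "continuous_on UNIV g" for g :: "real \<times> real \<Rightarrow> complex" and z
      by (rule continuous_on_compose2[OF that]) (auto intro!: continuous_intros)
    show ?thesis
      by (intro continuous_intros c1 smooth_on_imp_continuous_on smooth_on_partial_y chi_smooth)
  qed
  define P where "P = {y\<in>{0..1}. F (x1, y) - s * \<delta> = 0} \<union> {y\<in>{0..1}. F (x1, y) - s * (2 * \<delta>) = 0}
     \<union> {y\<in>{0..1}. F (x2, y) - s * \<delta> = 0} \<union> {y\<in>{0..1}. F (x2, y) - s * (2 * \<delta>) = 0}
     \<union> {y\<in>{0..1}. ?\<phi>' y = 0}"
  have finP: "finite P" unfolding P_def using F_y_level x1 x2 slice_integral_zeros[OF x] by blast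
  have "card P \<le> b + b + b + b + (b - 1)" unfolding P_def
    by (intro order_trans[OF card_Un_le] add_mono conjunct2[OF F_y_level] conjunct2[OF slice_integral_zeros] x x1 x2)
  then have cardP: "real (card P) + 1 \<le> 5 * b" using ab by linarith
  have Hint: "?H integrable_on {0..1}" by (rule iterated_kernel_eq_integral(1)[OF shell_kernel])
  let ?B = "20 * M\<^sup>2 / (l * \<delta> * ?r)"
  have B0: "0 \<le> ?B" using l \<delta> r by simp
  have "norm (integral {0..1} ?H) \<le> (real (card P) + 1) * ?B"
  proof (rule subadditive_pieces_bound[where \<mu> = "\<lambda>u v. norm (integral {u..v} ?H)", OF finP])
    fix u p v :: real assume "0 \<le> u" "u \<le> p" "p \<le> v" "v \<le> 1"
    then have "integral {u..v} ?H = integral {u..p} ?H + integral {p..v} ?H"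
      by (intro Henstock_Kurzweil_Integration.integral_combine[symmetric] integrable_on_subinterval[OF Hint]) auto
    then show "norm (integral {u..v} ?H) \<le> norm (integral {u..p} ?H) + norm (integral {p..v} ?H)"
      by (simp only: norm_triangle_ineq)
  next
    fix u v :: real assume uv: "0 \<le> u" "u \<le> v" "v \<le> 1" "{u<..<v} \<inter> P = {}"
    have in01: "y \<in> {0..1}" if "y \<in> {u<..<v}" for y using that uv by auto
    have all: "(\<forall>y\<in>{u<..<v}. (z, y) \<in> shell s \<delta>) \<or> (\<forall>y\<in>{u<..<v}. (z, y) \<notin> shell s \<delta>)"
      if z: "z \<in> {x1, x2}" for z
    proof -
      have z01: "z \<in> {0..1}" using z x1 x2 by auto
      have cF: "continuous_on {u<..<v} (\<lambda>y. s * F (z, y) - t)" for t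
        by (intro continuous_intros continuous_on_subset[OF continuous_on_square_slices(1)[OF F_continuous z01]])
           (use uv in auto)
      have ss: "s * s = 1" using s by auto
      have nz: "s * F (z, y) - t \<noteq> 0" if "y \<in> {u<..<v}" "t \<in> {\<delta>, 2 * \<delta>}" for y t
      proof
        assume "s * F (z, y) - t = 0"
        then have "F (z, y) - s * t = 0" using s by auto
        then have "y \<in> P" using that z in01[OF that(1)] unfolding P_def by auto
        then show False using uv(4) that(1) by blast
      qed
      have "(\<forall>y\<in>{u<..<v}. 0 < s * F (z, y) - \<delta>) \<or> (\<forall>y\<in>{u<..<v}. s * F (z, y) - \<delta> < 0)"
        by (rule constant_sign_on_interval[OF cF nz]) auto
      moreover have "(\<forall>y\<in>{u<..<v}. 0 < s * F (z, y) - 2 * \<delta>) \<or> (\<forall>y\<in>{u<..<v}. s * F (z, y) - 2 * \<delta> < 0)"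
        by (rule constant_sign_on_interval[OF cF nz]) auto
      moreover have "(z, y) \<in> unit_square" if "y \<in> {u<..<v}" for y
        using in01[OF that] z01 by (auto simp: unit_square_def)
      ultimately show ?thesis unfolding shell_def by fastforce
    qed
    show "norm (integral {u..v} ?H) \<le> ?B"
    proof (cases "(\<forall>y\<in>{u<..<v}. (x1, y) \<in> shell s \<delta> \<and> (x2, y) \<in> shell s \<delta>) \<and> u < v")
      case False
      have "?H y = 0" if "y \<in> {u<..<v}" for y
        using False all[of x1] all[of x2] that by (auto simp: shell_kernel_def)
      then have "integral {u<..<v} ?H = integral {u<..<v} (\<lambda>y. 0)"
        by (intro integral_cong)
      then have "integral {u..v} ?H = 0" unfolding integral_open_interval_real by simp
      then show ?thesis using B0 by simp
    next
      case True
      then have sh: "(x1, y) \<in> shell s \<delta>" "(x2, y) \<in> shell s \<delta>" if "y \<in> {u<..<v}" for y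
        using that by auto
      have "u < v" using True by auto
      have cl: "closure {u<..<v} = {u..v}" using \<open>u < v\<close> by simp
      have sub: "{u..v} \<subseteq> {0..1}" using uv by auto
      have "?H y = ?e y * ?A y" if "y \<in> {u<..<v}" for y
        using sh[OF that] osc_kernel_times_cnj[of S chi l "(x2, y)" "(x1, y)"] by (simp add: shell_kernel_def)
      then have "integral {u<..<v} ?H = integral {u<..<v} (\<lambda>y. ?e y * ?A y)"
        by (intro integral_cong)
      then have eq: "integral {u..v} ?H = integral {u..v} (\<lambda>y. ?e y * ?A y)"
        unfolding integral_open_interval_real .
      have big: "\<delta> / 2 * ?r \<le> \<bar>?\<phi> y\<bar>" if y: "y \<in> {u..v}" for y
      proof (rule continuous_ge_on_closure[where S = "{u<..<v}" and f = "\<lambda>y. \<bar>?\<phi> y\<bar>"])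
        show "continuous_on (closure {u<..<v}) (\<lambda>y. \<bar>?\<phi> y\<bar>)"
          unfolding cl by (intro continuous_intros continuous_on_subset[OF c\<phi> sub])
        show "y \<in> closure {u<..<v}" using y cl by simp
        fix z assume z: "z \<in> {u<..<v}"
        have Fi: "(\<lambda>w. F (w, z)) integrable_on {x1..x2}" by (rule slice_integrable[OF F_continuous x(1,3) in01[OF z]])
        have "integral {x1..x2} (\<lambda>w. \<delta> / 2) \<le> integral {x1..x2} (\<lambda>w. s * F (w, z))"
        proof (rule integral_le)
          show "(\<lambda>w. s * F (w, z)) integrable_on {x1..x2}" by (intro integrable_on_mult_right Fi)
          fix w assume "w \<in> {x1..x2}"
          then show "\<delta> / 2 \<le> s * F (w, z)"
            using sh[OF z] x near in01[OF z] unfolding shell_def by (intro no_dip[OF s \<delta>]) auto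
        qed (rule integrable_const_ivl)
        then have "\<delta> / 2 * ?r \<le> s * ?\<phi> z" using x by (simp add: mult.commute)
        also have "\<dots> \<le> \<bar>?\<phi> z\<bar>" using s by auto
        finally show "\<delta> / 2 * ?r \<le> \<bar>?\<phi> z\<bar>" .
      qed
      have sign: "(\<forall>y\<in>{u..v}. 0 \<le> ?\<phi>' y) \<or> (\<forall>y\<in>{u..v}. ?\<phi>' y \<le> 0)"
      proof -
        have c1: "continuous_on (closure {u<..<v}) ?\<phi>'"
          unfolding cl by (intro continuous_on_subset[OF c\<phi>' sub])
        have "?\<phi>' y \<noteq> 0" if "y \<in> {u<..<v}" for y
          using in01[OF that] that uv(4) unfolding P_def by auto
        then have "(\<forall>y\<in>{u<..<v}. 0 < ?\<phi>' y) \<or> (\<forall>y\<in>{u<..<v}. ?\<phi>' y < 0)"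
          by (intro constant_sign_on_interval continuous_on_subset[OF c1 closure_subset])
        then show ?thesis
          using continuous_ge_on_closure[OF c1, of _ 0] continuous_le_on_closure[OF c1, of _ 0] unfolding cl
          by (meson less_imp_le)
      qed
      have amp: "norm (?A y) \<le> 2 * M\<^sup>2" "norm (?A' y) \<le> 2 * M\<^sup>2" if y: "y \<in> {u..v}" for y
      proof -
        have q: "(x1, y) \<in> unit_square" "(x2, y) \<in> unit_square" using y uv x1 x2 by (auto simp: unit_square_def)
        have pr: "norm (p * cnj q) \<le> M\<^sup>2" if "norm p \<le> M" "norm q \<le> M" for p q
          using mult_mono'[OF that] by (simp add: norm_mult power2_eq_square)
        show "norm (?A y) \<le> 2 * M\<^sup>2" using pr[OF chi_le chi_le, OF q(2,1)] zero_le_power2[of M] by linarith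
        show "norm (?A' y) \<le> 2 * M\<^sup>2"
          using norm_triangle_mono[OF pr[OF chi_le chi_y_le, OF q(2,1)] pr[OF chi_y_le chi_le, OF q(2,1)]] by simp
      qed
      have "norm (integral {u..v} (\<lambda>y. ?e y * ?A y)) \<le> 5 * (2 * M\<^sup>2) / (l * (\<delta> / 2 * ?r))"
      proof (rule van_der_Corput[where \<phi> = ?\<phi> and \<phi>' = ?\<phi>' and a' = ?A'])
        show "(?\<Phi> has_real_derivative ?\<phi> y) (at y within {u..v})" if "y \<in> {u..v}" for y
          using that sub by (intro DERIV_subset[OF d\<Phi> sub]) auto
        show "(?\<phi> has_real_derivative ?\<phi>' y) (at y within {u..v})" if "y \<in> {u..v}" for y
          using that sub by (intro DERIV_subset[OF d\<phi> sub]) auto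
        show "continuous_on {u..v} ?\<phi>'" by (rule continuous_on_subset[OF c\<phi>' sub])
      qed (use uv l \<delta> r dA cA' big sign amp in auto)
      also have "\<dots> = ?B" by (simp add: field_simps)
      finally show ?thesis unfolding eq .
    qed
  qed (use B0 in auto)
  also have "\<dots> \<le> (5 * b) * ?B" by (rule mult_right_mono[OF cardP B0])
  also have "\<dots> = 100 * b * M\<^sup>2 / (l * \<delta>) / ?r" by simp
  finally show ?thesis unfolding iterated_kernel_eq_integral(2)[OF shell_kernel] .
qed

definition cell_count where "cell_count = (2 * real a + 1) * ((4 ^ (a * a) * 2 / c) powr (1 / a) / \<kappa> + 2)"

definition shell_const where
  "shell_const = 8 * (M\<^sup>2 * (2 * y_measure_const)) powr (1/4) * (100 * b * M\<^sup>2) powr (3/4) * \<kappa> powr (1/4)"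

text \<open>The two bounds for the operator balance at the scale \<open>\<delta>\<close> with \<open>l \<delta>\<^bsup>\<sigma>\<^esup> = 1\<close>.\<close>

definition \<sigma> where "\<sigma> = 1 + 1 / real a + 1 / real b"

lemma constants_nonneg: "0 \<le> x_measure_const" "0 \<le> y_measure_const" "0 \<le> cell_count" "0 \<le> shell_const"
  using \<kappa> unfolding x_measure_const_def y_measure_const_def cell_count_def shell_const_def by (auto intro!: mult_nonneg_nonneg add_nonneg_nonneg)

lemma \<sigma>_bounds: "1 < \<sigma>" "\<sigma> \<le> 3"
proof -
  have "0 < 1 / real a" "0 < 1 / real b" "1 / real a \<le> 1" "1 / real b \<le> 1" using ab by auto
  then show "1 < \<sigma>" "\<sigma> \<le> 3" unfolding \<sigma>_def by linarith+
qed

lemma sublevel_slice_borel: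
  assumes "t \<in> {0..1}"
  shows "{y\<in>{0..1}. \<bar>F (t, y)\<bar> \<le> \<delta>} \<in> sets lborel" "{x\<in>{0..1}. \<bar>F (x, t)\<bar> \<le> \<delta>} \<in> sets lborel"
proof -
  have "closed {y\<in>{0..1}. \<bar>F (t, y)\<bar> \<le> \<delta>}"
    by (intro continuous_on_closed_Collect_le continuous_intros continuous_on_square_slices(1)[OF F_continuous assms] closed_atLeastAtMost)
  then show "{y\<in>{0..1}. \<bar>F (t, y)\<bar> \<le> \<delta>} \<in> sets lborel" by simp
  have "closed {x\<in>{0..1}. \<bar>F (x, t)\<bar> \<le> \<delta>}"
    by (intro continuous_on_closed_Collect_le continuous_intros continuous_on_square_slices(2)[OF F_continuous assms] closed_atLeastAtMost)
  then show "{x\<in>{0..1}. \<bar>F (x, t)\<bar> \<le> \<delta>} \<in> sets lborel" by simp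
qed

text \<open>
  Only the \<open>y\<close> with \<open>\<bar>F(x,y)\<bar> \<le> 2 \<delta>\<close> contribute, and they form a set of measure
  \<open>O(\<delta>\<^bsup>1/b\<^esup>)\<close>.
\<close>

lemma shell_iterated_kernel_size:
  assumes s: "s \<in> {1, -1}" and \<delta>: "0 < \<delta>"
  shows "norm (iterated_kernel (shell_kernel l s \<delta>) (x, x')) \<le> M\<^sup>2 * (2 * y_measure_const) * \<delta> powr (1 / b)"
proof -
  let ?k = "shell_kernel l s \<delta>"
  note b = square_kernelD(2)[OF shell_kernel]
  show ?thesis
  proof (cases "x \<in> {0..1}")
    case False
    then have "(x, x') \<notin> unit_square" by (auto simp: unit_square_def)
    then have "iterated_kernel ?k (x, x') = 0" by (rule square_kernelD(3)[OF square_kernel_iterated[OF shell_kernel]])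
    then show ?thesis using constants_nonneg by simp
  next
    case True
    let ?E = "{y\<in>{0..1}. \<bar>F (x, y)\<bar> \<le> 2 * \<delta>}"
    let ?f = "\<lambda>y. ?k (x, y) * cnj (?k (x', y))"
    have i: "integrable lborel ?f" by (rule square_kernel_product_integrable[OF shell_kernel])
    have "norm (iterated_kernel ?k (x, x')) \<le> (LINT y|lborel. norm (?f y))"
      unfolding iterated_kernel_def prod.case by (rule integral_norm_bound)
    also have "\<dots> \<le> M\<^sup>2 * measure lborel ?E"
    proof (rule integral_indicator_le[OF i sublevel_slice_borel(1)[OF True]])
      show "norm (?f y) \<le> M\<^sup>2" for y
        unfolding norm_mult power2_eq_square complex_mod_cnj by (intro mult_mono' b norm_ge_zero)
      show "?f y = 0" if "y \<notin> ?E" for y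
        using that s by (auto simp: shell_kernel_def shell_def unit_square_def split: split_indicator)
    qed auto
    also have "measure lborel ?E \<le> y_measure_const * (2 * \<delta>) powr (1 / b)"
      unfolding y_measure_const_def by (rule measure_F_y_le) (use True \<delta> in auto)
    also have "(2 * \<delta>) powr (1 / b) = 2 powr (1 / b) * \<delta> powr (1 / b)"
      using \<delta> by (simp add: powr_mult)
    also have "2 powr (1 / b) \<le> (2 :: real) powr 1"
      using ab by (intro powr_mono) auto
    finally show ?thesis
      using constants_nonneg by (simp add: mult_left_mono mult_right_mono mult_ac)
  qed
qed

text \<open>
  Apart from the last factor this is the bound \<open>O((l \<delta>)\<^bsup>-1/2\<^esup>)\<close> of a nondegenerate phase.
  The factor \<open>l \<delta>\<^bsup>\<sigma>\<^esup>\<close> measures the distance from the critical scale and is the price for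
  using decay of first order only.
\<close>

lemma shell_bound:
  assumes s: "s \<in> {1, -1}" and \<delta>: "0 < \<delta>" and l: "0 < l"
  shows "bilinear_bound (shell_kernel l s \<delta>)
    (sqrt (cell_count * (shell_const * (1 / (l * \<delta>) * (l * \<delta> powr \<sigma>) powr (1/4)))))"
proof -
  let ?k = "shell_kernel l s \<delta>"
  let ?K = "iterated_kernel ?k"
  let ?\<epsilon> = "\<kappa> * \<delta> powr (1 / a)"
  let ?U = "M\<^sup>2 * (2 * y_measure_const) * \<delta> powr (1 / b)"
  let ?V = "100 * b * M\<^sup>2 / (l * \<delta>)"
  let ?B = "?U powr (1/4) * ?V powr (3/4)"
  let ?A = "8 * ?B * ?\<epsilon> powr (1/4)"
  have \<epsilon>: "0 < ?\<epsilon>" using \<kappa> \<delta> by simp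
  have A: "?A = shell_const * (1 / (l * \<delta>) * (l * \<delta> powr \<sigma>) powr (1/4))"
  proof -
    have "?U powr (1/4) = (M\<^sup>2 * (2 * y_measure_const)) powr (1/4) * (\<delta> powr (1 / b)) powr (1/4)"
      using constants_nonneg by (simp add: powr_mult)
    moreover have "?V = (100 * b * M\<^sup>2) * (1 / (l * \<delta>))" by simp
    then have "?V powr (3/4) = (100 * b * M\<^sup>2) powr (3/4) * (1 / (l * \<delta>)) powr (3/4)"
      using l \<delta> by (simp only: powr_mult)
    moreover have "?\<epsilon> powr (1/4) = \<kappa> powr (1/4) * (\<delta> powr (1 / a)) powr (1/4)"
      using \<kappa> by (simp add: powr_mult)
    ultimately have "?A = shell_const * ((\<delta> powr (1 / b)) powr (1/4) * (1 / (l * \<delta>)) powr (3/4) * (\<delta> powr (1 / a)) powr (1/4))"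
      unfolding shell_const_def by (simp only: mult_ac)
    then show ?thesis unfolding shell_powr_identity[OF l \<delta>] \<sigma>_def .
  qed
  have A0: "0 \<le> ?A" by simp
  have K: "square_kernel (M\<^sup>2) ?K" by (rule square_kernel_iterated[OF shell_kernel])
  have TT: "(L2_norm (transposed_op ?k g))\<^sup>2 \<le> cell_count * ?A * (L2_norm g)\<^sup>2" if g: "g \<in> L2_space" for g
  proof (rule localized_TT_star_bound[OF shell_kernel g \<epsilon> A0])
    fix y :: real assume y: "y \<in> {0..1}"
    let ?f = "\<lambda>x. \<lfloor>x / ?\<epsilon>\<rfloor>"
    have fin: "finite (?f ` {x\<in>{0..1}. \<bar>F (x, y)\<bar> \<le> 2 * \<delta>})"
      by (rule finite_subset[of _ "{?f 0..?f 1}"])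
         (use \<epsilon> in \<open>auto intro!: floor_mono divide_right_mono simp del: div_by_0\<close>)
    have "card (?f ` {x\<in>{0..1}. ?k (x, y) \<noteq> 0}) \<le> card (?f ` {x\<in>{0..1}. \<bar>F (x, y)\<bar> \<le> 2 * \<delta>})"
      using s by (intro card_mono[OF fin] image_mono) (auto simp: shell_kernel_def shell_def split: split_indicator_asm)
    then show "real (card (?f ` {x\<in>{0..1}. ?k (x, y) \<noteq> 0})) \<le> cell_count"
      using card_cells_le[OF y \<delta>] unfolding cell_count_def by linarith
  next
    fix x :: real assume x: "x \<in> {0..1}"
    let ?cell = "{x'. \<lfloor>x' / ?\<epsilon>\<rfloor> = \<lfloor>x / ?\<epsilon>\<rfloor>}"
    have near: "\<bar>t - x\<bar> \<le> ?\<epsilon>" if "t \<in> ?cell" for t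
    proof -
      have "\<lfloor>t / ?\<epsilon>\<rfloor> = \<lfloor>x / ?\<epsilon>\<rfloor>" using that by simp
      then have "\<bar>t / ?\<epsilon> - x / ?\<epsilon>\<bar> \<le> 1" by linarith
      then have "\<bar>(t - x) / ?\<epsilon>\<bar> \<le> 1" by (simp only: diff_divide_distrib)
      then show ?thesis using \<epsilon> by (simp only: abs_divide abs_of_pos pos_divide_le_eq mult_1)
    qed
    have [measurable]: "?cell \<in> sets borel" by measurable
    have int: "integrable lborel (\<lambda>t. indicator ?cell t * norm (?K (x, t)))"
      using integrable_mult_indicator[OF _ integrable_norm[OF square_kernel_section_integrable(1)[OF K, of x]], of ?cell]
      by simp
    show "(LINT t|lborel. indicator ?cell t * norm (?K (x, t))) \<le> ?A"
    proof (rule integral_le_powr_singularity[OF int \<epsilon>, where x = x and B = ?B])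
      fix t assume "?\<epsilon> < \<bar>t - x\<bar>"
      then show "indicator ?cell t * norm (?K (x, t)) = 0" using near[of t] by (auto split: split_indicator)
    next
      fix t assume t: "\<bar>t - x\<bar> \<le> ?\<epsilon>" "t \<noteq> x"
      have "norm (?K (x, t)) \<le> ?B * \<bar>t - x\<bar> powr (-3/4)"
      proof (cases "t \<in> {0..1}")
        case False
        then have "(x, t) \<notin> unit_square" by (auto simp: unit_square_def)
        then have "?K (x, t) = 0" by (rule square_kernelD(3)[OF K])
        then show ?thesis by simp
      next
        case True
        have dec: "norm (?K (x, t)) \<le> ?V / \<bar>t - x\<bar>"
        proof (cases "t < x")
          case True
          then show ?thesis using shell_iterated_kernel_decay[OF s \<delta> l, of t x] x t \<open>t \<in> {0..1}\<close> by simp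
        next
          case False
          then show ?thesis
            using shell_iterated_kernel_decay[OF s \<delta> l, of x t] x t True by (simp add: norm_iterated_kernel_sym[of _ x t])
        qed
        have "norm (?K (x, t)) \<le> ?U powr (1/4) * (?V / \<bar>t - x\<bar>) powr (3/4)"
          by (rule le_geometric_mean[OF norm_ge_zero shell_iterated_kernel_size[OF s \<delta>] dec])
        also have "(?V / \<bar>t - x\<bar>) powr (3/4) = ?V powr (3/4) * \<bar>t - x\<bar> powr (-3/4)"
          using t l \<delta> by (subst powr_divide) (auto simp: powr_minus_divide)
        finally show ?thesis by (simp only: mult.assoc)
      qed
      moreover have "indicator ?cell t * norm (?K (x, t)) \<le> norm (?K (x, t))" by (auto split: split_indicator)
      ultimately show "indicator ?cell t * norm (?K (x, t)) \<le> ?B * \<bar>t - x\<bar> powr (-3/4)" by linarith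
    qed
  qed
  show ?thesis
    unfolding bilinear_bound_def A[symmetric]
    by (intro ballI bilinear_form_le_transposed[OF shell_kernel] TT mult_nonneg_nonneg constants_nonneg A0)
qed

section \<open>Summation over the shells\<close>

definition core_kernel :: "real \<Rightarrow> real \<Rightarrow> real \<times> real \<Rightarrow> complex"
  where "core_kernel l \<delta> p = indicator {p \<in> unit_square. \<bar>F p\<bar> \<le> \<delta>} p * osc_kernel S chi l p"

lemma core_kernel: "square_kernel M (core_kernel l \<delta>)"
  unfolding core_kernel_def
  by (intro square_kernel_restrict[OF osc_kernel_is_square_kernel] sublevel_borel continuous_intros F_continuous)

lemma core_bound:
  assumes \<delta>: "0 < \<delta>"
  shows "bilinear_bound (core_kernel l \<delta>) (sqrt (M * (y_measure_const * \<delta> powr (1 / b)) * (M * (x_measure_const * \<delta> powr (1 / a)))))"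
  unfolding bilinear_bound_def
proof (intro ballI Schur_test[OF core_kernel])
  have M0: "0 \<le> M" using M_ge_1 by simp
  note k = square_kernelD(2)[OF core_kernel]
  fix x :: real assume x: "x \<in> {0..1}"
  have "(LINT y|lborel. norm (core_kernel l \<delta> (x, y))) \<le> M * measure lborel {y\<in>{0..1}. \<bar>F (x, y)\<bar> \<le> \<delta>}"
    by (rule integral_indicator_le[OF square_kernel_section_integrable(1)[OF core_kernel] sublevel_slice_borel(1)[OF x] _ k _ M0])
       (auto simp: core_kernel_def unit_square_def split: split_indicator)
  also have "\<dots> \<le> M * (y_measure_const * \<delta> powr (1 / b))"
    unfolding y_measure_const_def by (intro mult_left_mono measure_F_y_le x \<delta> M0)
  finally show "(LINT y|lborel. norm (core_kernel l \<delta> (x, y))) \<le> M * (y_measure_const * \<delta> powr (1 / b))" .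
  have "(LINT t|lborel. norm (core_kernel l \<delta> (t, x))) \<le> M * measure lborel {t\<in>{0..1}. \<bar>F (t, x)\<bar> \<le> \<delta>}"
    by (rule integral_indicator_le[OF square_kernel_section_integrable(2)[OF core_kernel] sublevel_slice_borel(2)[OF x] _ k _ M0])
       (auto simp: core_kernel_def unit_square_def split: split_indicator)
  also have "\<dots> \<le> M * (x_measure_const * \<delta> powr (1 / a))"
    unfolding x_measure_const_def by (intro mult_left_mono measure_F_x_le x \<delta> M0)
  finally show "(LINT t|lborel. norm (core_kernel l \<delta> (t, x))) \<le> M * (x_measure_const * \<delta> powr (1 / a))" .
qed

lemma core_kernel_double:
  assumes "0 < \<delta>"
  shows "core_kernel l (2 * \<delta>) = (\<lambda>p. core_kernel l \<delta> p + (shell_kernel l 1 \<delta> p + shell_kernel l (-1) \<delta> p))"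
proof
  fix p
  have "indicator {p \<in> unit_square. \<bar>F p\<bar> \<le> 2 * \<delta>} p
    = (indicator {p \<in> unit_square. \<bar>F p\<bar> \<le> \<delta>} p + (indicator (shell 1 \<delta>) p + indicator (shell (-1) \<delta>) p) :: complex)"
    using assms by (auto simp: indicator_def shell_def abs_if split: if_splits)
  then show "core_kernel l (2 * \<delta>) p = core_kernel l \<delta> p + (shell_kernel l 1 \<delta> p + shell_kernel l (-1) \<delta> p)"
    unfolding core_kernel_def shell_kernel_def by (simp only: distrib_right)
qed

text \<open>
  Doubling the sublevel set \<open>n\<close> times, from the critical scale \<open>d\<close> until it is the whole
  square, adds the shells at \<open>2\<^sup>j d\<close>. With \<open>l d\<^bsup>\<sigma>\<^esup> = 1\<close> the shell bound is \<open>(l d)\<^bsup>-1/2\<^esup>\<close>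
  times \<open>2\<close> to the power \<open>-j/2 + j \<sigma>/8\<close>, and \<open>\<sigma> \<le> 3\<close> makes this at most \<open>2\<^bsup>-j/8\<^esup>\<close>.
\<close>

theorem degenerate_phase_bound:
  "\<exists>C\<ge>0. \<forall>l\<ge>1. bilinear_bound (osc_kernel S chi l) (C * l powr (- ((1 / a + 1 / b) / (2 * (1 + 1 / a + 1 / b)))))"
proof -
  define \<rho> :: real where "\<rho> = 2 powr (-1/8)"
  have \<rho>: "0 < \<rho>" "\<rho> < 1" unfolding \<rho>_def using powr_less_mono[of "-1/8" 0 "2::real"] by auto
  define C0 where "C0 = M * sqrt (x_measure_const * y_measure_const)"
  define C1 where "C1 = 2 * sqrt (cell_count * shell_const)"
  define C where "C = C0 + C1 / (1 - \<rho>)"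
  have C0: "0 \<le> C0" and C1: "0 \<le> C1" using M_ge_1 constants_nonneg by (auto simp: C0_def C1_def)
  then have C: "0 \<le> C" using \<rho> by (simp add: C_def)
  have main: "bilinear_bound (osc_kernel S chi l) (C * l powr (- ((1 / a + 1 / b) / (2 * (1 + 1 / a + 1 / b)))))"
    if l: "1 \<le> l" for l
  proof -
    define d where "d = l powr (-1/\<sigma>)"
    have d: "0 < d" using l by (simp add: d_def)
    have "d powr \<sigma> = l powr (-1)" unfolding d_def powr_powr using \<sigma>_bounds by simp
    then have ld: "l * d powr \<sigma> = 1" using l by (simp add: powr_minus_divide)
    define Q where "Q = sqrt (1 / (l * d))"
    have Q0: "0 \<le> Q" using l d by (simp add: Q_def)
    have Q: "Q = l powr (- ((1 / a + 1 / b) / (2 * (1 + 1 / a + 1 / b))))"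
    proof -
      have "1 / (l * d) = l powr (-(1 - 1/\<sigma>))"
      proof -
        have "l powr (-(1 - 1/\<sigma>)) = l powr (1/\<sigma>) / l powr 1" using l by (simp add: powr_diff)
        then show ?thesis unfolding d_def using l by (simp add: powr_minus_divide)
      qed
      moreover have "Q = (1 / (l * d)) powr (1/2)"
        unfolding Q_def using l d by (intro powr_half_sqrt[symmetric]) auto
      ultimately have "Q = l powr (-(1 - 1/\<sigma>) * (1/2))" by (simp only: powr_powr)
      also have "-(1 - 1/\<sigma>) * (1/2) = - ((\<sigma> - 1) / (2 * \<sigma>))"
        using \<sigma>_bounds by (simp add: field_simps)
      also have "\<dots> = - ((1 / a + 1 / b) / (2 * (1 + 1 / a + 1 / b)))"
        by (simp add: \<sigma>_def)
      finally show ?thesis .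
    qed
    have core: "bilinear_bound (core_kernel l d) (C0 * Q)"
    proof -
      have "(d powr (1 / b) * d powr (1 / a)) * (l * d) = l * (d powr 1 * d powr (1 / a) * d powr (1 / b))"
        using d by (simp add: mult_ac)
      also have "\<dots> = 1" using ld unfolding \<sigma>_def powr_add .
      finally have "d powr (1 / b) * d powr (1 / a) = 1 / (l * d)"
        using l d by (subst eq_divide_eq) simp
      moreover have "M * (y_measure_const * d powr (1 / b)) * (M * (x_measure_const * d powr (1 / a)))
          = M\<^sup>2 * (x_measure_const * y_measure_const) * (d powr (1 / b) * d powr (1 / a))"
        by (simp add: power2_eq_square mult_ac)
      ultimately have "sqrt (M * (y_measure_const * d powr (1 / b)) * (M * (x_measure_const * d powr (1 / a)))) = C0 * Q"
        unfolding C0_def Q_def using M_ge_1 by (simp only: real_sqrt_mult real_sqrt_abs)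
      then show ?thesis using core_bound[OF d, of l] by simp
    qed
    have sh: "bilinear_bound (shell_kernel l s (2 ^ j * d)) (C1 / 2 * Q * \<rho> ^ j)" if s: "s \<in> {1, -1}" for s j
    proof -
      let ?d = "2 ^ j * d"
      have "l * ?d powr \<sigma> = (2 ^ j) powr \<sigma> * (l * d powr \<sigma>)" using d by (simp add: powr_mult)
      also have "\<dots> = (2 powr real j) powr \<sigma>" unfolding ld by (simp add: powr_realpow)
      also have "\<dots> = 2 powr (j * \<sigma>)" by (rule powr_powr)
      finally have "(l * ?d powr \<sigma>) powr (1/4) = 2 powr (j * \<sigma> / 4)" by (simp add: powr_powr)
      also have "\<dots> \<le> 2 powr (j * 3 / 4)" using \<sigma>_bounds by (intro powr_mono) (auto intro!: divide_right_mono mult_left_mono)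
      finally have "1 / (l * ?d) * (l * ?d powr \<sigma>) powr (1/4) \<le> 1 / (l * ?d) * 2 powr (j * 3 / 4)"
        using l d by (intro mult_left_mono) auto
      also have "\<dots> = 1 / (l * d) * (2 powr (- real j) * 2 powr (j * 3 / 4))"
        by (simp add: powr_minus_divide powr_realpow)
      also have "2 powr (- real j) * 2 powr (j * 3 / 4) = (2 powr (- real j / 4) :: real)"
        by (simp flip: powr_add)
      also have "\<dots> = (\<rho> ^ j)\<^sup>2"
      proof -
        have "\<rho> ^ j = \<rho> powr j" using \<rho> by (simp add: powr_realpow)
        also have "\<dots> = 2 powr (-1/8 * j)" unfolding \<rho>_def by (rule powr_powr)
        finally show ?thesis unfolding power2_eq_square by (simp flip: powr_add)
      qed
      finally have le: "1 / (l * ?d) * (l * ?d powr \<sigma>) powr (1/4) \<le> 1 / (l * d) * (\<rho> ^ j)\<^sup>2" .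
      have "sqrt (cell_count * (shell_const * (1 / (l * ?d) * (l * ?d powr \<sigma>) powr (1/4))))
          \<le> sqrt (cell_count * (shell_const * (1 / (l * d) * (\<rho> ^ j)\<^sup>2)))"
        by (intro real_sqrt_le_mono mult_left_mono le constants_nonneg)
      also have "\<dots> = C1 / 2 * Q * \<rho> ^ j"
        unfolding C1_def Q_def using \<rho> by (simp add: real_sqrt_mult real_sqrt_divide)
      finally show ?thesis
        using d l by (intro bilinear_bound_mono[OF shell_bound[OF s]]) auto
    qed
    have step: "bilinear_bound (core_kernel l (2 ^ n * d)) (C0 * Q + (\<Sum>j<n. C1 * Q * \<rho> ^ j))" for n
    proof (induction n)
      case 0
      then show ?case using core by simp
    next
      case (Suc n)
      have "square_kernel (M + M) (\<lambda>p. shell_kernel l 1 (2 ^ n * d) p + shell_kernel l (-1) (2 ^ n * d) p)"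
        by (rule square_kernel_add[OF shell_kernel shell_kernel])
      moreover have "bilinear_bound (\<lambda>p. shell_kernel l 1 (2 ^ n * d) p + shell_kernel l (-1) (2 ^ n * d) p)
          (C1 / 2 * Q * \<rho> ^ n + C1 / 2 * Q * \<rho> ^ n)"
        by (intro bilinear_bound_add[OF shell_kernel shell_kernel] sh) auto
      ultimately have "bilinear_bound (core_kernel l (2 * (2 ^ n * d)))
          ((C0 * Q + (\<Sum>j<n. C1 * Q * \<rho> ^ j)) + (C1 / 2 * Q * \<rho> ^ n + C1 / 2 * Q * \<rho> ^ n))"
        using d by (subst core_kernel_double) (auto intro!: bilinear_bound_add[OF core_kernel _ Suc])
      then show ?case by (simp add: mult.assoc add.assoc)
    qed
    obtain B where B: "\<And>p. p \<in> unit_square \<Longrightarrow> norm (F p) \<le> B" using square_bounded[OF F_continuous] by blast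
    obtain n where n: "B / d < 2 ^ n" using real_arch_pow[of 2 "B / d"] by auto
    have all: "core_kernel l (2 ^ n * d) = osc_kernel S chi l"
    proof
      fix p
      have "B \<le> 2 ^ n * d" using n d by (simp add: divide_less_eq)
      then have "p \<in> {p \<in> unit_square. \<bar>F p\<bar> \<le> 2 ^ n * d}" if "p \<in> unit_square"
        using that B[OF that] by simp
      then show "core_kernel l (2 ^ n * d) p = osc_kernel S chi l p"
        by (cases "p \<in> unit_square") (auto simp: core_kernel_def osc_kernel_def chi_zero)
    qed
    have "(\<Sum>j<n. \<rho> ^ j) \<le> 1 / (1 - \<rho>)"
      using sum_le_suminf[of "\<lambda>j. \<rho> ^ j" "{..<n}"] \<rho> by (simp add: suminf_geometric summable_geometric)
    then have "C1 * Q * (\<Sum>j<n. \<rho> ^ j) \<le> C1 * Q * (1 / (1 - \<rho>))"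
      using C1 Q0 by (intro mult_left_mono) auto
    moreover have "C * Q = C0 * Q + C1 * Q * (1 / (1 - \<rho>))"
      by (simp add: C_def distrib_right)
    ultimately have "C0 * Q + (\<Sum>j<n. C1 * Q * \<rho> ^ j) \<le> C * Q"
      unfolding sum_distrib_left[symmetric] by linarith
    then show ?thesis
      using bilinear_bound_mono[OF step[of n]] unfolding all Q by blast
  qed
  then show ?thesis using C by blast
qed

end

section \<open>The nondegenerate phase\<close>

lemma zero_of_support_slice:
  fixes h :: "real \<Rightarrow> complex"
  assumes h: "continuous_on UNIV h" and z: "\<And>t. t \<notin> {0..1} \<Longrightarrow> h t = 0"
  shows "h 0 = 0" "h 1 = 0"
proof -
  have "open {t. h t \<noteq> 0}" using h by (intro open_Collect_neq continuous_on_const)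
  moreover have "{t. h t \<noteq> 0} \<subseteq> {0..1}" using z by blast
  ultimately have "{t. h t \<noteq> 0} \<subseteq> interior {0..1}" by (rule interior_maximal[rotated])
  then show "h 0 = 0" "h 1 = 0" by auto
qed

lemma has_integral_arctan:
  fixes x l :: real
  assumes l: "0 < l"
  shows "((\<lambda>t. 1 / (1 + (l * (t - x))\<^sup>2)) has_integral (arctan (l * (1 - x)) / l - arctan (l * (0 - x)) / l)) {0..1}"
proof (rule fundamental_theorem_of_calculus)
  fix t :: real
  have "((\<lambda>t. arctan (l * (t - x)) / l) has_real_derivative (inverse (1 + (l * (t - x))\<^sup>2) * l) / l) (at t within {0..1})"
    by (rule DERIV_cdivide) (auto intro!: derivative_eq_intros)
  then have "((\<lambda>t. arctan (l * (t - x)) / l) has_real_derivative 1 / (1 + (l * (t - x))\<^sup>2)) (at t within {0..1})"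
    using l by (simp add: inverse_eq_divide)
  then show "((\<lambda>t. arctan (l * (t - x)) / l) has_vector_derivative 1 / (1 + (l * (t - x))\<^sup>2)) (at t within {0..1})"
    by (simp add: has_real_derivative_iff_has_vector_derivative)
qed simp

context osc_data
begin

lemma chi_y_smooth: "smooth_on UNIV (partial_y UNIV chi)"
  by (rule smooth_on_partial_y[OF chi_smooth])

lemma slice_continuous:
  assumes "continuous_on UNIV g"
  shows "continuous_on t (\<lambda>y. g (x, y))"
  by (rule continuous_on_compose2[OF assms]) (auto intro!: continuous_intros)

text \<open>These values remove the boundary terms in both integrations by parts.\<close>

lemma chi_boundary: "chi (x, 0) = 0" "chi (x, 1) = 0"
proof -
  have z: "chi (x, t) = 0" if "t \<notin> {0..1}" for t
    using that by (intro chi_zero) (auto simp: unit_square_def)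
  show "chi (x, 0) = 0" "chi (x, 1) = 0"
    by (rule zero_of_support_slice[of "\<lambda>t. chi (x, t)"]; use z in \<open>auto intro!: slice_continuous chi_continuous\<close>)+
qed

lemma chi_y_boundary: "partial_y UNIV chi (x, 0) = 0" "partial_y UNIV chi (x, 1) = 0"
proof -
  have z: "partial_y UNIV chi (x, t) = 0" if t: "t \<notin> {0..1}" for t
  proof -
    have "((\<lambda>t. 0) has_vector_derivative partial_y UNIV chi (x, t)) (at t)"
    proof (rule has_vector_derivative_transform_within_open[where f = "\<lambda>t. chi (x, t)" and S = "- {0..1}"])
      show "((\<lambda>t. chi (x, t)) has_vector_derivative partial_y UNIV chi (x, t)) (at t)" by (rule chi_deriv)
      show "chi (x, y) = 0" if "y \<in> - {0..1}" for y
        using that by (intro chi_zero) (auto simp: unit_square_def)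
    qed (use t in \<open>auto intro: open_Compl\<close>)
    then show ?thesis using vector_derivative_unique_at has_vector_derivative_const by blast
  qed
  show "partial_y UNIV chi (x, 0) = 0" "partial_y UNIV chi (x, 1) = 0"
    by (rule zero_of_support_slice[of "\<lambda>t. partial_y UNIV chi (x, t)"];
        use z in \<open>auto intro!: slice_continuous smooth_on_imp_continuous_on[OF chi_y_smooth]\<close>)+
qed

lemma nondegenerate_kernel_decay:
  assumes k: "0 < k" "k \<le> 1" and Fk: "\<And>p. p \<in> unit_square \<Longrightarrow> k \<le> \<bar>F p\<bar>"
    and chi_yy: "\<And>p. p \<in> unit_square \<Longrightarrow> norm (partial_y UNIV (partial_y UNIV chi) p) \<le> M"
    and F_y: "\<And>p. p \<in> unit_square \<Longrightarrow> \<bar>partial_y unit_square F p\<bar> \<le> M"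
    and F_yy: "\<And>p. p \<in> unit_square \<Longrightarrow> \<bar>partial_y unit_square (partial_y unit_square F) p\<bar> \<le> M"
    and x: "0 \<le> x1" "x1 < x2" "x2 \<le> 1" and l: "0 < l"
  shows "norm (iterated_kernel (osc_kernel S chi l) (x2, x1)) \<le> 8 * (4 * M\<^sup>2) ^ 3 / (k ^ 4 * (l * (x2 - x1))\<^sup>2)"
proof -
  let ?\<Phi> = "\<lambda>y. S (x2, y) - S (x1, y)"
  let ?I = "\<lambda>G y. integral {x1..x2} (\<lambda>u. G (u, y))"
  let ?Fy = "partial_y unit_square F" and ?Fyy = "partial_y unit_square (partial_y unit_square F)"
  let ?c1 = "partial_y UNIV chi" and ?c2 = "partial_y UNIV (partial_y UNIV chi)"
  let ?A = "\<lambda>y. chi (x2, y) * cnj (chi (x1, y))"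
  let ?A' = "\<lambda>y. chi (x2, y) * cnj (?c1 (x1, y)) + ?c1 (x2, y) * cnj (chi (x1, y))"
  let ?A'' = "\<lambda>y. (chi (x2, y) * cnj (?c2 (x1, y)) + ?c1 (x2, y) * cnj (?c1 (x1, y)))
     + (?c1 (x2, y) * cnj (?c1 (x1, y)) + ?c2 (x2, y) * cnj (chi (x1, y)))"
  have c1d: "((\<lambda>t. ?c1 (z, t)) has_vector_derivative ?c2 (z, y)) (at y within s)" for z y s
    using partial_derivatives(2)[OF chi_y_smooth, of z y] by (auto intro: has_vector_derivative_at_within)
  have gen: "((\<lambda>y. ?I G y) has_real_derivative ?I (partial_y unit_square G) y) (at y within {0..1})"
    if "smooth_on unit_square G" "y \<in> {0..1}" for G y
    using x that by (intro slice_integral_derivative) auto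
  have q: "(u, y) \<in> unit_square" if "u \<in> {x1..x2}" "y \<in> {0..1}" for u y
    using that x by (auto simp: unit_square_def)
  have up: "\<bar>?I G y\<bar> \<le> 4 * M\<^sup>2 * (x2 - x1)"
    if G: "smooth_on unit_square G" "y \<in> {0..1}" and b: "\<And>p. p \<in> unit_square \<Longrightarrow> \<bar>G p\<bar> \<le> M" for G y
  proof -
    have "norm (?I G y) \<le> integral {x1..x2} (\<lambda>u. M)"
      by (rule integral_norm_bound_integral[OF slice_integrable[OF smooth_on_imp_continuous_on[OF G(1)] x(1,3) G(2)] integrable_const_ivl]) (use b q G in auto)
    also have "\<dots> = M * (x2 - x1)" using x by simp
    also have "\<dots> \<le> 4 * M\<^sup>2 * (x2 - x1)"
      using x M_ge_1 self_le_power[OF M_ge_1, of 2] by (intro mult_right_mono) auto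
    finally show ?thesis by simp
  qed
  have low: "k * (x2 - x1) \<le> \<bar>?I F y\<bar>" if y: "y \<in> {0..1}" for y
    using x by (intro slice_integral_lower_bound[OF F_continuous Fk k(1)] y) auto
  have pr: "norm (p * cnj q) \<le> M\<^sup>2" if "norm p \<le> M" "norm q \<le> M" for p q
    using mult_mono'[OF that] by (simp add: norm_mult power2_eq_square)
  have M2: "1 \<le> M\<^sup>2" using M_ge_1 by (rule one_le_power)
  have amp: "norm (?A y) \<le> 4 * M\<^sup>2" "norm (?A' y) \<le> 4 * M\<^sup>2" "norm (?A'' y) \<le> 4 * M\<^sup>2" if y: "y \<in> {0..1}" for y
  proof -
    have q1: "(x1, y) \<in> unit_square" and q2: "(x2, y) \<in> unit_square" using q[of x1 y] q[of x2 y] x y by auto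
    note b1 = chi_le[OF q1] chi_y_le[OF q1] chi_yy[OF q1] and b2 = chi_le[OF q2] chi_y_le[OF q2] chi_yy[OF q2]
    show "norm (?A y) \<le> 4 * M\<^sup>2" using pr[OF b2(1) b1(1)] M2 by linarith
    show "norm (?A' y) \<le> 4 * M\<^sup>2"
      using norm_triangle_mono[OF pr[OF b2(1) b1(2)] pr[OF b2(2) b1(1)]] M2 by linarith
    show "norm (?A'' y) \<le> 4 * M\<^sup>2"
      using norm_triangle_mono[OF norm_triangle_mono[OF pr[OF b2(1) b1(3)] pr[OF b2(2) b1(2)]]
          norm_triangle_mono[OF pr[OF b2(2) b1(2)] pr[OF b2(3) b1(1)]]] by linarith
  qed
  have "norm (integral {0..1} (\<lambda>y. exp (\<i> * complex_of_real (l * ?\<Phi> y)) * ?A y)) \<le> 8 * (4 * M\<^sup>2) ^ 3 / (k ^ 4 * (l * (x2 - x1))\<^sup>2)"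
  proof (rule oscillatory_second_order[where \<phi> = "?I F" and \<phi>' = "?I ?Fy" and \<phi>'' = "?I ?Fyy" and a' = ?A' and a'' = ?A''])
    show "(?\<Phi> has_real_derivative ?I F y) (at y within {0..1})" if "y \<in> {0..1}" for y
      unfolding F_eq using x that by (intro phase_difference_derivative[OF S_smooth]) auto
    show "(?I F has_real_derivative ?I ?Fy y) (at y within {0..1})" if "y \<in> {0..1}" for y
      by (rule gen[OF F_smooth that])
    show "(?I ?Fy has_real_derivative ?I ?Fyy y) (at y within {0..1})" if "y \<in> {0..1}" for y
      by (rule gen[OF smooth_on_partial_y[OF F_smooth] that])
    show "continuous_on {0..1} (?I ?Fyy)"
      by (rule DERIV_continuous_on[OF gen[OF smooth_on_partial_y[OF smooth_on_partial_y[OF F_smooth]]]])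
    show "(?A has_vector_derivative ?A' y) (at y within {0..1})" for y
      by (intro has_vector_derivative_times_cnj chi_deriv)
    show "(?A' has_vector_derivative ?A'' y) (at y within {0..1})" for y
      by (intro has_vector_derivative_add has_vector_derivative_times_cnj chi_deriv c1d)
    show "continuous_on {0..1} ?A''"
      by (intro continuous_intros slice_continuous smooth_on_imp_continuous_on smooth_on_partial_y chi_smooth)
    show "\<bar>?I ?Fy y\<bar> \<le> 4 * M\<^sup>2 * (x2 - x1)" if "y \<in> {0..1}" for y
      by (rule up[OF smooth_on_partial_y[OF F_smooth] that F_y])
    show "\<bar>?I ?Fyy y\<bar> \<le> 4 * M\<^sup>2 * (x2 - x1)" if "y \<in> {0..1}" for y
      by (rule up[OF smooth_on_partial_y[OF smooth_on_partial_y[OF F_smooth]] that F_yy])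
  qed (use l k x low amp M2 chi_boundary chi_y_boundary in auto)
  then show ?thesis
    unfolding iterated_kernel_eq_integral(2)[OF osc_kernel_is_square_kernel] osc_kernel_times_cnj by simp
qed

text \<open>
  The decay \<open>(l r)\<^bsup>-2\<^esup>\<close> and the trivial bound combine to a multiple of
  \<open>1 / (1 + (l r)\<^sup>2)\<close>, whose integral is at most \<open>\<pi>/l\<close>.
\<close>

theorem nondegenerate_phase_bound:
  assumes F0: "\<And>p. p \<in> unit_square \<Longrightarrow> F p \<noteq> 0"
    and chi_yy: "\<And>p. p \<in> unit_square \<Longrightarrow> norm (partial_y UNIV (partial_y UNIV chi) p) \<le> M"
    and F_y: "\<And>p. p \<in> unit_square \<Longrightarrow> \<bar>partial_y unit_square F p\<bar> \<le> M"
    and F_yy: "\<And>p. p \<in> unit_square \<Longrightarrow> \<bar>partial_y unit_square (partial_y unit_square F) p\<bar> \<le> M"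
  shows "\<exists>C\<ge>0. \<forall>l\<ge>1. bilinear_bound (osc_kernel S chi l) (C * l powr (- (1 / 2)))"
proof -
  obtain k' where k': "0 < k'" "\<And>p. p \<in> unit_square \<Longrightarrow> k' \<le> \<bar>F p\<bar>"
    using square_bounded_below[OF F_continuous F0] by blast
  define k where "k = min 1 k'"
  have k: "0 < k" "k \<le> 1" "\<And>p. p \<in> unit_square \<Longrightarrow> k \<le> \<bar>F p\<bar>"
    using k' by (auto simp: k_def min_le_iff_disj)
  define D where "D = 8 * (4 * M\<^sup>2) ^ 3 / k ^ 4"
  have D: "0 \<le> D" using k by (simp add: D_def)
  define C where "C = sqrt ((M\<^sup>2 + D) * pi)"
  have "bilinear_bound (osc_kernel S chi l) (C * l powr (- (1 / 2)))" if l1: "1 \<le> l" for l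
  proof -
    have l: "0 < l" using l1 by simp
    let ?K = "iterated_kernel (osc_kernel S chi l)"
    have K: "square_kernel (M\<^sup>2) ?K" by (rule square_kernel_iterated[OF osc_kernel_is_square_kernel])
    note Kle = square_kernelD(2)[OF K]
    have dec: "norm (?K (x, t)) \<le> (M\<^sup>2 + D) * (1 / (1 + (l * (t - x))\<^sup>2))"
      if xt: "x \<in> {0..1}" "t \<in> {0..1}" for x t
    proof -
      have "norm (?K (x, t)) * (l * (t - x))\<^sup>2 \<le> D"
      proof (cases "t = x")
        case False
        have ord: "norm (?K (u, v)) * (l * (u - v))\<^sup>2 \<le> D" if "v < u" "0 \<le> v" "u \<le> 1" for u v
        proof -
          have "norm (?K (u, v)) \<le> 8 * (4 * M\<^sup>2) ^ 3 / (k ^ 4 * (l * (u - v))\<^sup>2)"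
            by (rule nondegenerate_kernel_decay[OF k chi_yy F_y F_yy that(2,1,3) l])
          also have "\<dots> = D / (l * (u - v))\<^sup>2" by (simp add: D_def)
          finally show ?thesis using l that by (simp add: pos_le_divide_eq)
        qed
        show ?thesis
        proof (cases "t < x")
          case True
          then show ?thesis using ord[of t x] xt by (simp add: power2_commute power_mult_distrib)
        next
          case False
          then show ?thesis using ord[of x t] xt \<open>t \<noteq> x\<close> by (simp add: norm_iterated_kernel_sym[of _ x t])
        qed
      qed (use D in simp)
      then have "norm (?K (x, t)) * (1 + (l * (t - x))\<^sup>2) \<le> M\<^sup>2 + D"
        using Kle[of "(x, t)"] by (simp add: distrib_left)
      moreover have "0 < 1 + (l * (t - x))\<^sup>2" by (simp add: add_pos_nonneg)
      ultimately show ?thesis by (simp add: pos_le_divide_eq)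
    qed
    have A: "(LINT t|lborel. norm (?K (x, t))) \<le> (M\<^sup>2 + D) * pi / l" if x: "x \<in> {0..1}" for x
    proof -
      have int: "integrable lborel (\<lambda>t. norm (?K (x, t)))"
        by (intro integrable_norm square_kernel_section_integrable(1)[OF K])
      have "(\<lambda>t. if t \<in> {0..1} then norm (?K (x, t)) else 0) = (\<lambda>t. norm (?K (x, t)))"
        using K by (auto simp: square_kernel_def unit_square_def fun_eq_iff)
      then have "((\<lambda>t. norm (?K (x, t))) has_integral (LINT t|lborel. norm (?K (x, t)))) {0..1}"
        using has_integral_integral_lborel[OF int] has_integral_restrict_UNIV[of "{0..1}" "\<lambda>t. norm (?K (x, t))"] by simp
      from has_integral_le[OF this has_integral_mult_right[OF has_integral_arctan[OF l]] dec[OF x]]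
      have "(LINT t|lborel. norm (?K (x, t))) \<le> (M\<^sup>2 + D) * (arctan (l * (1 - x)) / l - arctan (l * (0 - x)) / l)" .
      also have "\<dots> \<le> (M\<^sup>2 + D) * (pi / l)"
      proof (intro mult_left_mono)
        have "arctan (l * (1 - x)) - arctan (l * (0 - x)) \<le> pi"
          using arctan_bounded[of "l * (1 - x)"] arctan_bounded[of "l * (0 - x)"] by linarith
        then show "arctan (l * (1 - x)) / l - arctan (l * (0 - x)) / l \<le> pi / l"
          unfolding diff_divide_distrib[symmetric] using l by (intro divide_right_mono) auto
      qed (use D in auto)
      finally show ?thesis by simp
    qed
    have "bilinear_bound (osc_kernel S chi l) (sqrt ((M\<^sup>2 + D) * pi / l))"
      unfolding bilinear_bound_def
      using D l by (intro ballI bilinear_form_le_transposed[OF osc_kernel_is_square_kernel] TT_star_bound[OF osc_kernel_is_square_kernel] A) auto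
    moreover have "sqrt ((M\<^sup>2 + D) * pi / l) = C * l powr (- (1 / 2))"
      using l by (simp add: C_def real_sqrt_divide powr_minus_divide powr_half_sqrt)
    ultimately show ?thesis by simp
  qed
  moreover have "0 \<le> C" using D by (simp add: C_def)
  ultimately show ?thesis by blast
qed

end

section \<open>Both parts of the theorem\<close>

text \<open>
  On an interval of length \<open>\<delta> / (2 B)\<close> a function with derivative at most \<open>B\<close> changes by
  at most \<open>\<delta>/2\<close>.
\<close>

lemma no_dip_first_order:
  fixes g g' :: "real \<Rightarrow> real"
  assumes d: "\<And>t. t \<in> {0..1} \<Longrightarrow> (g has_real_derivative g' t) (at t within {0..1})"
    and B: "\<And>t. t \<in> {0..1} \<Longrightarrow> \<bar>g' t\<bar> \<le> B" and "1 \<le> B"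
    and x: "0 \<le> x1" "x1 \<le> u" "u \<le> x2" "x2 \<le> 1" and near: "x2 - x1 \<le> 1 / (2 * B) * \<delta>"
    and g1: "\<delta> < g x1"
  shows "\<delta> / 2 \<le> g u"
proof (cases "x1 = u")
  case True
  have "0 < \<delta> \<or> \<delta> \<le> 0" by linarith
  moreover have "0 \<le> 1 / (2 * B) * \<delta>" using near x by linarith
  then have "0 \<le> \<delta>" using \<open>1 \<le> B\<close> by (simp add: zero_le_divide_iff)
  ultimately show ?thesis using True g1 by auto
next
  case False
  then have "x1 < u" using x by simp
  then obtain z where z: "z \<in> {x1<..<u}" "g u - g x1 = g' z * (u - x1)"
    using mean_value_within[OF _ _ d, of x1 u] x by auto
  have "\<bar>g' z * (u - x1)\<bar> \<le> B * (u - x1)"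
    using B[of z] z(1) x by (simp add: abs_mult mult_right_mono)
  also have "\<dots> \<le> B * (1 / (2 * B) * \<delta>)"
    using near x \<open>1 \<le> B\<close> by (intro mult_left_mono) auto
  also have "\<dots> = \<delta> / 2" using \<open>1 \<le> B\<close> by simp
  finally show ?thesis using z(2) g1 by linarith
qed

text \<open>
  If \<open>g\<close> dipped below \<open>\<delta>/2\<close> between two points of height above \<open>\<delta>\<close> at distance \<open>h\<close>, then
  \<open>g'\<close> would rise from below \<open>-\<delta>/(2h)\<close> to above \<open>\<delta>/(2h)\<close>, hence by more than \<open>\<delta>/h\<close>, while
  it can rise by at most \<open>B h\<close>, and \<open>B h\<^sup>2 < \<delta>\<close>.
\<close>

lemma no_dip_second_order:
  fixes g g' g'' :: "real \<Rightarrow> real"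
  assumes d: "\<And>t. t \<in> {0..1} \<Longrightarrow> (g has_real_derivative g' t) (at t within {0..1})"
    and d': "\<And>t. t \<in> {0..1} \<Longrightarrow> (g' has_real_derivative g'' t) (at t within {0..1})"
    and B: "\<And>t. t \<in> {0..1} \<Longrightarrow> \<bar>g'' t\<bar> \<le> B" and "1 \<le> B" and \<delta>: "0 < \<delta>"
    and x: "0 \<le> x1" "x1 \<le> u" "u \<le> x2" "x2 \<le> 1" and near: "x2 - x1 \<le> 1 / (2 * B) * sqrt \<delta>"
    and g1: "\<delta> < g x1" and g2: "\<delta> < g x2"
  shows "\<delta> / 2 \<le> g u"
proof (rule ccontr)
  assume "\<not> \<delta> / 2 \<le> g u"
  then have gu: "g u < \<delta> / 2" by simp
  then have "x1 \<noteq> u" "u \<noteq> x2" using g1 g2 \<delta> by auto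
  then have lt: "x1 < u" "u < x2" using x by auto
  obtain z1 where z1: "z1 \<in> {x1<..<u}" "g u - g x1 = g' z1 * (u - x1)" using mean_value_within[OF lt(1) _ d] x lt by auto
  obtain z2 where z2: "z2 \<in> {u<..<x2}" "g x2 - g u = g' z2 * (x2 - u)" using mean_value_within[OF lt(2) _ d] x lt by auto
  have "z1 < z2" "{z1..z2} \<subseteq> {0..1}" using z1 z2 x by auto
  then obtain z3 where z3: "z3 \<in> {z1<..<z2}" "g' z2 - g' z1 = g'' z3 * (z2 - z1)"
    using mean_value_within[OF _ _ d'] by blast
  let ?h = "x2 - x1"
  have h: "0 < ?h" using lt by simp
  have s1: "g' z1 * (u - x1) < - \<delta> / 2" using z1(2) g1 gu by linarith
  have n1: "g' z1 < 0"
  proof (rule ccontr)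
    assume "\<not> g' z1 < 0"
    then have "0 \<le> g' z1 * (u - x1)" using lt by (intro mult_nonneg_nonneg) auto
    then show False using s1 \<delta> by linarith
  qed
  have "g' z1 * ?h \<le> g' z1 * (u - x1)" using n1 lt by (intro mult_left_mono_neg) auto
  then have 1: "g' z1 * ?h < - \<delta> / 2" using s1 by linarith
  have s2: "\<delta> / 2 < g' z2 * (x2 - u)" using z2(2) g2 gu by linarith
  have n2: "0 < g' z2"
  proof (rule ccontr)
    assume "\<not> 0 < g' z2"
    then have "g' z2 * (x2 - u) \<le> 0" using lt by (intro mult_nonpos_nonneg) auto
    then show False using s2 \<delta> by linarith
  qed
  have "g' z2 * (x2 - u) \<le> g' z2 * ?h" using n2 lt by (intro mult_left_mono) auto
  then have 2: "\<delta> / 2 < g' z2 * ?h" using s2 by linarith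
  have "\<delta> < (g' z2 - g' z1) * ?h" using 1 2 by (simp add: left_diff_distrib)
  also have "g' z2 - g' z1 \<le> B * ?h"
  proof -
    have "g'' z3 * (z2 - z1) \<le> B * (z2 - z1)"
      using B[of z3] z1 z2 z3 x by (intro mult_right_mono) auto
    also have "\<dots> \<le> B * ?h" using z1 z2 \<open>1 \<le> B\<close> by (intro mult_left_mono) auto
    finally show ?thesis using z3(2) by simp
  qed
  then have "(g' z2 - g' z1) * ?h \<le> B * ?h * ?h" using h by (intro mult_right_mono) auto
  also have "\<dots> \<le> B * (1 / (2 * B) * sqrt \<delta>) * (1 / (2 * B) * sqrt \<delta>)"
    using near h \<open>1 \<le> B\<close> \<delta> by (intro mult_mono mult_left_mono) auto
  also have "\<dots> = \<delta> / (4 * B)" using \<open>1 \<le> B\<close> \<delta> by simp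
  also have "\<dots> \<le> \<delta>" using \<open>1 \<le> B\<close> \<delta> by (simp add: divide_le_eq)
  finally show False by simp
qed

theorem theorem5p1:
  fixes S F :: "real \<times> real \<Rightarrow> real" and chi :: "real \<times> real \<Rightarrow> complex"
  assumes S_smooth: "smooth_on unit_square S"
    and F_eq: "F = partial_x unit_square (partial_y unit_square S)"
    and chi_smooth: "smooth_on UNIV chi"
    and chi_support: "closure {p. chi p \<noteq> 0} \<subseteq> unit_square"
  shows
    "(\<forall>B::nat.
        (\<forall>p\<in>unit_square. mixed_partial unit_square 1 0 F p \<noteq> 0) \<longrightarrow>
        (\<forall>p\<in>unit_square. mixed_partial unit_square 0 B F p \<noteq> 0) \<longrightarrow>
        (\<exists>C::real. \<forall>l::real. l \<ge> 1 \<longrightarrow>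
           L2_bounded_linear (osc_op S chi l) \<and>
           L2_onorm (osc_op S chi l) \<le> C * l powr (- ((real B + 1) / (2 * (2 * real B + 1)))))) \<and>
     ((\<forall>p\<in>unit_square. mixed_partial unit_square 2 0 F p \<noteq> 0) \<longrightarrow>
      (\<forall>p\<in>unit_square. mixed_partial unit_square 0 2 F p \<noteq> 0) \<longrightarrow>
        (\<exists>C::real. \<forall>l::real. l \<ge> 1 \<longrightarrow>
           L2_bounded_linear (osc_op S chi l) \<and>
           L2_onorm (osc_op S chi l) \<le> C * l powr (- (1 / 4))))"
proof -
  let ?Q = "unit_square"
  have F: "smooth_on ?Q F" unfolding F_eq by (intro smooth_on_partial_x smooth_on_partial_y S_smooth)
  note Fx = smooth_on_partial_x[OF F] and Fy = smooth_on_partial_y[OF F]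
  note Fxx = smooth_on_partial_x[OF Fx] and Fyy = smooth_on_partial_y[OF Fy]
  note c1 = smooth_on_partial_y[OF chi_smooth]
  note c2 = smooth_on_partial_y[OF c1]
  have bdF: "\<exists>M\<ge>1. \<forall>p\<in>?Q. \<bar>G p\<bar> \<le> M" if "smooth_on ?Q G" for G :: "real \<times> real \<Rightarrow> real"
    using square_bounded[OF smooth_on_imp_continuous_on[OF that]] by (metis real_norm_def)
  have bdc: "\<exists>M\<ge>1. \<forall>p\<in>?Q. norm (G p) \<le> M" if "smooth_on UNIV G" for G :: "real \<times> real \<Rightarrow> complex"
    using square_bounded[OF continuous_on_subset[OF smooth_on_imp_continuous_on[OF that]]] by (metis subset_UNIV)
  obtain m1 m2 m3 m4 m5 m6 m7 where m: "\<forall>p\<in>?Q. norm (chi p) \<le> m1" "\<forall>p\<in>?Q. norm (partial_y UNIV chi p) \<le> m2"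
    "\<forall>p\<in>?Q. norm (partial_y UNIV (partial_y UNIV chi) p) \<le> m3"
    "\<forall>p\<in>?Q. \<bar>partial_y ?Q F p\<bar> \<le> m4" "\<forall>p\<in>?Q. \<bar>partial_y ?Q (partial_y ?Q F) p\<bar> \<le> m5"
    "\<forall>p\<in>?Q. \<bar>partial_x ?Q F p\<bar> \<le> m6" "\<forall>p\<in>?Q. \<bar>partial_x ?Q (partial_x ?Q F) p\<bar> \<le> m7"
    "1 \<le> m1" "1 \<le> m2" "1 \<le> m3" "1 \<le> m4" "1 \<le> m5" "1 \<le> m6" "1 \<le> m7"
    using bdc[OF chi_smooth] bdc[OF c1] bdc[OF c2] bdF[OF Fy] bdF[OF Fyy] bdF[OF Fx] bdF[OF Fxx] by blast
  define M where "M = m1 + m2 + m3 + m4 + m5 + m6 + m7"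
  have M1: "1 \<le> M" and le: "m1 \<le> M" "m2 \<le> M" "m3 \<le> M" "m4 \<le> M" "m5 \<le> M" "m6 \<le> M" "m7 \<le> M"
    using m(8-) by (auto simp: M_def)
  have bM: "norm (chi p) \<le> M" "norm (partial_y UNIV chi p) \<le> M"
    "norm (partial_y UNIV (partial_y UNIV chi) p) \<le> M"
    "\<bar>partial_y ?Q F p\<bar> \<le> M" "\<bar>partial_y ?Q (partial_y ?Q F) p\<bar> \<le> M"
    "\<bar>partial_x ?Q F p\<bar> \<le> M" "\<bar>partial_x ?Q (partial_x ?Q F) p\<bar> \<le> M" if "p \<in> ?Q" for p
    using m(1-7) that le order_trans by blast+
  interpret osc_data S F chi M
    using S_smooth F_eq chi_smooth chi_support M1 bM by unfold_locales auto
  have inQ: "(x, y) \<in> ?Q" if "x \<in> {0..1}" "y \<in> {0..1}" for x y using that by (auto simp: unit_square_def)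
  have conclude: "\<exists>C::real. \<forall>l::real. l \<ge> 1 \<longrightarrow> L2_bounded_linear (osc_op S chi l) \<and> L2_onorm (osc_op S chi l) \<le> C * l powr (- e)"
    if "\<exists>C\<ge>0. \<forall>l\<ge>1. bilinear_bound (osc_kernel S chi l) (C * l powr (- e))" for e
  proof -
    from that obtain C where C: "0 \<le> C" "\<And>l. 1 \<le> l \<Longrightarrow> bilinear_bound (osc_kernel S chi l) (C * l powr (- e))" by blast
    have "L2_bounded_linear (osc_op S chi l) \<and> L2_onorm (osc_op S chi l) \<le> C * l powr (- e)" if "1 \<le> l" for l
      by (rule L2_operator_bound[OF osc_kernel_is_square_kernel C(2)[OF that]]) (use C in auto)
    then show ?thesis by blast
  qed
  have below: "\<exists>c>0. \<forall>p\<in>?Q. c \<le> \<bar>G p\<bar> \<and> c \<le> \<bar>H p\<bar>"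
    if G: "smooth_on ?Q G" "\<forall>p\<in>?Q. G p \<noteq> 0" and H: "smooth_on ?Q H" "\<forall>p\<in>?Q. H p \<noteq> 0" for G H :: "real \<times> real \<Rightarrow> real"
  proof -
    obtain cG cH where c: "0 < cG" "\<And>p. p \<in> ?Q \<Longrightarrow> cG \<le> \<bar>G p\<bar>" "0 < cH" "\<And>p. p \<in> ?Q \<Longrightarrow> cH \<le> \<bar>H p\<bar>"
      using square_bounded_below[OF smooth_on_imp_continuous_on[OF G(1)]] square_bounded_below[OF smooth_on_imp_continuous_on[OF H(1)]]
        G(2) H(2) by metis
    then show ?thesis by (intro exI[of _ "min cG cH"]) (auto simp: min_le_iff_disj)
  qed
  show ?thesis
  proof (intro conjI allI impI)
    fix B :: nat
    assume A1: "\<forall>p\<in>?Q. mixed_partial ?Q 1 0 F p \<noteq> 0" and A2: "\<forall>p\<in>?Q. mixed_partial ?Q 0 B F p \<noteq> 0"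
    have "\<exists>C\<ge>0. \<forall>l\<ge>1. bilinear_bound (osc_kernel S chi l) (C * l powr (- ((real B + 1) / (2 * (2 * real B + 1)))))"
    proof (cases "B = 0")
      case True
      have "F p \<noteq> 0" if "p \<in> ?Q" for p using A2 that True by (auto simp: mixed_partial_def)
      from nondegenerate_phase_bound[OF this bM(3,4,5)] show ?thesis using True by simp
    next
      case False
      obtain c where c: "0 < c" "\<And>p. p \<in> ?Q \<Longrightarrow> c \<le> \<bar>((partial_x ?Q ^^ 1) F) p\<bar>"
          "\<And>p. p \<in> ?Q \<Longrightarrow> c \<le> \<bar>((partial_y ?Q ^^ B) F) p\<bar>"
        using below[OF smooth_on_partial_x_funpow[OF F, of 1] _ smooth_on_partial_y_funpow[OF F, of B]] A1 A2
        unfolding mixed_partial_def by (metis funpow_0)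
      interpret degenerate_phase S F chi M 1 B c "1 / (2 * M)"
      proof unfold_locales
        fix s \<delta> x1 x2 u y :: real
        assume s: "s \<in> {1, -1}" and \<delta>: "0 < \<delta>" and x: "0 \<le> x1" "x1 \<le> u" "u \<le> x2" "x2 \<le> 1" and y: "y \<in> {0..1}"
          and near: "x2 - x1 \<le> 1 / (2 * M) * \<delta> powr (1 / real 1)" and g: "\<delta> < s * F (x1, y)"
        show "\<delta> / 2 \<le> s * F (u, y)"
        proof (rule no_dip_first_order[where g = "\<lambda>t. s * F (t, y)" and g' = "\<lambda>t. s * partial_x ?Q F (t, y)"
              and B = M and ?x1.0 = x1 and ?x2.0 = x2])
          show "((\<lambda>t. s * F (t, y)) has_real_derivative s * partial_x ?Q F (t, y)) (at t within {0..1})" if "t \<in> {0..1}" for t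
            using F_slice_deriv_x[OF that y, of 0] by (intro DERIV_cmult) simp
          show "\<bar>s * partial_x ?Q F (t, y)\<bar> \<le> M" if "t \<in> {0..1}" for t
            using bM(6)[OF inQ[OF that y]] s by (auto simp: abs_mult)
          show "x2 - x1 \<le> 1 / (2 * M) * \<delta>" using near \<delta> by simp
        qed (use M1 x g in auto)
      qed (use c False M1 in auto)
      have e: "1 / real 1 + 1 / real B = (real B + 1) / B" "1 + 1 / real 1 + 1 / real B = (2 * real B + 1) / B"
        using False by (simp_all add: field_simps)
      have "(1 / real 1 + 1 / real B) / (2 * (1 + 1 / real 1 + 1 / real B)) = (real B + 1) / (2 * (2 * real B + 1))"
        unfolding e using False by simp
      then show ?thesis using degenerate_phase_bound by (simp only:)
    qed
    then show "\<exists>C. \<forall>l\<ge>1. L2_bounded_linear (osc_op S chi l) \<and> L2_onorm (osc_op S chi l) \<le> C * l powr (- ((real B + 1) / (2 * (2 * real B + 1))))"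
      by (rule conclude)
  next
    assume A1: "\<forall>p\<in>?Q. mixed_partial ?Q 2 0 F p \<noteq> 0" and A2: "\<forall>p\<in>?Q. mixed_partial ?Q 0 2 F p \<noteq> 0"
    obtain c where c: "0 < c" "\<And>p. p \<in> ?Q \<Longrightarrow> c \<le> \<bar>((partial_x ?Q ^^ 2) F) p\<bar>"
        "\<And>p. p \<in> ?Q \<Longrightarrow> c \<le> \<bar>((partial_y ?Q ^^ 2) F) p\<bar>"
      using below[OF smooth_on_partial_x_funpow[OF F, of 2] _ smooth_on_partial_y_funpow[OF F, of 2]] A1 A2
      unfolding mixed_partial_def by (metis funpow_0)
    interpret degenerate_phase S F chi M 2 2 c "1 / (2 * M)"
    proof unfold_locales
      fix s \<delta> x1 x2 u y :: real
      assume s: "s \<in> {1, -1}" and \<delta>: "0 < \<delta>" and x: "0 \<le> x1" "x1 \<le> u" "u \<le> x2" "x2 \<le> 1" and y: "y \<in> {0..1}"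
        and near: "x2 - x1 \<le> 1 / (2 * M) * \<delta> powr (1 / real 2)" and g: "\<delta> < s * F (x1, y)" "\<delta> < s * F (x2, y)"
      show "\<delta> / 2 \<le> s * F (u, y)"
      proof (rule no_dip_second_order[where g = "\<lambda>t. s * F (t, y)" and g' = "\<lambda>t. s * partial_x ?Q F (t, y)"
            and g'' = "\<lambda>t. s * partial_x ?Q (partial_x ?Q F) (t, y)" and B = M and ?x1.0 = x1 and ?x2.0 = x2])
        show "((\<lambda>t. s * F (t, y)) has_real_derivative s * partial_x ?Q F (t, y)) (at t within {0..1})" if "t \<in> {0..1}" for t
          using F_slice_deriv_x[OF that y, of 0] by (intro DERIV_cmult) simp
        show "((\<lambda>t. s * partial_x ?Q F (t, y)) has_real_derivative s * partial_x ?Q (partial_x ?Q F) (t, y)) (at t within {0..1})" if "t \<in> {0..1}" for t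
          using F_slice_deriv_x[OF that y, of 1] by (intro DERIV_cmult) simp
        show "\<bar>s * partial_x ?Q (partial_x ?Q F) (t, y)\<bar> \<le> M" if "t \<in> {0..1}" for t
          using bM(7)[OF inQ[OF that y]] s by (auto simp: abs_mult)
        show "x2 - x1 \<le> 1 / (2 * M) * sqrt \<delta>" using near \<delta> by (simp add: powr_half_sqrt)
      qed (use M1 \<delta> x g in auto)
    qed (use c M1 in auto)
    have "\<exists>C\<ge>0. \<forall>l\<ge>1. bilinear_bound (osc_kernel S chi l) (C * l powr (- (1 / 4)))"
      using degenerate_phase_bound by simp
    then show "\<exists>C. \<forall>l\<ge>1. L2_bounded_linear (osc_op S chi l) \<and> L2_onorm (osc_op S chi l) \<le> C * l powr (- (1 / 4))"
      by (rule conclude)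
  qed
qed

end
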